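(* Let $\alpha\in[2,\frac{15}{7})$ and $\bar s=(s_1,s_2)\in\mathbb{R}^2$. Then there exists no $T>0$ such that the Cauchy problem $$\partial_t u-\partial_xD_x^\alpha u-\partial_x^{-1}\Delta_yu=\partial_x(u^2)\quad\text{on }\mathbb{R}^3,\qquad u(0)=u_0,$$ admits a unique local solution defined on the interval $[-T,T]$ such that the flow map $$\Gamma:u_0\mapsto u$$ is $C^2$-differentiable at zero as a map from $H^{\bar s}(\mathbb{R}^3)$ to $C([-T,T];H^{\bar s}(\mathbb{R}^3))$.
   Context: Points of $\mathbb{R}^3$ are $(x,y)$ with $x\in\mathbb{R}$, $y\in\mathbb{R}^2$, and dual variables are $(\xi,\eta)\in\mathbb{R}\times\mathbb{R}^2$. $D_x^\alpha$ is the Fourier multiplier $|\xi|^\alpha$, $\partial_x^{-1}$ is the Fourier multiplier $(i\xi)^{-1}$, $\Delta_y=\partial_{y_1}^2+\partial_{y_2}^2$. The anisotropic Sobolev space $H^{\bar s}(\mathbb{R}^3)=H^{s_1,s_2}(\mathbb{R}^3)$ has norm $\|\phi\|_{H^{s_1,s_2}}=\|\langle\xi\rangle^{s_1}\langle\eta\rangle^{s_2}\hat\phi(\xi,\eta)\|_{L^2_{\xi,\eta}}$. Solutions are understood in the sense of Duhamel's formula $u(t)=S_\alpha(t)u_0+\int_0^tS_\alpha(t-t')\partial_x(u^2)(t')\,dt'$, with $\widehat{S_\alpha(t)u_0}(\xi,\eta)=e^{it(|\xi|^\alpha\xi+|\eta|^2/\xi)}\hat u_0(\xi,\eta)$. 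*)

theory Defs
  imports "HOL-Analysis.Analysis" "HOL-Library.Function_Algebras"
begin

section \<open>Normed spaces of functionals and maps of class \<open>C\<^sup>2\<close> at a point\<close>

instantiation "fun" :: (type, real_vector) real_vector
begin

definition scaleR_fun :: "real \<Rightarrow> ('a \<Rightarrow> 'b) \<Rightarrow> 'a \<Rightarrow> 'b"
  where "scaleR_fun c f = (\<lambda>x. c *\<^sub>R f x)"

instance
  by standard (auto simp: scaleR_fun_def fun_eq_iff algebra_simps)

end

text \<open>
  The Sobolev spaces below depend on real parameters, so they cannot be types.  A normed space
  is given by a linear subspace of an ambient real vector space, together with a norm on it.
\<close>

record 'a nspace =
  points :: "'a set"
  nrm :: "'a \<Rightarrow> real"

text \<open>
  Bounded real-linear maps with the operator norm.  Since HOL functions are total, they are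
  extended by zero outside the domain space.
\<close>

definition bounded_maps ::
    "('a::real_vector) nspace \<Rightarrow> ('b::real_vector) nspace \<Rightarrow> ('a \<Rightarrow> 'b) nspace" where
  "bounded_maps X Y = \<lparr>
     points = {L. (\<forall>h\<in>points X. L h \<in> points Y) \<and> (\<forall>h. h \<notin> points X \<longrightarrow> L h = 0) \<and>
                  (\<forall>h\<in>points X. \<forall>k\<in>points X. L (h + k) = L h + L k) \<and>
                  (\<forall>c. \<forall>h\<in>points X. L (c *\<^sub>R h) = c *\<^sub>R L h) \<and>
                  (\<exists>K. \<forall>h\<in>points X. nrm Y (L h) \<le> K * nrm X h)},
     nrm = (\<lambda>L. Inf {K. 0 \<le> K \<and> (\<forall>h\<in>points X. nrm Y (L h) \<le> K * nrm X h)})\<rparr>"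

definition has_frechet_derivative ::
    "('a::real_vector) nspace \<Rightarrow> ('b::real_vector) nspace \<Rightarrow> ('a \<Rightarrow> 'b) \<Rightarrow> ('a \<Rightarrow> 'b) \<Rightarrow> 'a \<Rightarrow> bool"
where
  "has_frechet_derivative X Y f L x \<longleftrightarrow>
     L \<in> points (bounded_maps X Y) \<and>
     (\<forall>\<epsilon>>0. \<exists>\<delta>>0. \<forall>h\<in>points X. nrm X h < \<delta> \<longrightarrow>
        f (x + h) \<in> points Y \<and> nrm Y (f (x + h) - f x - L h) \<le> \<epsilon> * nrm X h)"

text \<open>
  Twice Frechet differentiable in a neighbourhood of the point, with second derivative
  continuous at the point.  Only the values of the map near the point matter.
\<close>

definition C2_differentiable_at ::
    "('a::real_vector) nspace \<Rightarrow> ('b::real_vector) nspace \<Rightarrow> ('a \<Rightarrow> 'b) \<Rightarrow> 'a \<Rightarrow> bool" where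
  "C2_differentiable_at X Y f x \<longleftrightarrow>
     (\<exists>r>0. \<exists>f' f''.
        (\<forall>y\<in>points X. nrm X (y - x) < r \<longrightarrow>
           has_frechet_derivative X Y f (f' y) y \<and>
           has_frechet_derivative X (bounded_maps X Y) f' (f'' y) y) \<and>
        (\<forall>\<epsilon>>0. \<exists>\<delta>>0. \<forall>y\<in>points X. nrm X (y - x) < \<delta> \<longrightarrow>
           nrm (bounded_maps X (bounded_maps X Y)) (f'' y - f'' x) < \<epsilon>))"

text \<open>\<open>C([-T,T]; X)\<close> with the supremum norm; its elements are extended by zero outside \<open>[-T,T]\<close>.\<close>

definition continuous_curves ::
    "real \<Rightarrow> ('a::real_vector) nspace \<Rightarrow> (real \<Rightarrow> 'a) nspace" where
  "continuous_curves T X = \<lparr>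
     points = {u. (\<forall>t\<in>{-T..T}. u t \<in> points X) \<and> (\<forall>t. t \<notin> {-T..T} \<longrightarrow> u t = 0) \<and>
                  (\<forall>t\<in>{-T..T}. ((\<lambda>t'. nrm X (u t' - u t)) \<longlongrightarrow> 0) (at t within {-T..T}))},
     nrm = (\<lambda>u. SUP t\<in>{-T..T}. nrm X (u t))\<rparr>"

section \<open>Tempered distributions and the Fourier transform\<close>

text \<open>\<open>D [b\<^sub>1, \<dots>, b\<^sub>m]\<close> is the iterated partial derivative of \<open>f\<close> in the coordinate directions \<open>b\<^sub>i\<close>.\<close>

definition schwartz :: "('n::euclidean_space \<Rightarrow> complex) set" where
  "schwartz = {f. \<exists>D :: 'n list \<Rightarrow> 'n \<Rightarrow> complex. D [] = f \<and>
     (\<forall>bs\<in>lists Basis. \<forall>z. (D bs has_derivative (\<lambda>h. \<Sum>b\<in>Basis. (h \<bullet> b) *\<^sub>R D (b # bs) z)) (at z)) \<and>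
     (\<forall>bs\<in>lists Basis. \<forall>k::nat. bounded (range (\<lambda>z. norm z ^ k * norm (D bs z))))}"

text \<open>The points \<open>(x,y)\<close>, and the dual variables \<open>(\<xi>,\<eta>)\<close>.\<close>

type_synonym pt = "real \<times> (real ^ 2)"

text \<open>
  Distributions are functionals on Schwartz functions, extended by zero to all functions.
  Continuity is automatic for those that occur below, which are given by a function or by the
  inverse Fourier transform of a function.
\<close>

type_synonym distribution = "(pt \<Rightarrow> complex) \<Rightarrow> complex"

definition tempered_fun :: "(pt \<Rightarrow> complex) \<Rightarrow> bool" where
  "tempered_fun g \<longleftrightarrow>
     g \<in> borel_measurable borel \<and> (\<forall>\<psi>\<in>schwartz. integrable lborel (\<lambda>z. g z * \<psi> z))"

definition dist_of :: "(pt \<Rightarrow> complex) \<Rightarrow> distribution" where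
  "dist_of g = (\<lambda>\<psi>. if \<psi> \<in> schwartz then LINT z|lborel. g z * \<psi> z else 0)"

text \<open>
  Convention: \<open>\<phi>\<hat>(\<zeta>) = \<integral> e\<^bsup>-i z\<bullet>\<zeta>\<^esup> \<phi>(z) dz\<close>.  The following two
  are the inverse transform of a Schwartz function, and by duality
  \<open>\<langle>F\<^sup>-\<^sup>1 g, \<psi>\<rangle> = \<langle>g, F\<^sup>-\<^sup>1 \<psi>\<rangle>\<close> that of a function \<open>g\<close> as a tempered distribution.
\<close>

definition inv_fourier :: "(pt \<Rightarrow> complex) \<Rightarrow> pt \<Rightarrow> complex" where
  "inv_fourier \<psi> \<zeta> = (LINT z|lborel. cis (z \<bullet> \<zeta>) * \<psi> z) / of_real ((2 * pi) ^ 3)"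

definition inv_fourier_dist :: "(pt \<Rightarrow> complex) \<Rightarrow> distribution" where
  "inv_fourier_dist g =
     (\<lambda>\<psi>. if \<psi> \<in> schwartz then LINT \<zeta>|lborel. g \<zeta> * inv_fourier \<psi> \<zeta> else 0)"

text \<open>
  Only distributions whose Fourier transform is a function are transformed; that function is
  unique up to null sets, on which nothing below depends.
\<close>

definition has_fourier_fun :: "distribution \<Rightarrow> bool" where
  "has_fourier_fun u \<longleftrightarrow> (\<exists>g. tempered_fun g \<and> u = inv_fourier_dist g)"

definition fourier_fun :: "distribution \<Rightarrow> pt \<Rightarrow> complex" where
  "fourier_fun u = (SOME g. tempered_fun g \<and> u = inv_fourier_dist g)"

definition fourier_mult :: "(pt \<Rightarrow> complex) \<Rightarrow> distribution \<Rightarrow> distribution" where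
  "fourier_mult m u = inv_fourier_dist (\<lambda>\<zeta>. m \<zeta> * fourier_fun u \<zeta>)"

section \<open>Anisotropic Sobolev spaces\<close>

definition bracket :: "'n::real_normed_vector \<Rightarrow> real" where
  "bracket v = sqrt (1 + (norm v)\<^sup>2)"

definition sobolev_weight :: "real \<Rightarrow> real \<Rightarrow> pt \<Rightarrow> real" where
  "sobolev_weight s1 s2 = (\<lambda>(\<xi>, \<eta>). bracket \<xi> powr s1 * bracket \<eta> powr s2)"

definition sobolev :: "real \<Rightarrow> real \<Rightarrow> distribution nspace" where
  "sobolev s1 s2 = \<lparr>
     points = {u. \<exists>g. g \<in> borel_measurable borel \<and>
                      integrable lborel (\<lambda>\<zeta>. (sobolev_weight s1 s2 \<zeta> * norm (g \<zeta>))\<^sup>2) \<and>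
                      u = inv_fourier_dist g},
     nrm = (\<lambda>u. sqrt (LINT \<zeta>|lborel. (sobolev_weight s1 s2 \<zeta> * norm (fourier_fun u \<zeta>))\<^sup>2))\<rparr>"

definition real_valued :: "distribution \<Rightarrow> bool" where
  "real_valued u \<longleftrightarrow> (\<forall>\<psi>\<in>schwartz. u (\<lambda>z. cnj (\<psi> z)) = cnj (u \<psi>))"

definition real_sobolev :: "real \<Rightarrow> real \<Rightarrow> distribution nspace" where
  "real_sobolev s1 s2 = (sobolev s1 s2)\<lparr>points := {u \<in> points (sobolev s1 s2). real_valued u}\<rparr>"

section \<open>The dispersion-generalized KP-I equation\<close>

definition propagator :: "real \<Rightarrow> real \<Rightarrow> distribution \<Rightarrow> distribution" where
  "propagator \<alpha> t =
     fourier_mult (\<lambda>(\<xi>, \<eta>). cis (t * (\<bar>\<xi>\<bar> powr \<alpha> * \<xi> + (norm \<eta>)\<^sup>2 / \<xi>)))"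

definition deriv_x :: "distribution \<Rightarrow> distribution" where
  "deriv_x = fourier_mult (\<lambda>(\<xi>, \<eta>). \<i> * of_real \<xi>)"

text \<open>
  \<open>q = u\<^sup>2\<close>: the square is the pointwise one, so \<open>u\<close> has to be given by a function
  whose square is again a tempered distribution.
\<close>

definition is_square :: "distribution \<Rightarrow> distribution \<Rightarrow> bool" where
  "is_square u q \<longleftrightarrow>
     (\<exists>w. tempered_fun w \<and> tempered_fun (\<lambda>z. (w z)\<^sup>2) \<and> u = dist_of w \<and> q = dist_of (\<lambda>z. (w z)\<^sup>2))"

text \<open>
  Solutions in \<open>C([-T,T]; X)\<close> of Duhamel's formula
  \<open>u(t) = S\<^sub>\<alpha>(t) u\<^sub>0 + \<integral>\<^sub>0\<^sup>t S\<^sub>\<alpha>(t - t') \<partial>\<^sub>x(u\<^sup>2)(t') dt'\<close>, the time integral being that of a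
  family of distributions, i.e. taken after pairing with test functions.  The square
  \<open>q(t') = u(t')\<^sup>2\<close> is required to exist for almost every time; for \<open>s\<^sub>1, s\<^sub>2 \<ge> 0\<close> it always does.
\<close>

definition kp_solution :: "real \<Rightarrow> distribution nspace \<Rightarrow> real \<Rightarrow> distribution \<Rightarrow> (real \<Rightarrow> distribution) \<Rightarrow> bool" where
  "kp_solution \<alpha> X T u0 u \<longleftrightarrow>
     u \<in> points (continuous_curves T X) \<and>
     (\<exists>q :: real \<Rightarrow> distribution.
        (AE t' in lborel. t' \<in> {-T..T} \<longrightarrow> is_square (u t') (q t') \<and> has_fourier_fun (q t')) \<and>
        (\<forall>t\<in>{-T..T}. \<forall>\<psi>\<in>schwartz.
           interval_lebesgue_integrable lborel (ereal 0) (ereal t)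
             (\<lambda>t'. propagator \<alpha> (t - t') (deriv_x (q t')) \<psi>) \<and>
           u t \<psi> = propagator \<alpha> t u0 \<psi> +
             (LBINT t'=ereal 0..ereal t. propagator \<alpha> (t - t') (deriv_x (q t')) \<psi>)))"

end

theory Submission
  imports Defs "HOL-Probability.Characteristic_Functions" "HOL-Probability.Sinc_Integral"
begin

text \<open>
  If \<open>\<Gamma>\<close> is \<open>C\<^sup>2\<close> at zero, its second derivative is a bounded quadratic map.  For data whose Fourier
  transform \<open>f\<close> is bounded with compact support, Picard iteration started from \<open>\<epsilon> f\<close> yields a
  series in \<open>\<epsilon>\<close> that converges on all of \<open>[-T,T]\<close> and in every \<open>H\<^bsup>s1,s2\<^esup>\<close> when \<open>\<epsilon>\<close> is small: the
  \<open>n\<close>-th term lives on frequencies of size \<open>O(n)\<close>, so the derivative in the nonlinearity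
  costs a factor \<open>n\<close>, which the time integral of \<open>t\<^sup>n\<close> gives back.  By uniqueness the series is the
  flow map, whatever the sign of \<open>s\<^sub>1\<close> and \<open>s\<^sub>2\<close>; hence the second Picard iterate is bounded by the square of
  the norm of the datum, with a constant independent of the datum.

  This fails for the interaction of a box at frequency \<open>(\<gamma>, 0)\<close>, \<open>\<gamma> = N\<^bsup>(1-\<alpha>)/2\<^esup>\<close>, with one at
  \<open>(N, N \<rho>)\<close>, \<open>\<rho>\<^sup>2 = (\<alpha>+1) N\<^sup>\<alpha>\<close>, where the dispersion of the two terms cancels.  With side lengths
  \<open>\<gamma>\<close>, \<open>N\<^bsup>-\<alpha>/2\<^esup>\<close> and \<open>\<gamma>\<^bsup>1/2\<^esup>\<close> the resonance function stays bounded on the boxes, and the quadratic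
  estimate would bound \<open>N\<^sup>2\<close> times the volume of a box, a constant multiple of \<open>N\<^bsup>11/4-5\<alpha>/4\<^esup>\<close>.
\<close>

section \<open>Integrals over Euclidean space\<close>

text \<open>The scales come from the resonance function. For a low frequency (x, p) and a high one
  (y, r) it equals x^(\<alpha>+1) + y^(\<alpha>+1) - (x+y)^(\<alpha>+1) + |p y - r x|^2 / (x y
  (x+y)): the transverse part is nonnegative and the dispersive part is about -(\<alpha>+1)
  N^\<alpha> x, so that they can cancel. For p = 0 and |r| = N \<rho> the transverse part is about
  \<rho>^2 x, which fixes \<rho>. The remaining error is of size x^2 N^(\<alpha>-1), which fixes
  \<gamma>. A shift by \<kappa> in the first transverse coordinate enters linearly and changes the
  transverse part by about \<kappa> \<rho>; a shift m in the second one costs only m^2 / \<gamma>.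
  For boxes of volume q the datum has squared norm about q and the output has norm about N q^(3/2),
  whence the product N^2 q. The weights drop out: the high input and the output carry comparable
  ones, the low input a bounded one. The exponent 11/4 - 5/4 \<alpha> is positive for \<alpha> <
  11/5, hence for \<alpha> < 15/7.\<close>

lemma lborel_integral_affine_euclidean:
  fixes f :: "'a::euclidean_space \<Rightarrow> 'b::{banach,second_countable_topology}"
  assumes [measurable]: "f \<in> borel_measurable borel" and c: "c \<noteq> 0"
  shows "(LINT x|lborel. f (t + c *\<^sub>R x)) = (LINT x|lborel. f x) /\<^sub>R (\<bar>c\<bar> ^ DIM('a))"
    and "integrable lborel f \<Longrightarrow> integrable lborel (\<lambda>x. f (t + c *\<^sub>R x))"
proof -
  have "(LINT x|lborel. f x) = (LINT x|density (distr lborel borel (\<lambda>x. t + c *\<^sub>R x)) (\<lambda>_. ennreal (\<bar>c\<bar>^DIM('a))). f x)"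
    using lborel_affine[OF c, of t] by simp
  also have "\<dots> = (LINT x|distr lborel borel (\<lambda>x. t + c *\<^sub>R x). (\<bar>c\<bar>^DIM('a)) *\<^sub>R f x)"
    by (rule integral_density) auto
  also have "\<dots> = (LINT x|lborel. (\<bar>c\<bar>^DIM('a)) *\<^sub>R f (t + c *\<^sub>R x))"
    by (rule integral_distr) auto
  finally show "(LINT x|lborel. f (t + c *\<^sub>R x)) = (LINT x|lborel. f x) /\<^sub>R (\<bar>c\<bar> ^ DIM('a))"
    using c by simp
  assume "integrable lborel f"
  then have "integrable (density (distr lborel borel (\<lambda>x. t + c *\<^sub>R x)) (\<lambda>_. ennreal (\<bar>c\<bar>^DIM('a)))) f"
    using lborel_affine[OF c, of t] by simp
  then have "integrable (distr lborel borel (\<lambda>x. t + c *\<^sub>R x)) (\<lambda>x. (\<bar>c\<bar>^DIM('a)) *\<^sub>R f x)"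
    by (subst (asm) integrable_density) auto
  then have "integrable lborel (\<lambda>x. (\<bar>c\<bar>^DIM('a)) *\<^sub>R f (t + c *\<^sub>R x))"
    by (subst (asm) integrable_distr_eq) auto
  then have "integrable lborel (\<lambda>x. inverse (\<bar>c\<bar>^DIM('a)) *\<^sub>R ((\<bar>c\<bar>^DIM('a)) *\<^sub>R f (t + c *\<^sub>R x)))"
    by (rule integrable_scaleR_right)
  then show "integrable lborel (\<lambda>x. f (t + c *\<^sub>R x))"
    using c by simp
qed

lemma lborel_integral_reflect:
  fixes f :: "'a::euclidean_space \<Rightarrow> 'b::{banach,second_countable_topology}"
  assumes [measurable]: "f \<in> borel_measurable borel"
  shows "(LINT x|lborel. f (t - x)) = (LINT x|lborel. f x)"
    and "integrable lborel f \<Longrightarrow> integrable lborel (\<lambda>x. f (t - x))"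
  using lborel_integral_affine_euclidean[OF assms, of "-1" t] by auto

lemma lborel_integral_shift:
  fixes f :: "'a::euclidean_space \<Rightarrow> 'b::{banach,second_countable_topology}"
  assumes [measurable]: "f \<in> borel_measurable borel"
  shows "(LINT x|lborel. f (x + t)) = (LINT x|lborel. f x)"
    and "integrable lborel f \<Longrightarrow> integrable lborel (\<lambda>x. f (x + t))"
  using lborel_integral_affine_euclidean[OF assms, of "1" t] by (auto simp: add.commute)

lemma
  fixes f :: "'a::euclidean_space \<Rightarrow> real \<Rightarrow> 'b::{real_normed_field,banach,second_countable_topology}"
  assumes int: "\<And>b. b \<in> Basis \<Longrightarrow> integrable lborel (f b)"
  shows lborel_integral_prod: "(LINT x|lborel. (\<Prod>b\<in>Basis. f b (x \<bullet> b))) = (\<Prod>b\<in>Basis. LINT x|lborel. f b x)"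
    and lborel_integrable_prod: "integrable lborel (\<lambda>x. \<Prod>b\<in>Basis. f b (x \<bullet> b))"
proof -
  interpret product_sigma_finite "\<lambda>_::'a. lborel :: real measure" ..
  have [measurable]: "f b \<in> borel_measurable borel" if "b \<in> Basis" for b
    using borel_measurable_integrable[OF int[OF that]] by simp
  have m: "(\<lambda>g. \<Sum>b\<in>Basis. g b *\<^sub>R b) \<in> (\<Pi>\<^sub>M b\<in>(Basis::'a set). lborel) \<rightarrow>\<^sub>M borel"
    by measurable
  have m2: "(\<lambda>x. \<Prod>b\<in>Basis. f b (x \<bullet> b)) \<in> borel_measurable borel"
    by measurable
  have eq: "(\<Prod>b\<in>Basis. f b ((\<Sum>b\<in>Basis. g b *\<^sub>R b) \<bullet> b)) = (\<Prod>b\<in>Basis. f b (g b))" for g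
    by (rule prod.cong) (simp_all add: inner_sum_left inner_Basis if_distrib cong: if_cong)
  show "(LINT x|lborel. (\<Prod>b\<in>Basis. f b (x \<bullet> b))) = (\<Prod>b\<in>Basis. LINT x|lborel. f b x)"
    using product_integral_prod[OF finite_Basis, of f] int
    by (subst lborel_eq, subst integral_distr[OF m m2]) (simp add: eq)
  show "integrable lborel (\<lambda>x. \<Prod>b\<in>Basis. f b (x \<bullet> b))"
    using product_integrable_prod[OF finite_Basis, of f] int
    by (subst lborel_eq, subst integrable_distr_eq[OF m m2]) (simp add: eq)
qed

text \<open>Each factor \<open>1 + (x \<bullet> b)\<^sup>2\<close> is at most
  \<open>1 + (norm x)\<^sup>2\<close>, so the function lies below a product of integrable functions
  of one variable.\<close>

lemma integrable_inverse_1_plus_norm_sq: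
  "integrable lborel (\<lambda>z::'a::euclidean_space. inverse ((1 + (norm z)\<^sup>2) ^ DIM('a)))"
proof -
  have "integrable lborel (\<lambda>x::real. inverse (1 + x\<^sup>2))"
    using integrable_inverse_1_plus_square by (simp add: set_integrable_def)
  then have "integrable lborel (\<lambda>x::'a. \<Prod>b\<in>Basis. inverse (1 + (x \<bullet> b)\<^sup>2))"
    by (rule lborel_integrable_prod)
  then show ?thesis
  proof (rule Bochner_Integration.integrable_bound)
    show "AE x in lborel. norm (inverse ((1 + (norm x)\<^sup>2) ^ DIM('a))) \<le> norm (\<Prod>b\<in>Basis. inverse (1 + ((x::'a) \<bullet> b)\<^sup>2))"
    proof (rule AE_I2)
      fix x :: 'a
      have "(\<Prod>b\<in>(Basis::'a set). (1 + (x \<bullet> b)\<^sup>2)) \<le> (\<Prod>b\<in>(Basis::'a set). 1 + (norm x)\<^sup>2)"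
        by (intro prod_mono) (auto simp: Basis_le_norm abs_le_square_iff[symmetric])
      moreover have "0 < (\<Prod>b\<in>(Basis::'a set). (1 + (x \<bullet> b)\<^sup>2))"
        by (intro prod_pos) (simp add: add_pos_nonneg)
      ultimately show "norm (inverse ((1 + (norm x)\<^sup>2) ^ DIM('a))) \<le> norm (\<Prod>b\<in>Basis. inverse (1 + (x \<bullet> b)\<^sup>2))"
        using le_imp_inverse_le by (fastforce simp: prod_inversef[symmetric] o_def prod_nonneg)
    qed
  qed measurable
qed

text \<open>The reference weight of all pointwise bounds below. The exponent 3 is the dimension: the
  weight is integrable and, up to a constant, stable under convolution, so that bounds by its
  multiples survive the nonlinearity.\<close>

definition decay :: "pt \<Rightarrow> real" where
  "decay z = inverse ((1 + (norm z)\<^sup>2) ^ 3)"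

lemma integrable_decay: "integrable lborel decay"
  using integrable_inverse_1_plus_norm_sq[where 'a=pt] unfolding decay_def[abs_def]
  by (simp del: power_Suc add: numeral_eq_Suc)

lemma decay_measurable [measurable]: "decay \<in> borel_measurable borel"
  unfolding decay_def[abs_def] by measurable

lemma decay_pos: "0 < decay z" and decay_le_1: "decay z \<le> 1"
proof -
  have "1 \<le> (1 + (norm z)\<^sup>2) ^ 3" by (rule one_le_power) simp
  moreover from this have "0 < (1 + (norm z)\<^sup>2) ^ 3" by linarith
  ultimately show "0 < decay z" "decay z \<le> 1" unfolding decay_def
    by (auto simp del: zero_less_power_eq intro: inverse_le_1_iff[THEN iffD2])
qed

lemma decay_nonneg: "0 \<le> decay z"
  using decay_pos[of z] by simp

lemma norm_sq_add_le: "(norm x)\<^sup>2 \<le> 2 * (norm y)\<^sup>2 + 2 * (norm (x - y))\<^sup>2" for x y :: "'a::real_normed_vector"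
proof -
  have "(norm x)\<^sup>2 \<le> (norm y + norm (x - y))\<^sup>2"
    by (metis norm_ge_zero norm_triangle_sub power_mono)
  also have "\<dots> \<le> 2 * (norm y)\<^sup>2 + 2 * (norm (x - y))\<^sup>2"
    using sum_squares_bound[of "norm y" "norm (x - y)"] by (simp add: power2_sum)
  finally show ?thesis .
qed

lemma peetre: "1 + (norm x)\<^sup>2 \<le> 2 * (1 + (norm y)\<^sup>2) * (1 + (norm (x - y))\<^sup>2)"
  for x y :: "'a::real_normed_vector"
  using norm_sq_add_le[of x y]
  by (simp add: algebra_simps) (smt (verit) mult_nonneg_nonneg zero_le_power2)

lemma inverse_cube_le: "inverse (b ^ 3) \<le> c ^ 3 * inverse (a ^ 3)" if "0 < a" "0 < b" "a \<le> c * b" for a b c :: real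
proof -
  have "a ^ 3 \<le> c ^ 3 * b ^ 3"
    using power_mono[of a "c * b" 3] that by (simp add: power_mult_distrib)
  then show ?thesis using that by (simp add: field_simps)
qed

lemma decay_peetre: "decay y \<le> (2 * (1 + (norm (x - y))\<^sup>2)) ^ 3 * decay x"
  unfolding decay_def
  by (rule inverse_cube_le) (use peetre[of x y] in \<open>auto intro: add_pos_nonneg simp: algebra_simps\<close>)

text \<open>One of \<open>y\<close> and \<open>x - y\<close> has at least half the norm of
  \<open>x\<close>. The corresponding factor is at most 4^3 = 64 times \<open>decay x\<close>, and
  the other factor is integrable.\<close>

lemma decay_convolution:
  obtains C where "C > 0" "\<And>x. integrable lborel (\<lambda>y. decay y * decay (x - y))"
    "\<And>x. (LINT y|lborel. decay y * decay (x - y)) \<le> C * decay x"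
proof
  let ?I = "LINT y|lborel. decay y"
  have nn: "0 \<le> ?I" by (simp add: decay_nonneg)
  \<comment> \<open>The summand 1 makes the constant positive when only \<open>0 \<le> ?I\<close> is
    known.\<close>
  show "0 < 64 * (2 * ?I) + 1" using nn by simp
  have i2: "integrable lborel (\<lambda>y. decay (x - y))" for x
    using lborel_integral_reflect(2)[OF decay_measurable integrable_decay] .
  show int: "integrable lborel (\<lambda>y. decay y * decay (x - y))" for x
    by (rule Bochner_Integration.integrable_bound[OF integrable_decay])
       (auto simp: abs_mult decay_nonneg decay_le_1 mult_left_le)
  have half: "decay y \<le> 64 * decay x" if "norm x \<le> 2 * norm y" for x y
  proof -
    have "(norm x)\<^sup>2 \<le> (2 * norm y)\<^sup>2" using that by (intro power_mono) auto
    then have "1 + (norm x)\<^sup>2 \<le> 4 * (1 + (norm y)\<^sup>2)" by (simp add: power_mult_distrib)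
    then show ?thesis
      using inverse_cube_le[of "1 + (norm x)\<^sup>2" "1 + (norm y)\<^sup>2" 4]
      by (simp add: decay_def add_pos_nonneg)
  qed
  have pw: "decay y * decay (x - y) \<le> 64 * decay x * (decay y + decay (x - y))" for x y
  proof -
    have "norm x \<le> norm y + norm (x - y)" by (metis norm_triangle_sub)
    then consider "norm x \<le> 2 * norm y" | "norm x \<le> 2 * norm (x - y)" by linarith
    then show ?thesis
    proof cases
      case 1
      have "decay y * decay (x - y) \<le> (64 * decay x) * decay (x - y)"
        by (rule mult_right_mono[OF half[OF 1] decay_nonneg])
      also have "\<dots> \<le> 64 * decay x * (decay y + decay (x - y))"
        by (intro mult_left_mono) (auto simp: decay_nonneg)
      finally show ?thesis .
    next
      case 2
      have "decay y * decay (x - y) \<le> decay y * (64 * decay x)"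
        by (rule mult_left_mono[OF half[OF 2] decay_nonneg])
      also have "\<dots> \<le> 64 * decay x * (decay y + decay (x - y))"
        by (simp add: algebra_simps decay_nonneg)
      finally show ?thesis .
    qed
  qed
  fix x
  have "(LINT y|lborel. decay y * decay (x - y)) \<le> (LINT y|lborel. 64 * decay x * (decay y + decay (x - y)))"
    by (rule integral_mono[OF int _ pw]) (simp add: integrable_decay i2)
  also have "\<dots> = 64 * decay x * (2 * ?I)"
    by (simp add: integrable_decay i2 lborel_integral_reflect(1))
  also have "\<dots> \<le> (64 * (2 * ?I) + 1) * decay x"
    using decay_nonneg[of x] by (simp add: algebra_simps)
  finally show "(LINT y|lborel. decay y * decay (x - y)) \<le> (64 * (2 * ?I) + 1) * decay x" .
qed

section \<open>Schwartz functions and their Fourier transforms\<close>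

lemma one_plus_norm_sq_pos: "0 < 1 + (norm z)\<^sup>2" for z :: "'a::real_normed_vector"
  by (simp add: add_pos_nonneg)

lemma norm_le_one_plus_sq: "norm x \<le> 1 + (norm x)\<^sup>2" for x :: "'a::real_normed_vector"
  using sum_squares_bound[of 1 "norm x", unfolded power_one] norm_ge_zero[of x] by linarith

text \<open>Passes from the powers of the norm in the definition of \<open>schwartz\<close> to
  powers of \<open>1 + (norm z)\<^sup>2\<close>, which have no zero and can be divided by.\<close>

lemma rapid_decay_bound:
  fixes f :: "'n::euclidean_space \<Rightarrow> complex"
  assumes "\<And>k::nat. bounded (range (\<lambda>z. norm z ^ k * norm (f z)))"
  shows "\<exists>C\<ge>0. \<forall>z. norm (f z) * (1 + (norm z)\<^sup>2) ^ m \<le> C"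
proof -
  obtain A where A: "\<And>z. norm (norm z ^ 0 * norm (f z)) \<le> A"
    using assms[of 0] unfolding bounded_iff by blast
  obtain B where B: "\<And>z. norm (norm z ^ (2 * m) * norm (f z)) \<le> B"
    using assms[of "2 * m"] unfolding bounded_iff by blast
  have "norm (f z) * (1 + (norm z)\<^sup>2) ^ m \<le> 2 ^ m * (A + B)" for z
  proof -
    have "(1 + (norm z)\<^sup>2) ^ m \<le> 2 ^ m * (1 + norm z ^ (2 * m))"
    proof (cases "norm z \<le> 1")
      case True
      have "(1 + (norm z)\<^sup>2) ^ m \<le> 2 ^ m"
        by (rule power_mono) (use True in \<open>auto simp: power_le_one\<close>)
      also have "\<dots> \<le> 2 ^ m * (1 + norm z ^ (2 * m))" by simp
      finally show ?thesis .
    next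
      case False
      have "(1 + (norm z)\<^sup>2) ^ m \<le> (2 * (norm z)\<^sup>2) ^ m"
        by (rule power_mono) (use False in \<open>auto simp: one_le_power\<close>)
      also have "\<dots> \<le> 2 ^ m * (1 + norm z ^ (2 * m))"
        by (simp add: power_mult_distrib power_mult)
      finally show ?thesis .
    qed
    then have "norm (f z) * (1 + (norm z)\<^sup>2) ^ m \<le> norm (f z) * (2 ^ m * (1 + norm z ^ (2 * m)))"
      by (rule mult_left_mono) simp
    also have "\<dots> = 2 ^ m * (norm (f z) + norm z ^ (2 * m) * norm (f z))"
      by (simp add: algebra_simps)
    also have "\<dots> \<le> 2 ^ m * (A + B)"
      using A[of z] B[of z] by (intro mult_left_mono add_mono) auto
    finally show ?thesis .
  qed
  then show ?thesis
    by (intro exI[of _ "max 0 (2 ^ m * (A + B))"]) (auto simp: le_max_iff_disj)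
qed

lemma schwartz_derivs:
  fixes f :: "'n::euclidean_space \<Rightarrow> complex"
  assumes "f \<in> schwartz"
  shows "\<exists>D. D [] = f \<and>
    (\<forall>bs\<in>lists Basis. \<forall>z. (D bs has_derivative (\<lambda>h. \<Sum>b\<in>Basis. (h \<bullet> b) *\<^sub>R D (b # bs) z)) (at z)) \<and>
    (\<forall>bs\<in>lists Basis. \<forall>m. \<exists>C\<ge>0. \<forall>z. norm (D bs z) * (1 + (norm z)\<^sup>2) ^ m \<le> C)"
proof -
  from assms obtain D :: "'n list \<Rightarrow> 'n \<Rightarrow> complex" where D: "D [] = f"
     "\<forall>bs\<in>lists Basis. \<forall>z. (D bs has_derivative (\<lambda>h. \<Sum>b\<in>Basis. (h \<bullet> b) *\<^sub>R D (b # bs) z)) (at z)"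
     "\<forall>bs\<in>lists Basis. \<forall>k::nat. bounded (range (\<lambda>z. norm z ^ k * norm (D bs z)))"
    unfolding schwartz_def by blast
  have "\<forall>bs\<in>lists Basis. \<forall>m. \<exists>C\<ge>0. \<forall>z. norm (D bs z) * (1 + (norm z)\<^sup>2) ^ m \<le> C"
    by (intro ballI allI rapid_decay_bound) (use D(3) in blast)
  with D(1,2) show ?thesis by (intro exI[of _ D] conjI)
qed

text \<open>Closure of a class \<open>G\<close> under partial derivatives replaces formulas for all
  iterated derivatives: the family \<open>D\<close> arises by folding a choice of derivatives along
  the list of directions.\<close>

lemma schwartzI:
  fixes f :: "'n::euclidean_space \<Rightarrow> complex"
  assumes "f \<in> G"
    and der: "\<And>g. g \<in> G \<Longrightarrow> \<exists>d. (\<forall>b\<in>Basis. d b \<in> G) \<and>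
            (\<forall>z. (g has_derivative (\<lambda>h. \<Sum>b\<in>Basis. (h \<bullet> b) *\<^sub>R d b z)) (at z))"
    and dec: "\<And>g k. g \<in> G \<Longrightarrow> bounded (range (\<lambda>z. norm z ^ k * norm (g z)))"
  shows "f \<in> schwartz"
proof -
  have "\<forall>g\<in>G. \<exists>d. (\<forall>b\<in>Basis. d b \<in> G) \<and>
            (\<forall>z. (g has_derivative (\<lambda>h. \<Sum>b\<in>Basis. (h \<bullet> b) *\<^sub>R d b z)) (at z))"
    using der by blast
  from bchoice[OF this] obtain d where d0: "\<forall>g\<in>G. (\<forall>b\<in>Basis. d g b \<in> G) \<and>
            (\<forall>z. (g has_derivative (\<lambda>h. \<Sum>b\<in>Basis. (h \<bullet> b) *\<^sub>R d g b z)) (at z))"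
    by (rule exE)
  have d: "d g b \<in> G" if "g \<in> G" "b \<in> Basis" for g b
    using d0 that by blast
  have d2: "(g has_derivative (\<lambda>h. \<Sum>b\<in>Basis. (h \<bullet> b) *\<^sub>R d g b z)) (at z)" if "g \<in> G" for g z
    using d0 that by blast
  define D where "D = (\<lambda>bs. foldr (\<lambda>b g. d g b) bs f)"
  have G: "D bs \<in> G" if "bs \<in> lists Basis" for bs
    using that by induction (simp_all add: D_def assms(1) d)
  have "D [] = f" and step: "D (b # bs) = d (D bs) b" for b bs
    by (simp_all add: D_def)
  then show ?thesis
    unfolding schwartz_def
    by (intro CollectI exI[of _ D] conjI ballI allI) (simp_all add: step d2 G dec)
qed

lemma schwartz_cnj: "f \<in> schwartz \<Longrightarrow> (\<lambda>z. cnj (f z)) \<in> schwartz"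
proof -
  assume "f \<in> schwartz"
  then obtain D :: "'a list \<Rightarrow> 'a \<Rightarrow> complex" where D: "D [] = f"
     "\<forall>bs\<in>lists Basis. \<forall>z. (D bs has_derivative (\<lambda>h. \<Sum>b\<in>Basis. (h \<bullet> b) *\<^sub>R D (b # bs) z)) (at z)"
     "\<forall>bs\<in>lists Basis. \<forall>k::nat. bounded (range (\<lambda>z. norm z ^ k * norm (D bs z)))"
    unfolding schwartz_def by blast
  have "((\<lambda>z. cnj (D bs z)) has_derivative (\<lambda>h. \<Sum>b\<in>Basis. (h \<bullet> b) *\<^sub>R cnj (D (b # bs) z))) (at z)"
    if "bs \<in> lists Basis" for bs z
  proof -
    have "((\<lambda>z. cnj (D bs z)) has_derivative (\<lambda>h. cnj (\<Sum>b\<in>Basis. (h \<bullet> b) *\<^sub>R D (b # bs) z))) (at z)"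
      by (rule bounded_linear.has_derivative[OF bounded_linear_cnj]) (use D(2) that in blast)
    then show ?thesis by simp
  qed
  then show ?thesis
    unfolding schwartz_def using D(1,3)
    by (intro CollectI exI[of _ "\<lambda>bs z. cnj (D bs z)"]) auto
qed

lemma schwartz_bound:
  fixes f :: "'n::euclidean_space \<Rightarrow> complex"
  assumes "f \<in> schwartz"
  shows "\<exists>C\<ge>0. \<forall>z. norm (f z) * (1 + (norm z)\<^sup>2) ^ m \<le> C"
proof -
  obtain D :: "'n list \<Rightarrow> 'n \<Rightarrow> complex"
    where "D [] = f" "\<forall>bs\<in>lists Basis. \<forall>m. \<exists>C\<ge>0. \<forall>z. norm (D bs z) * (1 + (norm z)\<^sup>2) ^ m \<le> C"
    using schwartz_derivs[OF assms] by blast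
  then show ?thesis
    by (metis lists.Nil)
qed

lemma schwartz_measurable [measurable_dest]:
  fixes f :: "'n::euclidean_space \<Rightarrow> complex"
  assumes "f \<in> schwartz"
  shows "f \<in> borel_measurable borel"
proof -
  obtain D :: "'n list \<Rightarrow> 'n \<Rightarrow> complex" where D: "D [] = f"
    "\<forall>bs\<in>lists Basis. \<forall>z. (D bs has_derivative (\<lambda>h. \<Sum>b\<in>Basis. (h \<bullet> b) *\<^sub>R D (b # bs) z)) (at z)"
    using schwartz_derivs[OF assms] by blast
  have "isCont f x" for x
    using has_derivative_continuous[OF D(2)[rule_format, of "[]" x]] D(1) by simp
  then have "continuous_on UNIV f"
    by (simp add: continuous_at_imp_continuous_on)
  then show ?thesis by (rule borel_measurable_continuous_onI)
qed

lemma le_decay: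
  assumes "norm (f z) * (1 + (norm z)\<^sup>2) ^ 3 \<le> C"
  shows "norm (f z) \<le> C * decay z"
proof -
  define p where "p = (1 + (norm z)\<^sup>2) ^ 3"
  have "0 < p" unfolding p_def by (rule zero_less_power[OF one_plus_norm_sq_pos])
  then show ?thesis using assms unfolding decay_def p_def[symmetric] by (simp add: field_simps)
qed

lemma mult_le_decay:
  assumes "0 \<le> w" "w \<le> (1 + (norm z)\<^sup>2) ^ m" "norm (f z) * (1 + (norm z)\<^sup>2) ^ (m + 3) \<le> C"
  shows "w * norm (f z) \<le> C * decay z"
proof -
  have "(w * norm (f z)) * (1 + (norm z)\<^sup>2) ^ 3 \<le> ((1 + (norm z)\<^sup>2) ^ m * norm (f z)) * (1 + (norm z)\<^sup>2) ^ 3"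
    by (intro mult_right_mono assms(2)) auto
  also have "\<dots> = norm (f z) * (1 + (norm z)\<^sup>2) ^ (m + 3)" by (simp only: power_add mult_ac)
  also have "\<dots> \<le> C" by (rule assms(3))
  finally show ?thesis using le_decay[of "\<lambda>z. w * norm (f z)" z C] assms(1) by (simp add: abs_mult)
qed

lemma integrable_of_le_decay:
  fixes f :: "pt \<Rightarrow> 'b::{banach,second_countable_topology}"
  assumes [measurable]: "f \<in> borel_measurable borel" and "\<And>z. norm (f z) \<le> C * decay z"
  shows "integrable lborel f"
  by (rule Bochner_Integration.integrable_bound[of _ "\<lambda>z. C * decay z"])
     (use assms(2) in \<open>auto simp: integrable_decay intro!: AE_I2 order_trans[OF assms(2)]\<close>)

lemma schwartz_integrable:
  assumes "\<psi> \<in> schwartz"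
  shows "integrable lborel (\<psi> :: pt \<Rightarrow> complex)"
proof -
  obtain C where C: "\<And>z. norm (\<psi> z) * (1 + (norm z)\<^sup>2) ^ 3 \<le> C"
    using schwartz_bound[OF assms, of 3] by blast
  show ?thesis
    by (rule integrable_of_le_decay[OF schwartz_measurable[OF assms], where C = C]) (rule le_decay[OF C])
qed

section \<open>The inverse Fourier transform of integrable and of Schwartz functions\<close>

lemma cis_measurable [measurable]: "cis \<in> borel_measurable borel"
  unfolding cis_conv_exp[abs_def] by (intro borel_measurable_continuous_onI continuous_intros)

lemma inv_fourier_measurable [measurable (raw)]:
  assumes [measurable]: "\<psi> \<in> borel_measurable borel"
  shows "inv_fourier \<psi> \<in> borel_measurable borel"
  unfolding inv_fourier_def by measurable

lemma norm_inv_fourier_le: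
  assumes "integrable lborel \<psi>"
  shows "norm (inv_fourier \<psi> \<zeta>) \<le> (LINT z|lborel. norm (\<psi> z))"
proof -
  have "norm (LINT z|lborel. cis (z \<bullet> \<zeta>) * \<psi> z) \<le> (LINT z|lborel. norm (cis (z \<bullet> \<zeta>) * \<psi> z))"
    by (rule integral_norm_bound)
  also have "\<dots> = (LINT z|lborel. norm (\<psi> z))" by (simp add: norm_mult)
  finally have 1: "norm (LINT z|lborel. cis (z \<bullet> \<zeta>) * \<psi> z) \<le> (LINT z|lborel. norm (\<psi> z))" .
  have "1 \<le> (2 * pi) ^ 3" by (rule one_le_power) (use pi_ge_two in linarith)
  then have "norm (inv_fourier \<psi> \<zeta>) \<le> norm (LINT z|lborel. cis (z \<bullet> \<zeta>) * \<psi> z)"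
    unfolding inv_fourier_def by (simp add: norm_divide norm_power divide_le_eq mult_le_cancel_left1)
  with 1 show ?thesis by linarith
qed

lemma integrable_cis_mult:
  fixes \<psi> :: "pt \<Rightarrow> complex"
  assumes "integrable lborel \<psi>"
  shows "integrable lborel (\<lambda>z. cis (z \<bullet> \<zeta>) * \<psi> z)"
proof -
  have [measurable]: "\<psi> \<in> borel_measurable borel"
    using borel_measurable_integrable[OF assms] by simp
  show ?thesis
    by (rule Bochner_Integration.integrable_bound[OF assms]) (auto simp: norm_mult)
qed

lemma has_vector_derivative_at_0_tendsto:
  assumes "(f has_vector_derivative D) (at 0)"
  shows "((\<lambda>t. (f t - f 0) /\<^sub>R t) \<longlongrightarrow> D) (at 0)"
proof -
  have "((\<lambda>t. norm (f t - f 0 - t *\<^sub>R D) / norm t) \<longlongrightarrow> 0) (at 0)"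
    using assms by (simp add: has_vector_derivative_def has_derivative_iff_norm)
  then have "((\<lambda>t. norm ((f t - f 0) /\<^sub>R t - D)) \<longlongrightarrow> 0) (at 0)"
  proof (rule Lim_transform_eventually)
    have "norm (f t - f 0 - t *\<^sub>R D) / norm t = norm ((f t - f 0) /\<^sub>R t - D)" if "t \<noteq> 0" for t
    proof -
      have "(f t - f 0) /\<^sub>R t - D = (f t - f 0 - t *\<^sub>R D) /\<^sub>R t"
        using that by (simp add: scaleR_diff_right)
      then show ?thesis by (simp add: divide_inverse mult.commute)
    qed
    then show "\<forall>\<^sub>F t in at 0. norm (f t - f 0 - t *\<^sub>R D) / norm t = norm ((f t - f 0) /\<^sub>R t - D)"
      by (auto simp: eventually_at_filter)
  qed
  then show ?thesis by (rule LIM_zero_cancel[OF tendsto_norm_zero_cancel])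
qed

text \<open>Integration by parts, by differentiating the translation invariance of the integral.\<close>

lemma inv_fourier_partial:
  fixes f g :: "pt \<Rightarrow> complex"
  assumes b: "norm b = 1"
    and [measurable]: "f \<in> borel_measurable borel" "g \<in> borel_measurable borel"
    and f: "\<And>z. norm (f z) \<le> C * decay z" and g: "\<And>z. norm (g z) \<le> C' * decay z" and C': "C' \<ge> 0"
    and der: "\<And>z. ((\<lambda>t. f (z + t *\<^sub>R b)) has_vector_derivative g z) (at 0)"
  shows "inv_fourier g \<zeta> = - \<i> * of_real (\<zeta> \<bullet> b) * inv_fourier f \<zeta>"
proof -
  define e :: "nat \<Rightarrow> real" where "e n = 1 / real (Suc n)" for n
  have e: "e n > 0" "e n \<le> 1" for n by (simp_all add: e_def)
  have e0: "e \<longlonglongrightarrow> 0" unfolding e_def using LIMSEQ_Suc[OF lim_1_over_n] by simp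
  have e_at: "filterlim e (at 0) sequentially"
    unfolding filterlim_at using e0 e(1) by (simp add: less_imp_neq[THEN not_sym])
  have if_: "integrable lborel f" and ig: "integrable lborel g"
    by (rule integrable_of_le_decay[OF _ f], measurable, rule integrable_of_le_decay[OF _ g], measurable)
  define I where "I = (LINT z|lborel. cis (z \<bullet> \<zeta>) * f z)"
  define q where "q n z = (f (z + e n *\<^sub>R b) - f z) /\<^sub>R e n" for n z
  have derz: "((\<lambda>t. f (z + t *\<^sub>R b)) has_vector_derivative g (z + t *\<^sub>R b)) (at t)" for z t
  proof -
    have "((\<lambda>s. f ((z + t *\<^sub>R b) + s *\<^sub>R b)) has_vector_derivative g (z + t *\<^sub>R b)) (at 0)"
      by (rule der)
    moreover have "((\<lambda>s. s - t) has_vector_derivative 1) (at t)"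
      unfolding has_real_derivative_iff_has_vector_derivative[symmetric]
      by (auto intro!: derivative_eq_intros)
    ultimately have "((\<lambda>s. f ((z + t *\<^sub>R b) + (s - t) *\<^sub>R b)) has_vector_derivative g (z + t *\<^sub>R b)) (at t)"
      using vector_diff_chain_at[of "\<lambda>s. s - t" 1 t "\<lambda>s. f ((z + t *\<^sub>R b) + s *\<^sub>R b)" "g (z + t *\<^sub>R b)"]
      by (simp add: o_def)
    then show ?thesis by (simp add: algebra_simps)
  qed
  \<comment> \<open>The mean value theorem bounds the quotient by \<open>g\<close> at points shifted
    by at most 1; for such shifts the factor in \<open>decay_peetre\<close> is at most (2 (1 + 1))^3
    = 64.\<close>
  have qb: "norm (q n z) \<le> 64 * C' * decay z" for n z
  proof -
    have dz: "decay (z + t *\<^sub>R b) \<le> 64 * decay z" if "t \<in> {0..e n}" for t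
    proof -
      have "(norm (z - (z + t *\<^sub>R b)))\<^sup>2 \<le> 1"
        using that e(2)[of n] b by (auto simp: power_le_one)
      then have "(2 * (1 + (norm (z - (z + t *\<^sub>R b)))\<^sup>2)) ^ 3 \<le> 4 ^ 3"
        by (intro power_mono) auto
      from mult_right_mono[OF this decay_nonneg, of z] decay_peetre[of "z + t *\<^sub>R b" z]
      show ?thesis by simp
    qed
    have "norm (f (z + e n *\<^sub>R b) - f (z + 0 *\<^sub>R b)) \<le> (64 * C' * decay z) * norm (e n - 0)"
    proof (rule differentiable_bound[where S = "{0..e n}" and f' = "\<lambda>t h. h *\<^sub>R g (z + t *\<^sub>R b)"])
      fix t assume t: "t \<in> {0..e n}"
      show "((\<lambda>t. f (z + t *\<^sub>R b)) has_derivative (\<lambda>h. h *\<^sub>R g (z + t *\<^sub>R b))) (at t within {0..e n})"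
        using derz[of z t] by (simp add: has_vector_derivative_def has_derivative_at_withinI)
      have "norm (g (z + t *\<^sub>R b)) \<le> C' * (64 * decay z)"
        using g[of "z + t *\<^sub>R b"] mult_left_mono[OF dz[OF t] C'] by linarith
      then have "norm (h *\<^sub>R g (z + t *\<^sub>R b)) \<le> 64 * C' * decay z * norm h" for h
        using mult_left_mono[of "norm (g (z + t *\<^sub>R b))" "C' * (64 * decay z)" "\<bar>h\<bar>"]
        by (simp add: mult.assoc mult.left_commute mult.commute)
      then show "onorm (\<lambda>h. h *\<^sub>R g (z + t *\<^sub>R b)) \<le> 64 * C' * decay z"
        by (rule onorm_le)
    qed (use e(1)[of n] in auto)
    moreover have "norm (q n z) = norm (f (z + e n *\<^sub>R b) - f z) / e n"
      using e(1)[of n] by (simp add: q_def divide_inverse mult.commute)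
    ultimately show ?thesis using e(1)[of n] by (simp add: pos_divide_le_eq)
  qed
  have qlim: "(\<lambda>n. q n z) \<longlonglongrightarrow> g z" for z
  proof -
    have "((\<lambda>t. (f (z + t *\<^sub>R b) - f z) /\<^sub>R t) \<longlongrightarrow> g z) (at 0)"
      using has_vector_derivative_at_0_tendsto[OF der[of z]] by simp
    then show ?thesis
      unfolding q_def by (rule filterlim_compose[OF _ e_at])
  qed
  have [measurable]: "q n \<in> borel_measurable borel" for n unfolding q_def by measurable
  have lim1: "(\<lambda>n. LINT z|lborel. cis (z \<bullet> \<zeta>) * q n z) \<longlonglongrightarrow> (LINT z|lborel. cis (z \<bullet> \<zeta>) * g z)"
    by (rule integral_dominated_convergence[where w = "\<lambda>z. 64 * C' * decay z"])
       (auto intro!: tendsto_intros qlim AE_I2 simp: integrable_decay norm_mult qb)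
  \<comment> \<open>Translating the variable of integration moves the difference quotient from
    \<open>f\<close> to the exponential, where its limit is explicit.\<close>
  have eqn: "(LINT z|lborel. cis (z \<bullet> \<zeta>) * q n z) = ((cis (- (e n * (b \<bullet> \<zeta>))) - 1) /\<^sub>R e n) * I" for n
  proof -
    have i1: "integrable lborel (\<lambda>z. cis (z \<bullet> \<zeta>) * f z)"
      by (rule integrable_cis_mult[OF if_])
    have i2: "integrable lborel (\<lambda>z. cis (z \<bullet> \<zeta>) * f (z + e n *\<^sub>R b))"
      by (rule integrable_cis_mult[OF lborel_integral_shift(2)[OF _ if_]]) simp
    have "(LINT z|lborel. cis (z \<bullet> \<zeta>) * f (z + e n *\<^sub>R b)) =
        (LINT z|lborel. cis (- (e n * (b \<bullet> \<zeta>))) * (cis ((z + e n *\<^sub>R b) \<bullet> \<zeta>) * f (z + e n *\<^sub>R b)))"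
      by (rule Bochner_Integration.integral_cong) (auto simp: mult.assoc[symmetric] cis_mult inner_add_left)
    also have "\<dots> = cis (- (e n * (b \<bullet> \<zeta>))) * I"
      unfolding I_def using lborel_integral_shift(1)[of "\<lambda>z. cis (z \<bullet> \<zeta>) * f z" "e n *\<^sub>R b"] by simp
    finally have s: "(LINT z|lborel. cis (z \<bullet> \<zeta>) * f (z + e n *\<^sub>R b)) = cis (- (e n * (b \<bullet> \<zeta>))) * I" .
    have "(LINT z|lborel. cis (z \<bullet> \<zeta>) * q n z) =
        (LINT z|lborel. (cis (z \<bullet> \<zeta>) * f (z + e n *\<^sub>R b) - cis (z \<bullet> \<zeta>) * f z) /\<^sub>R e n)"
      by (rule Bochner_Integration.integral_cong) (auto simp: q_def algebra_simps)
    also have "\<dots> = (cis (- (e n * (b \<bullet> \<zeta>))) * I - I) /\<^sub>R e n"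
      using i1 i2 s by (simp add: I_def)
    finally show ?thesis by (simp add: algebra_simps)
  qed
  have "((\<lambda>t. cis (- (t * (b \<bullet> \<zeta>)))) has_vector_derivative (- \<i> * of_real (b \<bullet> \<zeta>))) (at 0)"
  proof -
    have "((\<lambda>z. exp (- \<i> * of_real (b \<bullet> \<zeta>) * z)) has_field_derivative (- \<i> * of_real (b \<bullet> \<zeta>))) (at (of_real 0))"
      by (auto intro!: derivative_eq_intros)
    from has_vector_derivative_real_field[OF this] show ?thesis
      unfolding cis_conv_exp by (simp add: mult.commute mult.left_commute)
  qed
  then have "((\<lambda>t. (cis (- (t * (b \<bullet> \<zeta>))) - 1) /\<^sub>R t) \<longlongrightarrow> - \<i> * of_real (b \<bullet> \<zeta>)) (at 0)"
    by (drule_tac has_vector_derivative_at_0_tendsto) simp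
  then have "(\<lambda>n. (cis (- (e n * (b \<bullet> \<zeta>))) - 1) /\<^sub>R e n) \<longlonglongrightarrow> - \<i> * of_real (b \<bullet> \<zeta>)"
    by (rule filterlim_compose[OF _ e_at])
  then have "(\<lambda>n. ((cis (- (e n * (b \<bullet> \<zeta>))) - 1) /\<^sub>R e n) * I) \<longlonglongrightarrow> - \<i> * of_real (b \<bullet> \<zeta>) * I"
    by (rule tendsto_mult_right)
  with lim1[unfolded eqn] have "(LINT z|lborel. cis (z \<bullet> \<zeta>) * g z) = - \<i> * of_real (b \<bullet> \<zeta>) * I"
    using LIMSEQ_unique by blast
  then show ?thesis
    unfolding inv_fourier_def I_def by (simp add: inner_commute)
qed

text \<open>A power of the coordinate \<open>\<zeta> \<bullet> b\<close> times the transform is, up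
  to a unit, the transform of an iterated derivative, hence bounded by an integral. In dimension 3
  some coordinate is at least a third of the norm, so bounds on the coordinates suffice.\<close>

lemma inv_fourier_decay:
  assumes "\<psi> \<in> schwartz"
  shows "\<exists>C\<ge>0. \<forall>\<zeta>. norm (inv_fourier \<psi> \<zeta>) * (1 + (norm \<zeta>)\<^sup>2) ^ m \<le> C"
proof (rule rapid_decay_bound)
  fix k :: nat
  obtain D :: "pt list \<Rightarrow> pt \<Rightarrow> complex" where D: "D [] = \<psi>"
    "\<forall>bs\<in>lists Basis. \<forall>z. (D bs has_derivative (\<lambda>h. \<Sum>b\<in>Basis. (h \<bullet> b) *\<^sub>R D (b # bs) z)) (at z)"
    "\<forall>bs\<in>lists Basis. \<forall>m. \<exists>C\<ge>0. \<forall>z. norm (D bs z) * (1 + (norm z)\<^sup>2) ^ m \<le> C"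
    using schwartz_derivs[OF assms] by blast
  have meas: "D bs \<in> borel_measurable borel" if "bs \<in> lists Basis" for bs
  proof -
    have "isCont (D bs) x" for x
      using has_derivative_continuous[OF D(2)[rule_format, OF that, of x]] by simp
    then show ?thesis
      by (intro borel_measurable_continuous_onI) (simp add: continuous_at_imp_continuous_on)
  qed
  have bd: "\<exists>C\<ge>0. \<forall>z. norm (D bs z) \<le> C * decay z" if "bs \<in> lists Basis" for bs
    using D(3)[rule_format, OF that, of 3] le_decay[of "D bs"] by blast
  have rep: "replicate n b \<in> lists Basis" if "b \<in> Basis" for n and b :: pt
    using that by (induction n) auto
  have pow: "inv_fourier (D (replicate n b)) \<zeta> = (- \<i> * of_real (\<zeta> \<bullet> b)) ^ n * inv_fourier \<psi> \<zeta>"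
    if b: "b \<in> Basis" for n b \<zeta>
  proof (induction n)
    case 0
    then show ?case by (simp add: D(1))
  next
    case (Suc n)
    obtain C where C: "C \<ge> 0" "\<forall>z. norm (D (replicate n b) z) \<le> C * decay z"
      using bd[OF rep[OF b]] by blast
    obtain C' where C': "C' \<ge> 0" "\<forall>z. norm (D (b # replicate n b) z) \<le> C' * decay z"
      using bd[of "b # replicate n b"] rep[OF b, of n] b by auto
    have "((\<lambda>t. D (replicate n b) (z + t *\<^sub>R b)) has_vector_derivative D (b # replicate n b) z) (at 0)" for z
    proof -
      have "((\<lambda>t. z + t *\<^sub>R b) has_derivative (\<lambda>t. t *\<^sub>R b)) (at 0)"
        by (auto intro!: derivative_eq_intros)
      moreover have "(D (replicate n b) has_derivative (\<lambda>h. \<Sum>c\<in>Basis. (h \<bullet> c) *\<^sub>R D (c # replicate n b) z)) (at (z + 0 *\<^sub>R b))"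
        using D(2)[rule_format, OF rep[OF b]] by simp
      ultimately have "((\<lambda>t. D (replicate n b) (z + t *\<^sub>R b)) has_derivative
          (\<lambda>t. \<Sum>c\<in>Basis. ((t *\<^sub>R b) \<bullet> c) *\<^sub>R D (c # replicate n b) z)) (at 0)"
        by (rule has_derivative_compose)
      moreover have "(\<Sum>c\<in>Basis. ((t *\<^sub>R b) \<bullet> c) *\<^sub>R D (c # replicate n b) z) = t *\<^sub>R D (b # replicate n b) z" for t
      proof -
        have "(\<Sum>c\<in>Basis. ((t *\<^sub>R b) \<bullet> c) *\<^sub>R D (c # replicate n b) z) =
            (\<Sum>c\<in>Basis. if c = b then t *\<^sub>R D (b # replicate n b) z else 0)"
          by (rule sum.cong) (auto simp: inner_Basis b)
        then show ?thesis using b by simp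
      qed
      ultimately show ?thesis by (simp add: has_vector_derivative_def)
    qed
    then have "inv_fourier (D (b # replicate n b)) \<zeta> = - \<i> * of_real (\<zeta> \<bullet> b) * inv_fourier (D (replicate n b)) \<zeta>"
      using C C' b rep[OF b, of n]
      by (intro inv_fourier_partial[where C = C and C' = C'] meas) auto
    then show ?case by (simp add: Suc mult.assoc)
  qed
  have "\<exists>C. \<forall>\<zeta>. \<bar>\<zeta> \<bullet> b\<bar> ^ k * norm (inv_fourier \<psi> \<zeta>) \<le> C" if b: "b \<in> Basis" for b
  proof -
    obtain C where C: "C \<ge> 0" "\<forall>z. norm (D (replicate k b) z) \<le> C * decay z"
      using bd[OF rep[OF b]] by blast
    have int: "integrable lborel (D (replicate k b))"
      by (rule integrable_of_le_decay[OF meas[OF rep[OF b]], where C = C]) (use C in blast)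
    have "norm (inv_fourier (D (replicate k b)) \<zeta>) = \<bar>\<zeta> \<bullet> b\<bar> ^ k * norm (inv_fourier \<psi> \<zeta>)" for \<zeta>
      by (simp add: pow[OF b] norm_mult norm_power)
    then show ?thesis using norm_inv_fourier_le[OF int] by metis
  qed
  then have "\<forall>b\<in>(Basis::pt set). \<exists>C. \<forall>\<zeta>. \<bar>\<zeta> \<bullet> b\<bar> ^ k * norm (inv_fourier \<psi> \<zeta>) \<le> C"
    by blast
  from bchoice[OF this] obtain C where C: "\<And>b \<zeta>. b \<in> (Basis::pt set) \<Longrightarrow> \<bar>\<zeta> \<bullet> b\<bar> ^ k * norm (inv_fourier \<psi> \<zeta>) \<le> C b"
    by blast
  have "norm (norm \<zeta> ^ k * norm (inv_fourier \<psi> \<zeta>)) \<le> 3 ^ k * (\<Sum>b\<in>Basis. C b)" for \<zeta> :: pt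
  proof -
    have "\<exists>b\<in>Basis. norm \<zeta> \<le> 3 * \<bar>\<zeta> \<bullet> b\<bar>"
    proof (rule ccontr)
      assume *: "\<not> ?thesis"
      have "norm \<zeta> \<le> (\<Sum>b\<in>Basis. \<bar>\<zeta> \<bullet> b\<bar>)" by (rule norm_le_l1)
      also have "\<dots> < (\<Sum>b\<in>(Basis::pt set). norm \<zeta> / 3)"
        by (rule sum_strict_mono) (use * in auto)
      also have "\<dots> = norm \<zeta>" by simp
      finally show False by simp
    qed
    then obtain b where b: "b \<in> Basis" "norm \<zeta> \<le> 3 * \<bar>\<zeta> \<bullet> b\<bar>" by blast
    have C0: "0 \<le> C c" if "c \<in> Basis" for c
      using C[OF that, of 0] by (rule order_trans[rotated]) simp
    have "norm \<zeta> ^ k * norm (inv_fourier \<psi> \<zeta>) \<le> (3 * \<bar>\<zeta> \<bullet> b\<bar>) ^ k * norm (inv_fourier \<psi> \<zeta>)"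
      by (intro mult_right_mono power_mono b) auto
    also have "\<dots> = 3 ^ k * (\<bar>\<zeta> \<bullet> b\<bar> ^ k * norm (inv_fourier \<psi> \<zeta>))"
      by (simp add: power_mult_distrib)
    also have "\<dots> \<le> 3 ^ k * (\<Sum>b\<in>Basis. C b)"
      using C[OF b(1), of \<zeta>] member_le_sum[of b Basis C] b(1) C0
      by (intro mult_left_mono) (auto intro: order_trans)
    finally show ?thesis by simp
  qed
  then show "bounded (range (\<lambda>z. norm z ^ k * norm (inv_fourier \<psi> z)))"
    unfolding bounded_iff by blast
qed

subsection \<open>Modulated Gaussians\<close>

text \<open>Polynomials in the coordinates. Their products with a fixed modulated Gaussian form a
  class closed under partial derivatives, as \<open>schwartzI\<close> requires.\<close>

inductive_set cpoly :: "('n::euclidean_space \<Rightarrow> complex) set" where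
  const: "(\<lambda>z. c) \<in> cpoly"
| coord: "(\<lambda>z. of_real (z \<bullet> b)) \<in> cpoly"
| add: "p \<in> cpoly \<Longrightarrow> q \<in> cpoly \<Longrightarrow> (\<lambda>z. p z + q z) \<in> cpoly"
| mult: "p \<in> cpoly \<Longrightarrow> q \<in> cpoly \<Longrightarrow> (\<lambda>z. p z * q z) \<in> cpoly"

lemma inner_sum_Basis: "h \<bullet> w = (\<Sum>b\<in>Basis. (h \<bullet> b) * (b \<bullet> w))" for h w :: "'n::euclidean_space"
  unfolding euclidean_inner[of h w] by (rule sum.cong) (simp_all add: inner_commute)

lemma cpoly_derivative:
  fixes p :: "'n::euclidean_space \<Rightarrow> complex"
  assumes "p \<in> cpoly"
  shows "\<exists>d. (\<forall>b. d b \<in> cpoly) \<and> (\<forall>z. (p has_derivative (\<lambda>h. \<Sum>b\<in>Basis. (h \<bullet> b) *\<^sub>R d b z)) (at z))"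
  using assms
proof induction
  case (const c)
  show ?case by (rule exI[of _ "\<lambda>b z. 0"]) (auto intro: cpoly.const)
next
  case (coord c)
  have "((\<lambda>z. of_real (z \<bullet> c)) has_derivative (\<lambda>h. \<Sum>b\<in>Basis. (h \<bullet> b) *\<^sub>R complex_of_real (b \<bullet> c))) (at z)" for z :: 'n
  proof -
    have "((\<lambda>z. complex_of_real (z \<bullet> c)) has_derivative (\<lambda>h. of_real (h \<bullet> c))) (at z)"
      by (auto intro!: derivative_eq_intros)
    moreover have "(\<lambda>h. complex_of_real (h \<bullet> c)) = (\<lambda>h. \<Sum>b\<in>Basis. (h \<bullet> b) *\<^sub>R complex_of_real (b \<bullet> c))"
    proof
      show "complex_of_real (h \<bullet> c) = (\<Sum>b\<in>Basis. (h \<bullet> b) *\<^sub>R complex_of_real (b \<bullet> c))" for h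
        unfolding inner_sum_Basis[of h c] by (simp add: scaleR_conv_of_real)
    qed
    ultimately show ?thesis by (rule has_derivative_eq_rhs)
  qed
  then show ?case by (intro exI[of _ "\<lambda>b z. of_real (b \<bullet> c)"]) (auto intro: cpoly.const)
next
  case (add p q)
  then obtain d e where d: "\<forall>b. d b \<in> cpoly" "\<forall>z. (p has_derivative (\<lambda>h. \<Sum>b\<in>Basis. (h \<bullet> b) *\<^sub>R d b z)) (at z)"
    and e: "\<forall>b. e b \<in> cpoly" "\<forall>z. (q has_derivative (\<lambda>h. \<Sum>b\<in>Basis. (h \<bullet> b) *\<^sub>R e b z)) (at z)"
    by blast
  have "((\<lambda>z. p z + q z) has_derivative (\<lambda>h. \<Sum>b\<in>Basis. (h \<bullet> b) *\<^sub>R (d b z + e b z))) (at z)" for z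
    using has_derivative_add[OF d(2)[rule_format, of z] e(2)[rule_format, of z]]
    by (simp add: scaleR_add_right sum.distrib)
  then show ?case using d(1) e(1)
    by (intro exI[of _ "\<lambda>b z. d b z + e b z"]) (auto intro: cpoly.add)
next
  case (mult p q)
  then obtain d e where d: "\<forall>b. d b \<in> cpoly" "\<forall>z. (p has_derivative (\<lambda>h. \<Sum>b\<in>Basis. (h \<bullet> b) *\<^sub>R d b z)) (at z)"
    and e: "\<forall>b. e b \<in> cpoly" "\<forall>z. (q has_derivative (\<lambda>h. \<Sum>b\<in>Basis. (h \<bullet> b) *\<^sub>R e b z)) (at z)"
    by blast
  have "((\<lambda>z. p z * q z) has_derivative (\<lambda>h. \<Sum>b\<in>Basis. (h \<bullet> b) *\<^sub>R (p z * e b z + d b z * q z))) (at z)" for z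
    using has_derivative_mult[OF d(2)[rule_format, of z] e(2)[rule_format, of z]]
    by (simp add: scaleR_add_right sum.distrib sum_distrib_left sum_distrib_right mult.assoc)
  then show ?case using d(1) e(1) mult.hyps
    by (intro exI[of _ "\<lambda>b z. p z * e b z + d b z * q z"]) (auto intro!: cpoly.add cpoly.mult)
qed

lemma cpoly_bound:
  fixes p :: "'n::euclidean_space \<Rightarrow> complex"
  assumes "p \<in> cpoly"
  shows "\<exists>C n. \<forall>z. norm (p z) \<le> C * (1 + (norm z)\<^sup>2) ^ n"
  using assms
proof induction
  case (const c)
  show ?case by (rule exI[of _ "norm c"], rule exI[of _ 0]) simp
next
  case (coord b)
  have "norm (complex_of_real (z \<bullet> b)) \<le> norm b * (1 + (norm z)\<^sup>2) ^ 1" for z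
  proof -
    have "\<bar>z \<bullet> b\<bar> \<le> norm z * norm b" by (rule Cauchy_Schwarz_ineq2)
    also have "\<dots> \<le> (1 + (norm z)\<^sup>2) * norm b"
      by (rule mult_right_mono[OF norm_le_one_plus_sq]) simp
    finally show ?thesis by (simp add: mult.commute)
  qed
  then show ?case by blast
next
  case (add p q)
  then obtain C n D m where C: "\<And>z. norm (p z) \<le> C * (1 + (norm z)\<^sup>2) ^ n"
    and D: "\<And>z. norm (q z) \<le> D * (1 + (norm z)\<^sup>2) ^ m" by blast
  have "norm (p z + q z) \<le> (\<bar>C\<bar> + \<bar>D\<bar>) * (1 + (norm z)\<^sup>2) ^ (n + m)" for z
  proof -
    have "C * (1 + (norm z)\<^sup>2) ^ n \<le> \<bar>C\<bar> * (1 + (norm z)\<^sup>2) ^ (n + m)"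
      by (intro mult_mono power_increasing) auto
    moreover have "D * (1 + (norm z)\<^sup>2) ^ m \<le> \<bar>D\<bar> * (1 + (norm z)\<^sup>2) ^ (n + m)"
      by (intro mult_mono power_increasing) auto
    ultimately show ?thesis
      using norm_triangle_ineq[of "p z" "q z"] C[of z] D[of z] unfolding distrib_right by linarith
  qed
  then show ?case by blast
next
  case (mult p q)
  then obtain C n D m where C: "\<And>z. norm (p z) \<le> C * (1 + (norm z)\<^sup>2) ^ n"
    and D: "\<And>z. norm (q z) \<le> D * (1 + (norm z)\<^sup>2) ^ m" by blast
  have "norm (p z * q z) \<le> (C * D) * (1 + (norm z)\<^sup>2) ^ (n + m)" for z
    using mult_mono[OF C[of z] D[of z]] order_trans[OF norm_ge_zero C[of z]]
    by (simp add: norm_mult power_add mult_ac)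
  then show ?case by blast
qed

lemma power_le_fact_times_exp: "x ^ n \<le> fact n * exp x" if "0 \<le> x" for x :: real
proof -
  have "(\<Sum>k\<in>{n}. x ^ k /\<^sub>R fact k) \<le> (\<Sum>k. x ^ k /\<^sub>R fact k)"
    by (rule sum_le_suminf) (use that summable_exp[of x] in auto)
  then show ?thesis by (simp add: exp_def field_simps)
qed

lemma power_times_gaussian_bounded:
  assumes "0 < c" "0 \<le> (y::real)"
  shows "(1 + y) ^ n * exp (- c * y) \<le> fact n * exp c / c ^ n"
proof -
  have "(c * (1 + y)) ^ n \<le> fact n * exp (c * (1 + y))"
    using assms by (intro power_le_fact_times_exp) simp
  then have "(c * (1 + y)) ^ n * exp (- c * y) \<le> fact n * exp (c * (1 + y)) * exp (- c * y)"
    by (rule mult_right_mono) simp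
  also have "\<dots> = fact n * exp c"
    by (simp add: mult.assoc exp_add[symmetric] algebra_simps)
  finally show ?thesis using assms by (simp add: power_mult_distrib pos_le_divide_eq mult_ac)
qed

text \<open>The sign of the modulation makes \<open>inv_fourier\<close> of this function a Gaussian
  centred at \<open>a\<close>. Varying the centre and the width gives enough test functions to
  determine a tempered function.\<close>

definition mod_gauss :: "real \<Rightarrow> 'n::euclidean_space \<Rightarrow> 'n \<Rightarrow> complex" where
  "mod_gauss c a z = cis (- (z \<bullet> a)) * of_real (exp (- c * (norm z)\<^sup>2))"

lemma mod_gauss_has_derivative:
  "(mod_gauss c a has_derivative
      (\<lambda>h. mod_gauss c a z * (- \<i> * of_real (h \<bullet> a) - of_real (2 * c * (h \<bullet> z))))) (at z)"
proof -
  have eq: "mod_gauss c a = (\<lambda>z. exp (- \<i> * of_real (z \<bullet> a) - of_real c * of_real (z \<bullet> z)))"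
    unfolding mod_gauss_def[abs_def] cis_conv_exp
    by (simp add: exp_of_real[symmetric] exp_add[symmetric] power2_norm_eq_inner)
  have "((\<lambda>z. - \<i> * of_real (z \<bullet> a) - of_real c * of_real (z \<bullet> z)) has_derivative
      (\<lambda>h. - \<i> * of_real (h \<bullet> a) - of_real c * of_real (z \<bullet> h + h \<bullet> z))) (at z)"
    by (intro derivative_intros)
  moreover have "(exp has_derivative (*) (exp w)) (at w)" for w :: complex
    using DERIV_exp by (simp add: has_field_derivative_def)
  ultimately have "(mod_gauss c a has_derivative
      (\<lambda>h. mod_gauss c a z * (- \<i> * of_real (h \<bullet> a) - of_real c * of_real (z \<bullet> h + h \<bullet> z)))) (at z)"
    unfolding eq by (rule has_derivative_compose)
  then show ?thesis by (simp add: inner_commute mult_ac)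
qed

lemma mod_gauss_schwartz:
  assumes c: "c > 0"
  shows "mod_gauss c (a :: 'n::euclidean_space) \<in> schwartz"
proof (rule schwartzI)
  let ?G = "(\<lambda>p z. p z * mod_gauss c a z) ` (cpoly :: ('n \<Rightarrow> complex) set)"
  show "mod_gauss c a \<in> ?G"
    by (rule image_eqI[of _ _ "\<lambda>z. 1"]) (auto intro: cpoly.const)
  fix g assume "g \<in> ?G"
  then obtain p where p: "p \<in> cpoly" and g: "g = (\<lambda>z. p z * mod_gauss c a z)" by blast
  show "\<exists>d. (\<forall>b\<in>Basis. d b \<in> ?G) \<and> (\<forall>z. (g has_derivative (\<lambda>h. \<Sum>b\<in>Basis. (h \<bullet> b) *\<^sub>R d b z)) (at z))"
  proof -
    obtain d where d: "\<forall>b. d b \<in> cpoly" "\<forall>z. (p has_derivative (\<lambda>h. \<Sum>b\<in>Basis. (h \<bullet> b) *\<^sub>R d b z)) (at z)"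
      using cpoly_derivative[OF p] by blast
    define e where "e b z = d b z + p z * (- \<i> * of_real (b \<bullet> a) + - of_real (2 * c) * of_real (z \<bullet> b))" for b z
    have e: "e b \<in> cpoly" for b unfolding e_def
      by (intro cpoly.add cpoly.mult d(1)[rule_format] p cpoly.const cpoly.coord)
    have "(g has_derivative (\<lambda>h. \<Sum>b\<in>Basis. (h \<bullet> b) *\<^sub>R (e b z * mod_gauss c a z))) (at z)" for z
    proof -
      have "p z * (mod_gauss c a z * (- \<i> * of_real (h \<bullet> a) - of_real (2 * c * (h \<bullet> z)))) +
          (\<Sum>b\<in>Basis. (h \<bullet> b) *\<^sub>R d b z) * mod_gauss c a z
          = (\<Sum>b\<in>Basis. (h \<bullet> b) *\<^sub>R (e b z * mod_gauss c a z))" for h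
        unfolding inner_sum_Basis[of h a] inner_sum_Basis[of h z] e_def
        by (simp add: scaleR_conv_of_real sum_distrib_left sum_distrib_right sum.distrib[symmetric]
            sum_subtractf[symmetric] sum_negf[symmetric] algebra_simps inner_commute)
      then show ?thesis
        unfolding g using has_derivative_mult[OF d(2)[rule_format, of z] mod_gauss_has_derivative[of c a z]]
        by simp
    qed
    then show ?thesis using e
      by (intro exI[of _ "\<lambda>b z. e b z * mod_gauss c a z"]) auto
  qed
  fix k :: nat
  obtain C n where C: "\<And>z. norm (p z) \<le> C * (1 + (norm z)\<^sup>2) ^ n"
    using cpoly_bound[OF p] by blast
  have C0: "0 \<le> C" using order_trans[OF norm_ge_zero C[of 0]] by simp
  have "norm (norm z ^ k * norm (g z)) \<le> C * (fact (n + k) * exp c / c ^ (n + k))" for z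
  proof -
    have "norm z ^ k \<le> (1 + (norm z)\<^sup>2) ^ k"
      by (rule power_mono[OF norm_le_one_plus_sq]) simp
    then have "norm z ^ k * norm (p z) \<le> (1 + (norm z)\<^sup>2) ^ k * (C * (1 + (norm z)\<^sup>2) ^ n)"
      by (intro mult_mono C) auto
    then have "norm z ^ k * norm (p z) * exp (- c * (norm z)\<^sup>2) \<le>
        (1 + (norm z)\<^sup>2) ^ k * (C * (1 + (norm z)\<^sup>2) ^ n) * exp (- c * (norm z)\<^sup>2)"
      by (rule mult_right_mono) simp
    also have "\<dots> = C * ((1 + (norm z)\<^sup>2) ^ (n + k) * exp (- c * (norm z)\<^sup>2))"
      by (simp add: power_add mult_ac)
    also have "\<dots> \<le> C * (fact (n + k) * exp c / c ^ (n + k))"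
      by (intro mult_left_mono power_times_gaussian_bounded c C0) simp
    finally show ?thesis by (simp add: g mod_gauss_def norm_mult mult.assoc)
  qed
  then show "bounded (range (\<lambda>z. norm z ^ k * norm (g z)))"
    unfolding bounded_iff by blast
qed

text \<open>Read off from the characteristic function of the standard normal distribution.\<close>

lemma std_gaussian_fourier:
  "integrable lborel (\<lambda>x::real. cis (t * x) * of_real (exp (- (x\<^sup>2) / 2)))"
  "(LINT x|lborel. cis (t * x) * of_real (exp (- (x\<^sup>2) / 2))) = of_real (sqrt (2 * pi) * exp (- (t\<^sup>2) / 2))"
proof -
  have int: "integrable lborel (\<lambda>x::real. exp (- (x\<^sup>2) / 2))"
  proof -
    have "integrable lborel (\<lambda>x. sqrt (2 * pi) * normal_density 0 1 x)"
      by (rule integrable_mult_right[OF integrable_normal_density]) simp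
    then show ?thesis by (simp add: normal_density_def)
  qed
  show "integrable lborel (\<lambda>x::real. cis (t * x) * of_real (exp (- (x\<^sup>2) / 2)))"
    by (rule Bochner_Integration.integrable_bound[OF int]) (auto simp: norm_mult)
  have "of_real (exp (- (t\<^sup>2) / 2)) = char std_normal_distribution t"
    by (simp add: char_std_normal_distribution)
  also have "\<dots> = (LINT x|lborel. std_normal_density x *\<^sub>R iexp (t * x))"
    unfolding char_def by (rule integral_density) (auto simp: normal_density_nonneg)
  also have "\<dots> = (LINT x|lborel. (1 / sqrt (2 * pi)) *\<^sub>R (cis (t * x) * of_real (exp (- (x\<^sup>2) / 2))))"
    by (rule Bochner_Integration.integral_cong)
       (auto simp: normal_density_def cis_conv_exp scaleR_conv_of_real mult_ac)
  also have "\<dots> = (LINT x|lborel. cis (t * x) * of_real (exp (- (x\<^sup>2) / 2))) / of_real (sqrt (2 * pi))"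
    by (simp add: scaleR_conv_of_real)
  finally show "(LINT x|lborel. cis (t * x) * of_real (exp (- (x\<^sup>2) / 2))) = of_real (sqrt (2 * pi) * exp (- (t\<^sup>2) / 2))"
    by (simp add: field_simps)
qed

lemma gaussian_fourier_euclidean:
  fixes w :: "'n::euclidean_space"
  shows "(LINT z|lborel. cis (z \<bullet> w) * of_real (exp (- ((norm z)\<^sup>2) / 2))) =
      of_real (sqrt (2 * pi) ^ DIM('n) * exp (- ((norm w)\<^sup>2) / 2))"
proof -
  have sq: "(norm z)\<^sup>2 = (\<Sum>b\<in>Basis. (z \<bullet> b)\<^sup>2)" for z :: 'n
    unfolding power2_norm_eq_inner by (subst euclidean_inner) (simp add: power2_eq_square)
  have ex: "exp (- ((norm z)\<^sup>2) / 2) = (\<Prod>b\<in>Basis. exp (- ((z \<bullet> b)\<^sup>2) / 2))" for z :: 'n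
    by (simp add: sq exp_sum[symmetric] sum_divide_distrib sum_negf)
  have "cis (z \<bullet> w) = (\<Prod>b\<in>Basis. cis ((w \<bullet> b) * (z \<bullet> b)))" for z
    by (subst euclidean_inner) (simp add: cis_conv_exp exp_sum[symmetric] sum_distrib_left mult_ac)
  then have "(LINT z|lborel. cis (z \<bullet> w) * of_real (exp (- ((norm z)\<^sup>2) / 2))) =
     (LINT z|lborel. (\<Prod>b\<in>Basis. cis ((w \<bullet> b) * (z \<bullet> b)) * of_real (exp (- ((z \<bullet> b)\<^sup>2) / 2))))"
    by (simp only: ex prod.distrib of_real_prod)
  also have "\<dots> = (\<Prod>b\<in>Basis. of_real (sqrt (2 * pi) * exp (- ((w \<bullet> b)\<^sup>2) / 2)))"
    by (subst lborel_integral_prod[OF std_gaussian_fourier(1)]) (simp only: std_gaussian_fourier(2))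
  also have "\<dots> = of_real (sqrt (2 * pi) ^ DIM('n) * exp (- ((norm w)\<^sup>2) / 2))"
    by (simp only: ex of_real_prod of_real_mult of_real_power prod.distrib prod_constant)
  finally show ?thesis .
qed

lemma inv_fourier_mod_gauss:
  assumes d: "d > 0"
  shows "inv_fourier (mod_gauss (d\<^sup>2 / 2) a) \<zeta> =
      of_real ((sqrt (2 * pi) / (2 * pi * d)) ^ 3 * exp (- ((norm (\<zeta> - a))\<^sup>2) / (2 * d\<^sup>2)))"
proof -
  let ?f = "\<lambda>z::pt. cis (z \<bullet> ((\<zeta> - a) /\<^sub>R d)) * complex_of_real (exp (- ((norm z)\<^sup>2) / 2))"
  have "(LINT z|lborel. cis (z \<bullet> \<zeta>) * mod_gauss (d\<^sup>2 / 2) a z) = (LINT z|lborel. ?f (0 + d *\<^sub>R z))"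
  proof (rule Bochner_Integration.integral_cong)
    fix z
    have "cis (z \<bullet> \<zeta>) * mod_gauss (d\<^sup>2 / 2) a z = (cis (z \<bullet> \<zeta>) * cis (- (z \<bullet> a))) * of_real (exp (- (d\<^sup>2 / 2) * (norm z)\<^sup>2))"
      by (simp add: mod_gauss_def)
    moreover have "(0 + d *\<^sub>R z) \<bullet> ((\<zeta> - a) /\<^sub>R d) = z \<bullet> \<zeta> - z \<bullet> a"
      using d by (simp add: inner_diff_right field_simps)
    ultimately show "cis (z \<bullet> \<zeta>) * mod_gauss (d\<^sup>2 / 2) a z = ?f (0 + d *\<^sub>R z)"
      using d by (simp only: cis_mult) (simp add: power_mult_distrib)
  qed simp
  also have "\<dots> = (LINT z|lborel. ?f z) /\<^sub>R (\<bar>d\<bar> ^ DIM(pt))"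
    by (rule lborel_integral_affine_euclidean(1)) (use d in auto)
  also have "\<dots> = of_real ((sqrt (2 * pi) / d) ^ 3 * exp (- ((norm (\<zeta> - a))\<^sup>2) / (2 * d\<^sup>2)))"
  proof -
    have dim: "DIM(pt) = 3" by simp
    have "(norm ((\<zeta> - a) /\<^sub>R d))\<^sup>2 = (norm (\<zeta> - a))\<^sup>2 / d\<^sup>2"
      using d by (simp add: power_mult_distrib power_inverse divide_inverse mult.commute)
    then have "(LINT z|lborel. ?f z) = of_real (sqrt (2 * pi) ^ 3 * exp (- ((norm (\<zeta> - a))\<^sup>2 / d\<^sup>2) / 2))"
      using gaussian_fourier_euclidean[of "(\<zeta> - a) /\<^sub>R d"] dim by (simp only:)
    also have "- ((norm (\<zeta> - a))\<^sup>2 / d\<^sup>2) / 2 = - ((norm (\<zeta> - a))\<^sup>2) / (2 * d\<^sup>2)"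
      by simp
    also have "of_real (s ^ 3 * E) /\<^sub>R (\<bar>d\<bar> ^ DIM(pt)) = complex_of_real ((s / d) ^ 3 * E)" for s E
      using d dim by (simp only: scaleR_conv_of_real of_real_mult[symmetric] abs_of_pos of_real_eq_iff)
        (simp only: power_mult_distrib power_inverse divide_inverse mult_ac)
    finally show ?thesis .
  qed
  finally have "inv_fourier (mod_gauss (d\<^sup>2 / 2) a) \<zeta> =
      of_real ((sqrt (2 * pi) / d) ^ 3 * exp (- ((norm (\<zeta> - a))\<^sup>2) / (2 * d\<^sup>2)) / (2 * pi) ^ 3)"
    unfolding inv_fourier_def by (simp only: of_real_divide)
  also have "(s / d) ^ 3 * E / p ^ 3 = (s / (p * d)) ^ 3 * E" for s E p :: real
    by (simp add: power_divide power_mult_distrib mult_ac)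
  finally show ?thesis .
qed

subsection \<open>A function is determined by its inverse Fourier transform\<close>

text \<open>The indicator of an open set is the limit of the continuous functions min(1, n dist(x,
  complement)), so the integral of \<open>G\<close> vanishes over open sets. These are stable under
  intersection and generate the Borel sets.\<close>

lemma AE_zero_of_continuous_test:
  fixes G :: "'a::euclidean_space \<Rightarrow> complex"
  assumes int: "integrable lborel G"
    and test: "\<And>k :: 'a \<Rightarrow> real. continuous_on UNIV k \<Longrightarrow> (\<And>x. \<bar>k x\<bar> \<le> 1) \<Longrightarrow> (LINT x|lborel. k x *\<^sub>R G x) = 0"
  shows "AE x in lborel. G x = 0"
proof (rule sigma_finite_measure.density_zero[OF sigma_finite_lborel int])
  have [measurable]: "G \<in> borel_measurable borel"
    using borel_measurable_integrable[OF int] by simp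
  have opn: "(LINT x:U|lborel. G x) = 0" if U: "open U" for U
  \<comment> \<open>For the whole space the complement is empty and \<open>infdist\<close> to it is
    0 by convention, so the approximation would be identically 0.\<close>
  proof (cases "U = UNIV")
    case True
    then show ?thesis using test[of "\<lambda>_. 1"] by (simp add: set_lebesgue_integral_def)
  next
    case False
    have [measurable]: "U \<in> sets borel" using U by simp
    have [measurable]: "(\<lambda>x. infdist x (- U)) \<in> borel_measurable borel"
      by (intro borel_measurable_continuous_onI continuous_intros)
    define k where "k n x = min 1 (real n * infdist x (- U))" for n x
    have "(\<lambda>n. LINT x|lborel. k n x *\<^sub>R G x) \<longlonglongrightarrow> (LINT x|lborel. indicator U x *\<^sub>R G x)"
    proof (rule integral_dominated_convergence[where w = "\<lambda>x. norm (G x)"])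
      show "(\<lambda>x. k n x *\<^sub>R G x) \<in> borel_measurable lborel" for n
        unfolding k_def by measurable
      show "AE x in lborel. norm (k n x *\<^sub>R G x) \<le> norm (G x)" for n
      proof (rule AE_I2)
        fix x
        have "\<bar>k n x\<bar> \<le> 1" unfolding k_def using infdist_nonneg[of x "- U"] by (simp add: abs_le_iff)
        then show "norm (k n x *\<^sub>R G x) \<le> norm (G x)"
          using mult_right_mono[of "\<bar>k n x\<bar>" 1 "norm (G x)"] by simp
      qed
      show "AE x in lborel. (\<lambda>n. k n x *\<^sub>R G x) \<longlonglongrightarrow> indicator U x *\<^sub>R G x"
      proof (intro AE_I2 tendsto_scaleR tendsto_const)
        fix x
        show "(\<lambda>n. k n x) \<longlonglongrightarrow> indicator U x"
        proof (cases "x \<in> U")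
          case True
          then have "infdist x (- U) > 0"
            using in_closed_iff_infdist_zero[of "- U" x] U False infdist_nonneg[of x "- U"]
            by (force simp: less_le)
          then obtain N :: nat where N: "1 < real N * infdist x (- U)"
            using reals_Archimedean3 by blast
          have "k n x = 1" if "n \<ge> N" for n
          proof -
            have "real N * infdist x (- U) \<le> real n * infdist x (- U)"
              using that infdist_nonneg by (intro mult_right_mono) auto
            then show ?thesis unfolding k_def using N by simp
          qed
          then have "\<forall>\<^sub>F n in sequentially. k n x = indicator U x"
            using True by (auto simp: eventually_sequentially intro!: exI[of _ N])
          then show ?thesis by (rule tendsto_eventually)
        next
          case False
          then show ?thesis by (simp add: k_def)
        qed
      qed
    qed (use int in auto)
    moreover have "(LINT x|lborel. k n x *\<^sub>R G x) = 0" for n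
      by (rule test) (auto simp: k_def abs_le_iff infdist_nonneg intro!: continuous_intros)
    ultimately show ?thesis
      by (simp add: set_lebesgue_integral_def LIMSEQ_const_iff)
  qed
  fix A :: "'a set" assume "A \<in> sets lborel"
  then have "A \<in> sigma_sets UNIV {S. open S}" by (simp add: borel_def)
  with Int_stable_def[of "{S::'a set. open S}"]
  have "Int_stable {S::'a set. open S}" "{S::'a set. open S} \<subseteq> Pow UNIV" "A \<in> sigma_sets UNIV {S. open S}"
    by auto
  then show "(LINT x:A|lborel. G x) = 0"
  proof (induction rule: sigma_sets_induct_disjoint)
    case (basic A)
    then show ?case by (simp add: opn)
  next
    case empty
    then show ?case by (simp add: set_lebesgue_integral_def)
  next
    case (compl A)
    then have [measurable]: "A \<in> sets borel" by (simp add: borel_def)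
    have "(LINT x:UNIV - A|lborel. G x) = (LINT x:UNIV|lborel. G x) - (LINT x:A|lborel. G x)"
    proof -
      have "integrable lborel (\<lambda>x. indicat_real A x *\<^sub>R G x)"
        by (rule integrable_mult_indicator[OF _ int]) simp
      then have "(LINT x|lborel. G x) - (LINT x|lborel. indicat_real A x *\<^sub>R G x) =
          (LINT x|lborel. G x - indicat_real A x *\<^sub>R G x)"
        using int by simp
      also have "\<dots> = (LINT x|lborel. indicat_real (UNIV - A) x *\<^sub>R G x)"
        by (rule Bochner_Integration.integral_cong) (auto simp: indicator_def)
      finally show ?thesis by (simp add: set_lebesgue_integral_def)
    qed
    then show ?case using compl(2) opn[of UNIV] by simp
  next
    case (union A)
    have A: "A i \<in> sets lborel" for i using union(2) by (auto simp: borel_def)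
    have "set_integrable lborel (\<Union>i. A i) G"
      unfolding set_integrable_def
      by (rule integrable_mult_indicator[OF _ int]) (use A in auto)
    then have "(LINT x:(\<Union>i. A i)|lborel. G x) = (\<Sum>i. (LINT x:(A i)|lborel. G x))"
      using union(1) A by (intro lebesgue_integral_countable_add) (auto simp: disjoint_family_on_def)
    then show ?case using union(3) by simp
  qed
qed

lemma integrable_gauss: "integrable lborel (\<lambda>z::pt. exp (- c * (norm z)\<^sup>2))" if "c > 0"
  using integrable_norm[OF schwartz_integrable[OF mod_gauss_schwartz[OF that, of 0]]]
  by (simp add: mod_gauss_def norm_mult)

lemma integrable_pair_mult:
  fixes f :: "'a::euclidean_space \<Rightarrow> 'c::{real_normed_field,banach,second_countable_topology}" and g :: "'b::euclidean_space \<Rightarrow> 'c"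
  assumes f: "integrable lborel f" and g: "integrable lborel g"
  shows "integrable (lborel \<Otimes>\<^sub>M lborel) (\<lambda>(x, y). f x * g y)"
proof (rule lborel_pair.Fubini_integrable)
  have [measurable]: "f \<in> borel_measurable borel" "g \<in> borel_measurable borel"
    using borel_measurable_integrable[OF f] borel_measurable_integrable[OF g] by simp_all
  show "(\<lambda>(x, y). f x * g y) \<in> borel_measurable (lborel \<Otimes>\<^sub>M lborel)" by measurable
  show "integrable lborel (\<lambda>x. LINT y|lborel. norm (case (x, y) of (x, y) \<Rightarrow> f x * g y))"
    using f by (simp add: norm_mult)
  show "AE x in lborel. integrable lborel (\<lambda>y. case (x, y) of (x, y) \<Rightarrow> f x * g y)"
    using g by simp
qed

lemma tempered_integrable_gauss:
  assumes "tempered_fun g" "c > 0"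
  shows "integrable lborel (\<lambda>\<zeta>. norm (g \<zeta>) * exp (- c * (norm \<zeta>)\<^sup>2))"
proof -
  have "integrable lborel (\<lambda>\<zeta>. g \<zeta> * mod_gauss c 0 \<zeta>)"
    using assms(1) mod_gauss_schwartz[OF assms(2), of "0::pt"] by (simp add: tempered_fun_def)
  from integrable_norm[OF this] show ?thesis
    by (simp add: mod_gauss_def norm_mult)
qed

text \<open>Integrating the hypothesis over the centres \<open>a\<close> against a weight
  \<open>h\<close> shows that \<open>g\<close> annihilates the Gaussian averages \<open>H d\<close>
  of \<open>h\<close>; these tend to a multiple of \<open>h\<close> as the width \<open>d\<close>
  shrinks. The factor exp(-|\<zeta>|^2) in \<open>h\<close> turns \<open>g\<close> into an
  integrable function, to which continuous test functions apply.\<close>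

lemma tempered_AE_zero:
  assumes g: "tempered_fun g"
    and zero: "\<And>a d. d > 0 \<Longrightarrow> (LINT \<zeta>|lborel. g \<zeta> * inv_fourier (mod_gauss (d\<^sup>2 / 2) a) \<zeta>) = 0"
  shows "AE \<zeta> in lborel. g \<zeta> = 0"
proof -
  have gm [measurable]: "g \<in> borel_measurable borel" using g by (simp add: tempered_fun_def)
  define e where "e d a \<zeta> = exp (- ((norm (\<zeta> - a))\<^sup>2) / (2 * d\<^sup>2))" for d :: real and a \<zeta> :: pt
  have e0: "(LINT \<zeta>|lborel. g \<zeta> * of_real (e d a \<zeta>)) = 0" if d: "d > 0" for d a
  proof -
    define c where "c = (sqrt (2 * pi) / (2 * pi * d)) ^ 3"
    have c: "c \<noteq> 0" using d by (simp add: c_def)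
    have "0 = (LINT \<zeta>|lborel. g \<zeta> * inv_fourier (mod_gauss (d\<^sup>2 / 2) a) \<zeta>)"
      using zero[OF d] by simp
    also have "\<dots> = (LINT \<zeta>|lborel. of_real c * (g \<zeta> * of_real (e d a \<zeta>)))"
    proof -
      have "inv_fourier (mod_gauss (d\<^sup>2 / 2) a) \<zeta> = of_real c * of_real (e d a \<zeta>)" for \<zeta>
        unfolding inv_fourier_mod_gauss[OF d] c_def e_def by (simp only: of_real_mult)
      then show ?thesis by (simp only: mult_ac)
    qed
    also have "\<dots> = of_real c * (LINT \<zeta>|lborel. g \<zeta> * of_real (e d a \<zeta>))" by simp
    finally show ?thesis using c by simp
  qed
  define M where "M = (LINT z::pt|lborel. exp (- (1/2) * (norm z)\<^sup>2))"
  have M: "M > 0"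
  proof -
    have "complex_of_real M = of_real (sqrt (2 * pi) ^ DIM(pt))"
      using gaussian_fourier_euclidean[of "0::pt"] by (simp add: M_def)
    then have "M = sqrt (2 * pi) ^ DIM(pt)" unfolding of_real_eq_iff .
    then show ?thesis by simp
  qed
  have "(LINT \<zeta>|lborel. k \<zeta> *\<^sub>R (g \<zeta> * of_real (exp (- (norm \<zeta>)\<^sup>2)))) = 0"
    if k: "continuous_on UNIV k" "\<And>x. \<bar>k x\<bar> \<le> 1" for k :: "pt \<Rightarrow> real"
  proof -
    have [measurable]: "k \<in> borel_measurable borel"
      by (rule borel_measurable_continuous_onI[OF k(1)])
    define h where "h a = exp (- (norm a)\<^sup>2) * k a" for a :: pt
    have hb: "\<bar>h a\<bar> \<le> exp (- (norm a)\<^sup>2)" for a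
      using mult_left_mono[OF k(2), of "exp (- (norm a)\<^sup>2)" a] by (simp add: h_def abs_mult)
    have hc: "continuous_on UNIV h" unfolding h_def by (intro continuous_intros k)
    have [measurable]: "h \<in> borel_measurable borel"
      by (rule borel_measurable_continuous_onI[OF hc])
    define H where "H d \<zeta> = (LINT z|lborel. h (\<zeta> + d *\<^sub>R z) * exp (- (1/2) * (norm z)\<^sup>2))" for d :: real and \<zeta> :: pt
    \<comment> \<open>For \<open>d \<le> 1/2\<close> replacing the translate by \<zeta> costs a
      quarter of |z|^2 in the exponent, half of what the Gaussian in \<open>z\<close> supplies. The
      majorant is therefore independent of \<open>d\<close>.\<close>
    have bound: "\<bar>h (\<zeta> + d *\<^sub>R z) * exp (- (1/2) * (norm z)\<^sup>2)\<bar> \<le> exp (- (1/2) * (norm \<zeta>)\<^sup>2) * exp (- (1/4) * (norm z)\<^sup>2)"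
      if d: "0 < d" "d \<le> 1/2" for d \<zeta> z
    proof -
      have "(norm (\<zeta> - (\<zeta> + d *\<^sub>R z)))\<^sup>2 \<le> 1/4 * (norm z)\<^sup>2"
        using mult_right_mono[OF power_mono[OF d(2), of 2], of "(norm z)\<^sup>2"] d
        by (simp add: power_mult_distrib power_divide)
      with norm_sq_add_le[of \<zeta> "\<zeta> + d *\<^sub>R z"]
      have "- (norm (\<zeta> + d *\<^sub>R z))\<^sup>2 + - (1/2) * (norm z)\<^sup>2 \<le> - (1/2) * (norm \<zeta>)\<^sup>2 + - (1/4) * (norm z)\<^sup>2"
        by simp
      then have "exp (- (norm (\<zeta> + d *\<^sub>R z))\<^sup>2) * exp (- (1/2) * (norm z)\<^sup>2) \<le> exp (- (1/2) * (norm \<zeta>)\<^sup>2) * exp (- (1/4) * (norm z)\<^sup>2)"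
        unfolding exp_add[symmetric] by simp
      with mult_right_mono[OF hb[of "\<zeta> + d *\<^sub>R z"] exp_ge_zero[of "- (1/2) * (norm z)\<^sup>2"]]
      show ?thesis unfolding abs_mult abs_exp_cancel by (rule order_trans)
    qed
    have ig4: "integrable lborel (\<lambda>z::pt. exp (- (1/4) * (norm z)\<^sup>2))" by (rule integrable_gauss) simp
    have H0: "(LINT \<zeta>|lborel. g \<zeta> * of_real (H d \<zeta>)) = 0" if d: "0 < d" "d \<le> 1/2" for d
    proof -
      have He: "H d \<zeta> = (LINT a|lborel. h a * e d a \<zeta>) / d ^ 3" for \<zeta>
      proof -
        let ?F = "\<lambda>a. h a * e d a \<zeta>"
        have "H d \<zeta> = (LINT z|lborel. ?F (\<zeta> + d *\<^sub>R z))"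
          unfolding H_def e_def by (rule Bochner_Integration.integral_cong) (use d in \<open>simp_all add: power_mult_distrib\<close>)
        also have "\<dots> = (LINT z|lborel. ?F z) /\<^sub>R (\<bar>d\<bar> ^ DIM(pt))"
          by (rule lborel_integral_affine_euclidean(1)) (use d in \<open>auto simp: e_def\<close>)
        also have "\<dots> = (LINT a|lborel. h a * e d a \<zeta>) / d ^ 3"
        proof -
          have "\<bar>d\<bar> ^ DIM(pt) = d ^ 3" using d by (simp add: power3_eq_cube)
          then show ?thesis by (simp only: divide_inverse real_scaleR_def mult.commute)
        qed
        finally show ?thesis .
      qed
      have int: "integrable (lborel \<Otimes>\<^sub>M lborel) (\<lambda>(\<zeta>, a). g \<zeta> * of_real (h a * e d a \<zeta>))"
      proof (rule Bochner_Integration.integrable_bound[OF integrable_pair_mult])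
        show "integrable lborel (\<lambda>\<zeta>. norm (g \<zeta>) * exp (- (1/4) * (norm \<zeta>)\<^sup>2))"
          by (rule tempered_integrable_gauss[OF g]) simp
        show "integrable lborel (\<lambda>a::pt. exp (- (1/2) * (norm a)\<^sup>2))"
          by (rule integrable_gauss) simp
        show "(\<lambda>(\<zeta>, a). g \<zeta> * of_real (h a * e d a \<zeta>)) \<in> borel_measurable (lborel \<Otimes>\<^sub>M lborel)"
          unfolding e_def by measurable
        have "norm (g \<zeta> * of_real (h a * e d a \<zeta>)) \<le> norm (norm (g \<zeta>) * exp (- (1/4) * (norm \<zeta>)\<^sup>2) * exp (- (1/2) * (norm a)\<^sup>2))" for \<zeta> a
        proof -
          have "e d a \<zeta> \<le> exp (- (1/2) * (norm (\<zeta> - a))\<^sup>2)"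
          proof -
            have "2 * d\<^sup>2 \<le> 2" using d power_mono[of d 1 2] by simp
            then have "(norm (\<zeta> - a))\<^sup>2 / 2 \<le> (norm (\<zeta> - a))\<^sup>2 / (2 * d\<^sup>2)"
              using d by (intro divide_left_mono) auto
            then show ?thesis by (simp add: e_def)
          qed
          then have "\<bar>h a\<bar> * e d a \<zeta> \<le> exp (- (norm a)\<^sup>2) * exp (- (1/2) * (norm (\<zeta> - a))\<^sup>2)"
            by (intro mult_mono hb) (auto simp: e_def)
          also have "\<dots> \<le> exp (- (1/4) * (norm \<zeta>)\<^sup>2) * exp (- (1/2) * (norm a)\<^sup>2)"
            unfolding exp_add[symmetric] using norm_sq_add_le[of \<zeta> a] by simp
          finally have "norm (g \<zeta>) * (\<bar>h a\<bar> * e d a \<zeta>) \<le> norm (g \<zeta>) * (exp (- (1/4) * (norm \<zeta>)\<^sup>2) * exp (- (1/2) * (norm a)\<^sup>2))"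
            by (rule mult_left_mono) simp
          then show ?thesis by (simp add: norm_mult abs_mult e_def mult.assoc)
        qed
        then show "AE x in lborel \<Otimes>\<^sub>M lborel. norm (case x of (\<zeta>, a) \<Rightarrow> g \<zeta> * of_real (h a * e d a \<zeta>)) \<le>
            norm (case x of (\<zeta>, a) \<Rightarrow> norm (g \<zeta>) * exp (- (1/4) * (norm \<zeta>)\<^sup>2) * exp (- (1/2) * (norm a)\<^sup>2))"
          by (intro AE_I2) auto
      qed
      have "(LINT \<zeta>|lborel. LINT a|lborel. g \<zeta> * of_real (h a * e d a \<zeta>)) =
          (LINT a|lborel. LINT \<zeta>|lborel. g \<zeta> * of_real (h a * e d a \<zeta>))"
        by (rule lborel_pair.Fubini_integral[OF int, symmetric])
      also have "\<dots> = (LINT a|lborel. of_real (h a) * (LINT \<zeta>|lborel. g \<zeta> * of_real (e d a \<zeta>)))"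
      proof (rule Bochner_Integration.integral_cong)
        fix a
        have "(LINT \<zeta>|lborel. g \<zeta> * of_real (h a * e d a \<zeta>)) = (LINT \<zeta>|lborel. of_real (h a) * (g \<zeta> * of_real (e d a \<zeta>)))"
          by (rule Bochner_Integration.integral_cong) simp_all
        then show "(LINT \<zeta>|lborel. g \<zeta> * of_real (h a * e d a \<zeta>)) = of_real (h a) * (LINT \<zeta>|lborel. g \<zeta> * of_real (e d a \<zeta>))"
          by simp
      qed simp
      also have "\<dots> = 0" using e0[OF d(1)] by simp
      finally have "(LINT \<zeta>|lborel. g \<zeta> * of_real (LINT a|lborel. h a * e d a \<zeta>)) = 0"
        by (simp only: integral_mult_right_zero integral_complex_of_real)
      then show ?thesis using d by (simp add: He)
    qed
    define d where "d n = 1 / real (n + 2)" for n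
    have d: "0 < d n" "d n \<le> 1/2" for n by (simp_all add: d_def)
    have d0: "d \<longlonglongrightarrow> 0" unfolding d_def
      using LIMSEQ_ignore_initial_segment[OF lim_1_over_n, of 2] by simp
    have Hlim: "(\<lambda>n. H (d n) \<zeta>) \<longlonglongrightarrow> h \<zeta> * M" for \<zeta>
    proof -
      have "(\<lambda>n. H (d n) \<zeta>) \<longlonglongrightarrow> (LINT z|lborel. h \<zeta> * exp (- (1/2) * (norm (z::pt))\<^sup>2))"
        unfolding H_def
      proof (rule integral_dominated_convergence[where w = "\<lambda>z. exp (- (1/2) * (norm \<zeta>)\<^sup>2) * exp (- (1/4) * (norm z)\<^sup>2)"])
        show "AE z in lborel. (\<lambda>n. h (\<zeta> + d n *\<^sub>R z) * exp (- (1/2) * (norm z)\<^sup>2)) \<longlonglongrightarrow> h \<zeta> * exp (- (1/2) * (norm z)\<^sup>2)"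
        proof (intro AE_I2 tendsto_mult tendsto_const)
          fix z
          have "(\<lambda>n. \<zeta> + d n *\<^sub>R z) \<longlonglongrightarrow> \<zeta> + 0 *\<^sub>R z" by (intro tendsto_intros d0)
          then show "(\<lambda>n. h (\<zeta> + d n *\<^sub>R z)) \<longlonglongrightarrow> h \<zeta>"
            by (intro continuous_on_tendsto_compose[OF hc]) simp_all
        qed
      qed (use bound[OF d] ig4 in auto)
      then show ?thesis by (simp add: M_def)
    qed
    have "(\<lambda>n. LINT \<zeta>|lborel. g \<zeta> * of_real (H (d n) \<zeta>)) \<longlonglongrightarrow> (LINT \<zeta>|lborel. g \<zeta> * of_real (h \<zeta> * M))"
    proof (rule integral_dominated_convergence[where w = "\<lambda>\<zeta>. norm (g \<zeta>) * exp (- (1/2) * (norm \<zeta>)\<^sup>2) * (LINT z::pt|lborel. exp (- (1/4) * (norm z)\<^sup>2))"])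
      show "(\<lambda>\<zeta>. g \<zeta> * of_real (H (d n) \<zeta>)) \<in> borel_measurable lborel" for n
        unfolding H_def by measurable
      show "(\<lambda>\<zeta>. g \<zeta> * of_real (h \<zeta> * M)) \<in> borel_measurable lborel" by measurable
      show "integrable lborel (\<lambda>\<zeta>. norm (g \<zeta>) * exp (- (1/2) * (norm \<zeta>)\<^sup>2) * (LINT z::pt|lborel. exp (- (1/4) * (norm z)\<^sup>2)))"
        by (intro integrable_mult_left tempered_integrable_gauss[OF g]) simp
      show "AE \<zeta> in lborel. (\<lambda>n. g \<zeta> * of_real (H (d n) \<zeta>)) \<longlonglongrightarrow> g \<zeta> * of_real (h \<zeta> * M)"
        by (intro AE_I2 tendsto_intros Hlim)
      show "AE \<zeta> in lborel. norm (g \<zeta> * of_real (H (d n) \<zeta>)) \<le> norm (g \<zeta>) * exp (- (1/2) * (norm \<zeta>)\<^sup>2) * (LINT z::pt|lborel. exp (- (1/4) * (norm z)\<^sup>2))" for n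
      proof (rule AE_I2)
        fix \<zeta> :: pt
        have "\<bar>H (d n) \<zeta>\<bar> \<le> (LINT z|lborel. exp (- (1/2) * (norm \<zeta>)\<^sup>2) * exp (- (1/4) * (norm (z::pt))\<^sup>2))"
          unfolding H_def
          by (rule order_trans[OF integral_abs_bound integral_mono'])
             (use bound[OF d] ig4 in auto)
        also have "\<dots> = exp (- (1/2) * (norm \<zeta>)\<^sup>2) * (LINT z::pt|lborel. exp (- (1/4) * (norm z)\<^sup>2))"
          by simp
        finally show "norm (g \<zeta> * of_real (H (d n) \<zeta>)) \<le> norm (g \<zeta>) * exp (- (1/2) * (norm \<zeta>)\<^sup>2) * (LINT z::pt|lborel. exp (- (1/4) * (norm z)\<^sup>2))"
          by (simp add: norm_mult mult.assoc mult_left_mono)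
      qed
    qed
    then have "(LINT \<zeta>|lborel. g \<zeta> * of_real (h \<zeta> * M)) = 0"
      using H0[OF d] by (simp add: LIMSEQ_const_iff)
    moreover have "(LINT \<zeta>|lborel. g \<zeta> * of_real (h \<zeta> * M)) = of_real M * (LINT \<zeta>|lborel. k \<zeta> *\<^sub>R (g \<zeta> * of_real (exp (- (norm \<zeta>)\<^sup>2))))"
    proof -
      have "(LINT \<zeta>|lborel. g \<zeta> * of_real (h \<zeta> * M)) = (LINT \<zeta>|lborel. of_real M * (k \<zeta> *\<^sub>R (g \<zeta> * of_real (exp (- (norm \<zeta>)\<^sup>2)))))"
        by (rule Bochner_Integration.integral_cong) (simp_all add: h_def scaleR_conv_of_real)
      then show ?thesis by (simp only: integral_mult_right_zero)
    qed
    ultimately show ?thesis using M by simp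
  qed
  then have "AE \<zeta> in lborel. g \<zeta> * of_real (exp (- (norm \<zeta>)\<^sup>2)) = 0"
  proof (rule AE_zero_of_continuous_test[rotated])
    have "integrable lborel (\<lambda>\<zeta>. g \<zeta> * mod_gauss 1 0 \<zeta>)"
      using g mod_gauss_schwartz[of 1 "0::pt"] by (simp add: tempered_fun_def)
    then show "integrable lborel (\<lambda>\<zeta>. g \<zeta> * of_real (exp (- (norm \<zeta>)\<^sup>2)))"
      by (simp add: mod_gauss_def)
  qed
  then show ?thesis by simp
qed


lemma tempered_integrable_inv_fourier_mod_gauss:
  assumes g: "tempered_fun g" and d: "d > 0"
  shows "integrable lborel (\<lambda>\<zeta>. g \<zeta> * inv_fourier (mod_gauss (d\<^sup>2 / 2) a) \<zeta>)"
proof -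
  have [measurable]: "g \<in> borel_measurable borel" using g by (simp add: tempered_fun_def)
  define c where "c = 1 / (2 * d\<^sup>2)"
  have c: "c > 0" using d by (simp add: c_def)
  define K where "K = \<bar>(sqrt (2 * pi) / (2 * pi * d)) ^ 3\<bar> * exp (c * (norm a)\<^sup>2)"
  have "integrable lborel (\<lambda>\<zeta>. K * (norm (g \<zeta>) * exp (- (c/2) * (norm \<zeta>)\<^sup>2)))"
    by (rule integrable_mult_right[OF tempered_integrable_gauss[OF g]]) (use c in simp)
  then show ?thesis
  proof (rule Bochner_Integration.integrable_bound)
    have [measurable]: "mod_gauss (d\<^sup>2 / 2) a \<in> borel_measurable borel"
      unfolding mod_gauss_def[abs_def] by measurable
    show "(\<lambda>\<zeta>. g \<zeta> * inv_fourier (mod_gauss (d\<^sup>2 / 2) a) \<zeta>) \<in> borel_measurable lborel"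
      by measurable
    show "AE \<zeta> in lborel. norm (g \<zeta> * inv_fourier (mod_gauss (d\<^sup>2 / 2) a) \<zeta>) \<le> norm (K * (norm (g \<zeta>) * exp (- (c/2) * (norm \<zeta>)\<^sup>2)))"
    proof (rule AE_I2)
      fix \<zeta>
      have "- ((norm (\<zeta> - a))\<^sup>2) / (2 * d\<^sup>2) = c * - (norm (\<zeta> - a))\<^sup>2"
        by (simp add: c_def)
      also have "\<dots> \<le> c * ((norm a)\<^sup>2 + - (1/2) * (norm \<zeta>)\<^sup>2)"
        using norm_sq_add_le[of \<zeta> a] c by (intro mult_left_mono) auto
      also have "\<dots> = c * (norm a)\<^sup>2 + - (c/2) * (norm \<zeta>)\<^sup>2"
        by (simp add: algebra_simps)
      finally have "exp (- ((norm (\<zeta> - a))\<^sup>2) / (2 * d\<^sup>2)) \<le> exp (c * (norm a)\<^sup>2) * exp (- (c/2) * (norm \<zeta>)\<^sup>2)"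
        unfolding exp_add[symmetric] by simp
      from mult_left_mono[OF this mult_nonneg_nonneg[OF norm_ge_zero[of "g \<zeta>"] abs_ge_zero[of "(sqrt (2 * pi) / (2 * pi * d)) ^ 3"]]]
      show "norm (g \<zeta> * inv_fourier (mod_gauss (d\<^sup>2 / 2) a) \<zeta>) \<le> norm (K * (norm (g \<zeta>) * exp (- (c/2) * (norm \<zeta>)\<^sup>2)))"
        unfolding inv_fourier_mod_gauss[OF d] norm_mult norm_of_real abs_mult K_def abs_exp_cancel real_norm_def
        by (simp only: mult_ac abs_idempotent abs_norm_cancel)
    qed
  qed
qed

lemma tempered_unique:
  assumes g: "tempered_fun g" and h: "tempered_fun h" and eq: "inv_fourier_dist g = inv_fourier_dist h"
  shows "AE \<zeta> in lborel. g \<zeta> = h \<zeta>"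
proof -
  have "AE \<zeta> in lborel. g \<zeta> - h \<zeta> = 0"
  proof (rule tempered_AE_zero)
    show "tempered_fun (\<lambda>\<zeta>. g \<zeta> - h \<zeta>)"
      using g h by (auto simp: tempered_fun_def left_diff_distrib)
    fix a :: pt and d :: real assume d: "d > 0"
    have "mod_gauss (d\<^sup>2 / 2) a \<in> schwartz" using d by (intro mod_gauss_schwartz) simp
    with eq have "(LINT \<zeta>|lborel. g \<zeta> * inv_fourier (mod_gauss (d\<^sup>2 / 2) a) \<zeta>) =
        (LINT \<zeta>|lborel. h \<zeta> * inv_fourier (mod_gauss (d\<^sup>2 / 2) a) \<zeta>)"
      by (auto simp: inv_fourier_dist_def fun_eq_iff split: if_splits)
    then show "(LINT \<zeta>|lborel. (g \<zeta> - h \<zeta>) * inv_fourier (mod_gauss (d\<^sup>2 / 2) a) \<zeta>) = 0"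
      using tempered_integrable_inv_fourier_mod_gauss[OF g d, of a] tempered_integrable_inv_fourier_mod_gauss[OF h d, of a]
      by (simp add: left_diff_distrib)
  qed
  then show ?thesis by simp
qed

lemma inv_fourier_dist_cong_AE:
  assumes [measurable]: "g \<in> borel_measurable borel" "h \<in> borel_measurable borel"
    and "AE \<zeta> in lborel. g \<zeta> = h \<zeta>"
  shows "inv_fourier_dist g = inv_fourier_dist h"
proof
  fix \<psi>
  show "inv_fourier_dist g \<psi> = inv_fourier_dist h \<psi>"
  proof (cases "\<psi> \<in> schwartz")
    case True
    then have [measurable]: "\<psi> \<in> borel_measurable borel" by (rule schwartz_measurable)
    show ?thesis
      unfolding inv_fourier_dist_def using assms(3) by (auto intro!: integral_cong_AE)
  qed (simp add: inv_fourier_dist_def)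
qed

text \<open>The representative picked by \<open>SOME\<close> is determined only up to null sets,
  hence \<open>AE\<close>; it is afterwards used only under integrals.\<close>

lemma fourier_fun_inv_fourier_dist:
  assumes "tempered_fun g"
  shows "tempered_fun (fourier_fun (inv_fourier_dist g))"
    and "AE \<zeta> in lborel. fourier_fun (inv_fourier_dist g) \<zeta> = g \<zeta>"
proof -
  let ?h = "fourier_fun (inv_fourier_dist g)"
  have "tempered_fun ?h \<and> inv_fourier_dist g = inv_fourier_dist ?h"
    unfolding fourier_fun_def by (rule someI[where P = "\<lambda>h. tempered_fun h \<and> inv_fourier_dist g = inv_fourier_dist h" and x = g]) (use assms in simp)
  then show "tempered_fun ?h" "AE \<zeta> in lborel. ?h \<zeta> = g \<zeta>"
    using tempered_unique[OF _ assms, of ?h] by simp_all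
qed

lemma fourier_mult_inv_fourier_dist:
  assumes "tempered_fun g" and [measurable]: "m \<in> borel_measurable borel"
  shows "fourier_mult m (inv_fourier_dist g) = inv_fourier_dist (\<lambda>\<zeta>. m \<zeta> * g \<zeta>)"
proof -
  have [measurable]: "g \<in> borel_measurable borel" "fourier_fun (inv_fourier_dist g) \<in> borel_measurable borel"
    using assms(1) fourier_fun_inv_fourier_dist(1)[OF assms(1)] by (simp_all add: tempered_fun_def)
  show ?thesis unfolding fourier_mult_def
    by (rule inv_fourier_dist_cong_AE) (use fourier_fun_inv_fourier_dist(2)[OF assms(1)] in auto)
qed

section \<open>Seminormed spaces and second derivatives\<close>

definition seminormed :: "'a::real_vector nspace \<Rightarrow> bool" where
  "seminormed X \<longleftrightarrow> 0 \<in> points X \<and>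
     (\<forall>u\<in>points X. 0 \<le> nrm X u) \<and>
     (\<forall>u\<in>points X. \<forall>v\<in>points X. u + v \<in> points X \<and> nrm X (u + v) \<le> nrm X u + nrm X v) \<and>
     (\<forall>c. \<forall>u\<in>points X. c *\<^sub>R u \<in> points X \<and> nrm X (c *\<^sub>R u) = \<bar>c\<bar> * nrm X u)"

lemma
  assumes "seminormed X"
  shows seminormed_zero: "0 \<in> points X" "nrm X 0 = 0"
    and seminormed_nonneg: "u \<in> points X \<Longrightarrow> 0 \<le> nrm X u"
    and seminormed_add: "u \<in> points X \<Longrightarrow> v \<in> points X \<Longrightarrow> u + v \<in> points X"
      "u \<in> points X \<Longrightarrow> v \<in> points X \<Longrightarrow> nrm X (u + v) \<le> nrm X u + nrm X v"
    and seminormed_scale: "u \<in> points X \<Longrightarrow> c *\<^sub>R u \<in> points X"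
      "u \<in> points X \<Longrightarrow> nrm X (c *\<^sub>R u) = \<bar>c\<bar> * nrm X u"
    and seminormed_diff: "u \<in> points X \<Longrightarrow> v \<in> points X \<Longrightarrow> u - v \<in> points X"
      "u \<in> points X \<Longrightarrow> v \<in> points X \<Longrightarrow> nrm X (u - v) \<le> nrm X u + nrm X v"
proof -
  show z: "0 \<in> points X" and "u \<in> points X \<Longrightarrow> 0 \<le> nrm X u"
    and a: "u \<in> points X \<Longrightarrow> v \<in> points X \<Longrightarrow> u + v \<in> points X"
      "u \<in> points X \<Longrightarrow> v \<in> points X \<Longrightarrow> nrm X (u + v) \<le> nrm X u + nrm X v"
    and s: "u \<in> points X \<Longrightarrow> c *\<^sub>R u \<in> points X"
      "u \<in> points X \<Longrightarrow> nrm X (c *\<^sub>R u) = \<bar>c\<bar> * nrm X u" for u v c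
    using assms by (auto simp: seminormed_def)
  show "nrm X 0 = 0" using s(2)[OF z, of 0] by simp
  show "u - v \<in> points X" "nrm X (u - v) \<le> nrm X u + nrm X v" if "u \<in> points X" "v \<in> points X"
    using a[OF that(1) s(1)[OF that(2), of "-1"]] s(2)[OF that(2), of "-1"] by simp_all
qed

lemma
  fixes X :: "'a::real_vector nspace"
  assumes X: "seminormed X" and T: "0 \<le> T"
  shows seminormed_continuous_curves: "seminormed (continuous_curves T X)"
    and nrm_le_nrm_continuous_curves:
      "u \<in> points (continuous_curves T X) \<Longrightarrow> t \<in> {-T..T} \<Longrightarrow> nrm X (u t) \<le> nrm (continuous_curves T X) u"
proof -
  let ?Y = "continuous_curves T X"
  let ?I = "{-T..T}"
  have pY: "u \<in> points ?Y \<longleftrightarrow> (\<forall>t\<in>?I. u t \<in> points X) \<and> (\<forall>t. t \<notin> ?I \<longrightarrow> u t = 0) \<and>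
      (\<forall>t\<in>?I. ((\<lambda>t'. nrm X (u t' - u t)) \<longlongrightarrow> 0) (at t within ?I))" for u
    by (simp add: continuous_curves_def)
  have nY: "nrm ?Y u = (SUP t\<in>?I. nrm X (u t))" for u
    by (simp add: continuous_curves_def)
  have I: "?I \<noteq> {}" "0 \<in> ?I" using T by auto
  \<comment> \<open>A supremum of reals bounds its members only if they are bounded above. Here this
    is continuity of the norm along the curve on a compact interval.\<close>
  have bdd: "bdd_above ((\<lambda>t. nrm X (u t)) ` ?I)" if u: "u \<in> points ?Y" for u
  proof -
    have "continuous_on ?I (\<lambda>t. nrm X (u t))"
      unfolding continuous_on_def
    proof
      fix t assume t: "t \<in> ?I"
      have "((\<lambda>t'. nrm X (u t') - nrm X (u t)) \<longlongrightarrow> 0) (at t within ?I)"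
      proof (rule Lim_null_comparison)
        show "((\<lambda>t'. nrm X (u t' - u t)) \<longlongrightarrow> 0) (at t within ?I)" using u t by (auto simp: pY)
        have "\<bar>nrm X (u t') - nrm X (u t)\<bar> \<le> nrm X (u t' - u t)" if "t' \<in> ?I" for t'
        proof -
          have p: "u t' \<in> points X" "u t \<in> points X" using u t that by (auto simp: pY)
          have "nrm X (u t') \<le> nrm X (u t' - u t) + nrm X (u t)"
            using seminormed_add(2)[OF X seminormed_diff(1)[OF X p] p(2)] by simp
          moreover have "nrm X (u t) \<le> nrm X (u t') + nrm X (u t' - u t)"
            using seminormed_diff(2)[OF X p(1) seminormed_diff(1)[OF X p]] by simp
          ultimately show ?thesis by simp
        qed
        then show "\<forall>\<^sub>F t' in at t within ?I. norm (nrm X (u t') - nrm X (u t)) \<le> nrm X (u t' - u t)"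
          by (auto simp: eventually_at_filter)
      qed
      then show "((\<lambda>t. nrm X (u t)) \<longlongrightarrow> nrm X (u t)) (at t within ?I)"
        by (rule LIM_zero_cancel)
    qed
    then have "compact ((\<lambda>t. nrm X (u t)) ` ?I)" by (intro compact_continuous_image) auto
    then show ?thesis by (intro bounded_imp_bdd_above compact_imp_bounded)
  qed
  show le: "nrm X (u t) \<le> nrm ?Y u" if "u \<in> points ?Y" "t \<in> ?I" for u t
    unfolding nY by (rule cSUP_upper[OF that(2) bdd[OF that(1)]])
  have least: "nrm ?Y u \<le> K" if "\<And>t. t \<in> ?I \<Longrightarrow> nrm X (u t) \<le> K" for u K
    unfolding nY by (rule cSUP_least[OF I(1) that])
  have p: "u t \<in> points X" if "u \<in> points ?Y" "t \<in> ?I" for u t using that by (auto simp: pY)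
  have z: "0 \<in> points ?Y" using seminormed_zero[OF X] by (auto simp: pY)
  have nn: "0 \<le> nrm ?Y u" if "u \<in> points ?Y" for u
    using seminormed_nonneg[OF X p[OF that I(2)]] le[OF that I(2)] by linarith
  have ap: "u + v \<in> points ?Y" if u: "u \<in> points ?Y" and v: "v \<in> points ?Y" for u v
    unfolding pY
  proof (intro conjI ballI allI impI)
    fix t assume t: "t \<in> ?I"
    show "(u + v) t \<in> points X" using seminormed_add(1)[OF X p[OF u t] p[OF v t]] by (simp add: plus_fun_def)
    show "((\<lambda>t'. nrm X ((u + v) t' - (u + v) t)) \<longlongrightarrow> 0) (at t within ?I)"
    proof (rule Lim_null_comparison)
      have "((\<lambda>t'. nrm X (u t' - u t) + nrm X (v t' - v t)) \<longlongrightarrow> 0 + 0) (at t within ?I)"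
        by (intro tendsto_add) (use u v t in \<open>auto simp: pY\<close>)
      then show "((\<lambda>t'. nrm X (u t' - u t) + nrm X (v t' - v t)) \<longlongrightarrow> 0) (at t within ?I)" by simp
      have "\<bar>nrm X ((u + v) t' - (u + v) t)\<bar> \<le> nrm X (u t' - u t) + nrm X (v t' - v t)" if t': "t' \<in> ?I" for t'
      proof -
        have du: "u t' - u t \<in> points X" and dv: "v t' - v t \<in> points X"
          using seminormed_diff(1)[OF X] p[OF u t] p[OF v t] p[OF u t'] p[OF v t'] by auto
        have "(u + v) t' - (u + v) t = (u t' - u t) + (v t' - v t)"
          by (simp add: plus_fun_def algebra_simps)
        then show ?thesis
          using seminormed_add(2)[OF X du dv] seminormed_nonneg[OF X seminormed_add(1)[OF X du dv]]
          by (simp only: abs_of_nonneg)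
      qed
      then show "\<forall>\<^sub>F t' in at t within ?I. norm (nrm X ((u + v) t' - (u + v) t)) \<le> nrm X (u t' - u t) + nrm X (v t' - v t)"
        by (auto simp: eventually_at_filter)
    qed
  qed (use u v in \<open>auto simp: pY plus_fun_def\<close>)
  have at: "nrm ?Y (u + v) \<le> nrm ?Y u + nrm ?Y v" if u: "u \<in> points ?Y" and v: "v \<in> points ?Y" for u v
  proof (rule least)
    fix t assume t: "t \<in> ?I"
    show "nrm X ((u + v) t) \<le> nrm ?Y u + nrm ?Y v"
      using seminormed_add(2)[OF X p[OF u t] p[OF v t]] le[OF u t] le[OF v t] by (simp add: plus_fun_def)
  qed
  have sp: "c *\<^sub>R u \<in> points ?Y" if u: "u \<in> points ?Y" for u c
    unfolding pY
  proof (intro conjI ballI allI impI)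
    fix t assume t: "t \<in> ?I"
    show "(c *\<^sub>R u) t \<in> points X" using seminormed_scale(1)[OF X p[OF u t]] by (simp add: scaleR_fun_def)
    have "((\<lambda>t'. \<bar>c\<bar> * nrm X (u t' - u t)) \<longlongrightarrow> \<bar>c\<bar> * 0) (at t within ?I)"
      by (intro tendsto_mult tendsto_const) (use u t in \<open>auto simp: pY\<close>)
    then have "((\<lambda>t'. \<bar>c\<bar> * nrm X (u t' - u t)) \<longlongrightarrow> 0) (at t within ?I)" by simp
    then show "((\<lambda>t'. nrm X ((c *\<^sub>R u) t' - (c *\<^sub>R u) t)) \<longlongrightarrow> 0) (at t within ?I)"
    proof (rule Lim_transform_eventually)
      have "\<bar>c\<bar> * nrm X (u t' - u t) = nrm X ((c *\<^sub>R u) t' - (c *\<^sub>R u) t)" if t': "t' \<in> ?I" for t'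
        using seminormed_scale(2)[OF X seminormed_diff(1)[OF X p[OF u t'] p[OF u t]], of c]
        by (simp add: scaleR_fun_def scaleR_diff_right)
      then show "\<forall>\<^sub>F t' in at t within ?I. \<bar>c\<bar> * nrm X (u t' - u t) = nrm X ((c *\<^sub>R u) t' - (c *\<^sub>R u) t)"
        by (auto simp: eventually_at_filter)
    qed
  qed (use u in \<open>auto simp: pY scaleR_fun_def\<close>)
  have sle: "nrm ?Y (c *\<^sub>R u) \<le> \<bar>c\<bar> * nrm ?Y u" if u: "u \<in> points ?Y" for u c
  proof (rule least)
    fix t assume t: "t \<in> ?I"
    show "nrm X ((c *\<^sub>R u) t) \<le> \<bar>c\<bar> * nrm ?Y u"
      using seminormed_scale(2)[OF X p[OF u t], of c] mult_left_mono[OF le[OF u t], of "\<bar>c\<bar>"]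
      by (simp add: scaleR_fun_def)
  qed
  have sn: "nrm ?Y (c *\<^sub>R u) = \<bar>c\<bar> * nrm ?Y u" if u: "u \<in> points ?Y" for u c
  proof (cases "c = 0")
    case True
    then show ?thesis using sle[OF u, of 0] nn[OF z] by simp
  next
    case False
    have "nrm ?Y ((1 / c) *\<^sub>R (c *\<^sub>R u)) \<le> \<bar>1 / c\<bar> * nrm ?Y (c *\<^sub>R u)"
      by (rule sle[OF sp[OF u]])
    then have "\<bar>c\<bar> * nrm ?Y u \<le> nrm ?Y (c *\<^sub>R u)" using False by (simp add: field_simps)
    then show ?thesis using sle[OF u, of c] by simp
  qed
  show "seminormed ?Y" unfolding seminormed_def by (intro conjI ballI allI z nn ap at sp sn)
qed

text \<open>Stated for every map with some finite bound, so that it applies to a difference of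
  bounded maps without first showing that the difference is again in
  \<open>bounded_maps X Y\<close>.\<close>

lemma nrm_bounded_maps:
  assumes X: "\<And>h. h \<in> points X \<Longrightarrow> 0 \<le> nrm X h"
    and bdd: "\<exists>K. \<forall>h\<in>points X. nrm Y (M h) \<le> K * nrm X h"
  shows "0 \<le> nrm (bounded_maps X Y) M"
    and "h \<in> points X \<Longrightarrow> nrm Y (M h) \<le> nrm (bounded_maps X Y) M * nrm X h"
proof -
  let ?S = "{K. 0 \<le> K \<and> (\<forall>h\<in>points X. nrm Y (M h) \<le> K * nrm X h)}"
  have eq: "nrm (bounded_maps X Y) M = Inf ?S" by (simp add: bounded_maps_def)
  obtain K where K: "\<forall>h\<in>points X. nrm Y (M h) \<le> K * nrm X h" using bdd by blast
  have "max 0 K \<in> ?S"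
    using K mult_right_mono[OF max.cobounded2[of K 0] X] by fastforce
  then have ne: "?S \<noteq> {}" by blast
  then show "0 \<le> nrm (bounded_maps X Y) M" unfolding eq by (rule cInf_greatest) simp
  assume h: "h \<in> points X"
  show "nrm Y (M h) \<le> nrm (bounded_maps X Y) M * nrm X h"
  proof (cases "nrm X h = 0")
    case True
    then show ?thesis using K h by force
  next
    case False
    with X[OF h] have pos: "nrm X h > 0" by simp
    have "nrm Y (M h) / nrm X h \<le> Inf ?S"
      by (rule cInf_greatest[OF ne]) (use h pos in \<open>auto simp: pos_divide_le_eq\<close>)
    then show ?thesis unfolding eq using pos by (simp add: pos_divide_le_eq)
  qed
qed

lemma bounded_mapsD:
  assumes "L \<in> points (bounded_maps X Y)"
  shows "h \<in> points X \<Longrightarrow> L h \<in> points Y"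
    "h \<in> points X \<Longrightarrow> L (c *\<^sub>R h) = c *\<^sub>R L h"
    "\<exists>K. \<forall>h\<in>points X. nrm Y (L h) \<le> K * nrm X h"
  using assms by (auto simp: bounded_maps_def)

lemma has_vector_derivative_iff_eps:
  "(F has_vector_derivative D) (at x) \<longleftrightarrow>
     (\<forall>e>0. \<exists>d>0. \<forall>y. \<bar>y - x\<bar> < d \<longrightarrow> norm (F y - F x - (y - x) *\<^sub>R D) \<le> e * \<bar>y - x\<bar>)"
  unfolding has_vector_derivative_def has_derivative_at_alt by (simp add: bounded_linear_scaleR_left)

text \<open>Convergence at real points gives convergence in a complex disc, where the series may be
  differentiated termwise. By uniqueness of derivatives on the real line \<open>G\<close> is the
  termwise derivative, and \<open>D\<close> is the termwise second derivative at 0.\<close>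

lemma power_series_second_derivative:
  fixes c :: "nat \<Rightarrow> complex" and F G :: "real \<Rightarrow> complex"
  assumes rho: "\<rho> > 0"
    and F: "\<And>e. \<bar>e\<bar> < \<rho> \<Longrightarrow> (\<lambda>n. c n * of_real e ^ n) sums F e"
    and G: "\<And>e. \<bar>e\<bar> < \<rho> \<Longrightarrow> (F has_vector_derivative G e) (at e)"
    and D: "(G has_vector_derivative D) (at 0)"
  shows "D = 2 * c 2"
proof -
  have sm: "summable (\<lambda>n. c n * z ^ n)" if z: "norm z < \<rho>" for z
  proof -
    obtain r where r: "norm z < r" "r < \<rho>" using dense[OF z] by blast
    then have "\<bar>r\<bar> < \<rho>" using norm_ge_zero[of z] by linarith
    from sums_summable[OF F[OF this]] show ?thesis
      by (rule powser_inside) (use r in auto)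
  qed
  have dP: "((\<lambda>z. \<Sum>n. c n * z ^ n) has_field_derivative (\<Sum>n. diffs c n * z ^ n)) (at z)" if z: "norm z < \<rho>" for z
  proof -
    obtain r where r: "norm z < r" "r < \<rho>" using dense[OF z] by blast
    moreover from r have "0 < r" using norm_ge_zero[of z] by linarith
    ultimately have "norm (complex_of_real r) < \<rho>" "norm z < norm (complex_of_real r)"
      by simp_all
    then show ?thesis using termdiffs_strong[OF sm] by blast
  qed
  have sm': "summable (\<lambda>n. diffs c n * z ^ n)" if "norm z < \<rho>" for z
    using termdiff_converges[of z \<rho> c] sm that by blast
  have dQ: "((\<lambda>z. \<Sum>n. diffs c n * z ^ n) has_field_derivative (\<Sum>n. diffs (diffs c) n * 0 ^ n)) (at 0)"
    using termdiffs_strong[OF sm', of "of_real (\<rho>/2)" 0] rho by simp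
  have "(\<Sum>n. diffs (diffs c) n * 0 ^ n) = 2 * c 2"
    unfolding powser_zero by (simp add: diffs_def numeral_2_eq_2)
  with dQ have dQ': "((\<lambda>e. \<Sum>n. diffs c n * of_real e ^ n) has_vector_derivative 2 * c 2) (at 0)"
    using has_vector_derivative_real_field[of "\<lambda>z. \<Sum>n. diffs c n * z ^ n" "2 * c 2" 0 UNIV] by simp
  have GQ: "G e = (\<Sum>n. diffs c n * of_real e ^ n)" if e: "\<bar>e\<bar> < \<rho>" for e
  proof -
    have "((\<lambda>e. \<Sum>n. c n * of_real e ^ n) has_vector_derivative (\<Sum>n. diffs c n * of_real e ^ n)) (at e)"
      by (rule has_vector_derivative_real_field[OF dP]) (use e in simp)
    then have "(F has_vector_derivative (\<Sum>n. diffs c n * of_real e ^ n)) (at e)"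
    proof (rule has_vector_derivative_transform_within_open[of _ _ _ "{-\<rho><..<\<rho>}"])
      fix y assume "y \<in> {-\<rho><..<\<rho>}"
      then have "\<bar>y\<bar> < \<rho>" by auto
      from sums_unique[OF F[OF this]] show "(\<Sum>n. c n * of_real y ^ n) = F y" by simp
    qed (use e in auto)
    with G[OF e] show ?thesis by (rule vector_derivative_unique_at)
  qed
  have "(G has_vector_derivative 2 * c 2) (at 0)"
    by (rule has_vector_derivative_transform_within_open[OF dQ', of "{-\<rho><..<\<rho>}"]) (use rho GQ in auto)
  with D show ?thesis by (rule vector_derivative_unique_at)
qed

text \<open>The second derivative is identified by pairing with bounded functionals \<open>l\<close>, along each of
  which \<open>f\<close> restricted to a line is assumed to be a power series.\<close>

lemma C2_quadratic_bound:
  fixes X :: "'a::real_vector nspace" and Y :: "'b::real_vector nspace"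
  assumes X: "seminormed X" and Y: "seminormed Y" and C2: "C2_differentiable_at X Y f 0"
  obtains K where "K \<ge> 0" "\<And>\<phi>. \<phi> \<in> points X \<Longrightarrow> \<exists>b\<in>points Y. nrm Y b \<le> K * (nrm X \<phi>)\<^sup>2 \<and>
     (\<forall>(l :: 'b \<Rightarrow> complex) C c \<rho>. (\<forall>u v. l (u + v) = l u + l v) \<longrightarrow> (\<forall>a u. l (a *\<^sub>R u) = a *\<^sub>R l u) \<longrightarrow>
        (\<forall>v\<in>points Y. norm (l v) \<le> C * nrm Y v) \<longrightarrow> \<rho> > 0 \<longrightarrow>
        (\<forall>e. \<bar>e\<bar> < \<rho> \<longrightarrow> (\<lambda>n. c n * of_real e ^ n) sums l (f (e *\<^sub>R \<phi>))) \<longrightarrow> l b = 2 * c 2)"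
proof -
  let ?B = "bounded_maps X Y"
  note Xnn = seminormed_nonneg[OF X]
  obtain r f' f'' where r: "r > 0"
    and f': "\<And>y. y \<in> points X \<Longrightarrow> nrm X y < r \<Longrightarrow> has_frechet_derivative X Y f (f' y) y"
    and f'': "\<And>y. y \<in> points X \<Longrightarrow> nrm X y < r \<Longrightarrow> has_frechet_derivative X ?B f' (f'' y) y"
    using C2 unfolding C2_differentiable_at_def by auto
  have 0: "0 \<in> points X" "nrm X 0 = 0" by (rule seminormed_zero[OF X])+
  have f0: "has_frechet_derivative X ?B f' (f'' 0) 0" using f''[OF 0(1)] 0(2) r by simp
  then have A: "f'' 0 \<in> points (bounded_maps X ?B)" by (simp add: has_frechet_derivative_def)
  note A1 = bounded_mapsD(1)[OF A]
  define K where "K = nrm (bounded_maps X ?B) (f'' 0)"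
  show ?thesis
  proof (rule that[of K])
    show "0 \<le> K" unfolding K_def by (rule nrm_bounded_maps(1)[OF Xnn bounded_mapsD(3)[OF A]])
    fix \<phi> assume phi: "\<phi> \<in> points X"
    note nphi = Xnn[OF phi]
    have e\<phi>: "e *\<^sub>R \<phi> \<in> points X" "nrm X (e *\<^sub>R \<phi>) = \<bar>e\<bar> * nrm X \<phi>" for e
      using seminormed_scale[OF X phi] by auto
    let ?b = "f'' 0 \<phi> \<phi>"
    show "\<exists>b\<in>points Y. nrm Y b \<le> K * (nrm X \<phi>)\<^sup>2 \<and>
     (\<forall>(l :: 'b \<Rightarrow> complex) C c \<rho>. (\<forall>u v. l (u + v) = l u + l v) \<longrightarrow> (\<forall>a u. l (a *\<^sub>R u) = a *\<^sub>R l u) \<longrightarrow>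
        (\<forall>v\<in>points Y. norm (l v) \<le> C * nrm Y v) \<longrightarrow> \<rho> > 0 \<longrightarrow>
        (\<forall>e. \<bar>e\<bar> < \<rho> \<longrightarrow> (\<lambda>n. c n * of_real e ^ n) sums l (f (e *\<^sub>R \<phi>))) \<longrightarrow> l b = 2 * c 2)"
    proof (intro bexI[of _ ?b] conjI allI impI)
      show b: "?b \<in> points Y" by (rule bounded_mapsD(1)[OF A1[OF phi] phi])
      have "nrm Y ?b \<le> nrm ?B (f'' 0 \<phi>) * nrm X \<phi>"
        by (rule nrm_bounded_maps(2)[OF Xnn bounded_mapsD(3)[OF A1[OF phi]] phi])
      also have "\<dots> \<le> (K * nrm X \<phi>) * nrm X \<phi>"
        unfolding K_def by (intro mult_right_mono nphi nrm_bounded_maps(2)[OF Xnn bounded_mapsD(3)[OF A] phi])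
      finally show "nrm Y ?b \<le> K * (nrm X \<phi>)\<^sup>2" by (simp add: power2_eq_square mult.assoc)
      fix l :: "'b \<Rightarrow> complex" and C c and \<rho> :: real
      assume ladd: "\<forall>u v. l (u + v) = l u + l v" and lscale: "\<forall>a u. l (a *\<^sub>R u) = a *\<^sub>R l u"
        and lC: "\<forall>v\<in>points Y. norm (l v) \<le> C * nrm Y v" and rho: "\<rho> > 0"
        and ser: "\<forall>e. \<bar>e\<bar> < \<rho> \<longrightarrow> (\<lambda>n. c n * of_real e ^ n) sums l (f (e *\<^sub>R \<phi>))"
      have ldiff: "l (u - v) = l u - l v" for u v
      proof -
        have "l u = l (u - v) + l v" using ladd[rule_format, of "u - v" v] by simp
        then show ?thesis by simp
      qed
      define C' where "C' = max C 0 + 1"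
      have C': "C' > 0" and lC': "\<And>v. v \<in> points Y \<Longrightarrow> norm (l v) \<le> C' * nrm Y v"
      proof -
        show "C' > 0" by (simp add: C'_def)
        fix v assume v: "v \<in> points Y"
        have "C * nrm Y v \<le> C' * nrm Y v"
          by (rule mult_right_mono) (auto simp: C'_def seminormed_nonneg[OF Y v])
        with lC v show "norm (l v) \<le> C' * nrm Y v" by force
      qed
      \<comment> \<open>Adding 1 permits division also when \<open>\<phi>\<close> has norm
        zero.\<close>
      define P where "P = nrm X \<phi> + 1"
      have P: "P > 0" "nrm X \<phi> \<le> P" using nphi by (simp_all add: P_def)
      have small: "\<bar>e\<bar> * nrm X \<phi> < d" if "\<bar>e\<bar> < d / P" for e d
      proof -
        have "\<bar>e\<bar> * nrm X \<phi> \<le> \<bar>e\<bar> * P" by (rule mult_left_mono[OF P(2)]) simp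
        also have "\<dots> < d" using that P(1) by (simp add: pos_less_divide_eq)
        finally show ?thesis .
      qed
      have der1: "((\<lambda>e. l (f (e *\<^sub>R \<phi>))) has_vector_derivative l (f' (e *\<^sub>R \<phi>) \<phi>)) (at e)"
        if e: "\<bar>e\<bar> < r / P" for e
        unfolding has_vector_derivative_iff_eps
      proof (intro allI impI)
        fix \<eta> :: real assume eta: "\<eta> > 0"
        have fd: "has_frechet_derivative X Y f (f' (e *\<^sub>R \<phi>)) (e *\<^sub>R \<phi>)"
          by (rule f'[OF e\<phi>(1)]) (use small[OF e] e\<phi>(2) in simp)
        then have L: "f' (e *\<^sub>R \<phi>) \<in> points ?B" by (simp add: has_frechet_derivative_def)
        have "\<eta> / (C' * P) > 0" using eta C' P(1) by simp
        then obtain d where d: "d > 0" and fr: "\<And>h. h \<in> points X \<Longrightarrow> nrm X h < d \<Longrightarrow>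
           f (e *\<^sub>R \<phi> + h) \<in> points Y \<and> nrm Y (f (e *\<^sub>R \<phi> + h) - f (e *\<^sub>R \<phi>) - f' (e *\<^sub>R \<phi>) h) \<le> \<eta> / (C' * P) * nrm X h"
          using fd unfolding has_frechet_derivative_def by blast
        have fe: "f (e *\<^sub>R \<phi>) \<in> points Y" using fr[OF 0(1)] 0(2) d by simp
        show "\<exists>d>0. \<forall>y. \<bar>y - e\<bar> < d \<longrightarrow> norm (l (f (y *\<^sub>R \<phi>)) - l (f (e *\<^sub>R \<phi>)) - (y - e) *\<^sub>R l (f' (e *\<^sub>R \<phi>) \<phi>)) \<le> \<eta> * \<bar>y - e\<bar>"
        proof (intro exI[of _ "d / P"] conjI allI impI)
          show "d / P > 0" using d P(1) by simp
          fix y assume y: "\<bar>y - e\<bar> < d / P"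
          let ?h = "(y - e) *\<^sub>R \<phi>"
          have h: "nrm X ?h < d" using small[OF y] e\<phi>(2) by simp
          have eq: "e *\<^sub>R \<phi> + ?h = y *\<^sub>R \<phi>" by (simp add: algebra_simps)
          let ?v = "f (y *\<^sub>R \<phi>) - f (e *\<^sub>R \<phi>) - f' (e *\<^sub>R \<phi>) ?h"
          have v: "?v \<in> points Y"
            using fr[OF e\<phi>(1) h] bounded_mapsD(1)[OF L e\<phi>(1)] fe
            by (auto simp: eq intro!: seminormed_diff(1)[OF Y])
          have "l ?v = l (f (y *\<^sub>R \<phi>)) - l (f (e *\<^sub>R \<phi>)) - (y - e) *\<^sub>R l (f' (e *\<^sub>R \<phi>) \<phi>)"
            using bounded_mapsD(2)[OF L phi, of "y - e"] lscale by (simp add: ldiff)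
          moreover have "norm (l ?v) \<le> C' * (\<eta> / (C' * P) * nrm X ?h)"
            using lC'[OF v] mult_left_mono[of "nrm Y ?v" "\<eta> / (C' * P) * nrm X ?h" C'] fr[OF e\<phi>(1) h] C' eq by fastforce
          moreover have "C' * (\<eta> / (C' * P) * nrm X ?h) = (nrm X \<phi> / P) * (\<eta> * \<bar>y - e\<bar>)"
            using C' e\<phi>(2) by simp
          moreover have "(nrm X \<phi> / P) * (\<eta> * \<bar>y - e\<bar>) \<le> 1 * (\<eta> * \<bar>y - e\<bar>)"
            using P eta by (intro mult_right_mono) auto
          ultimately show "norm (l (f (y *\<^sub>R \<phi>)) - l (f (e *\<^sub>R \<phi>)) - (y - e) *\<^sub>R l (f' (e *\<^sub>R \<phi>) \<phi>)) \<le> \<eta> * \<bar>y - e\<bar>"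
            by simp
        qed
      qed
      \<comment> \<open>Evaluation at \<open>\<phi>\<close> followed by \<open>l\<close> is a
        bounded functional of operators, so the expansion of \<open>f'\<close> at 0 in operator norm
        passes through it. The two factors \<open>P\<close> pay for the norms of
        \<open>y *\<^sub>R \<phi>\<close> and of \<open>\<phi>\<close>.\<close>
      have der2: "((\<lambda>e. l (f' (e *\<^sub>R \<phi>) \<phi>)) has_vector_derivative l ?b) (at 0)"
        unfolding has_vector_derivative_iff_eps
      proof (intro allI impI)
        fix \<eta> :: real assume eta: "\<eta> > 0"
        have "\<eta> / (C' * P * P) > 0" using eta C' P(1) by simp
        then obtain d where d: "d > 0" and fr: "\<And>h. h \<in> points X \<Longrightarrow> nrm X h < d \<Longrightarrow>
           f' (0 + h) \<in> points ?B \<and> nrm ?B (f' (0 + h) - f' 0 - f'' 0 h) \<le> \<eta> / (C' * P * P) * nrm X h"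
          using f0 unfolding has_frechet_derivative_def by blast
        have f'0: "f' 0 \<in> points ?B" using fr[OF 0(1)] 0(2) d by simp
        show "\<exists>d>0. \<forall>y. \<bar>y - 0\<bar> < d \<longrightarrow> norm (l (f' (y *\<^sub>R \<phi>) \<phi>) - l (f' (0 *\<^sub>R \<phi>) \<phi>) - (y - 0) *\<^sub>R l ?b) \<le> \<eta> * \<bar>y - 0\<bar>"
        proof (intro exI[of _ "d / P"] conjI allI impI)
          show "d / P > 0" using d P(1) by simp
          fix y assume y: "\<bar>y - 0\<bar> < d / P"
          let ?h = "y *\<^sub>R \<phi>"
          have h: "nrm X ?h < d" using small[of y] y e\<phi>(2) by simp
          let ?M = "f' ?h - f' 0 - f'' 0 ?h"
          have mp: "f' ?h \<in> points ?B" using fr[OF e\<phi>(1) h] by simp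
          have M: "?M \<psi> = f' ?h \<psi> - f' 0 \<psi> - f'' 0 ?h \<psi>" for \<psi> by (simp add: fun_diff_def)
          have pts: "f' ?h \<psi> \<in> points Y" "f' 0 \<psi> \<in> points Y" "f'' 0 ?h \<psi> \<in> points Y" if "\<psi> \<in> points X" for \<psi>
            using bounded_mapsD(1)[OF mp that] bounded_mapsD(1)[OF f'0 that] bounded_mapsD(1)[OF A1[OF e\<phi>(1)] that] by auto
          have ex: "\<exists>K. \<forall>\<psi>\<in>points X. nrm Y (?M \<psi>) \<le> K * nrm X \<psi>"
          proof -
            obtain K1 where K1: "\<forall>\<psi>\<in>points X. nrm Y (f' ?h \<psi>) \<le> K1 * nrm X \<psi>" using bounded_mapsD(3)[OF mp] by blast
            obtain K2 where K2: "\<forall>\<psi>\<in>points X. nrm Y (f' 0 \<psi>) \<le> K2 * nrm X \<psi>" using bounded_mapsD(3)[OF f'0] by blast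
            obtain K3 where K3: "\<forall>\<psi>\<in>points X. nrm Y (f'' 0 ?h \<psi>) \<le> K3 * nrm X \<psi>" using bounded_mapsD(3)[OF A1[OF e\<phi>(1)]] by blast
            have "nrm Y (?M \<psi>) \<le> (K1 + K2 + K3) * nrm X \<psi>" if "\<psi> \<in> points X" for \<psi>
            proof -
              have "nrm Y (?M \<psi>) \<le> nrm Y (f' ?h \<psi>) + nrm Y (f' 0 \<psi>) + nrm Y (f'' 0 ?h \<psi>)"
                unfolding M using seminormed_diff[OF Y] pts[OF that] by (meson add_mono order_refl order_trans)
              with K1 K2 K3 that show ?thesis unfolding distrib_right by force
            qed
            then show ?thesis by blast
          qed
          have v: "?M \<phi> \<in> points Y"
            unfolding M using pts[OF phi] by (intro seminormed_diff(1)[OF Y])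
          have "nrm Y (?M \<phi>) \<le> nrm ?B ?M * nrm X \<phi>"
            by (rule nrm_bounded_maps(2)[OF Xnn ex phi])
          also have "\<dots> \<le> (\<eta> / (C' * P * P) * nrm X ?h) * nrm X \<phi>"
            using fr[OF e\<phi>(1) h] nphi by (intro mult_right_mono) auto
          finally have 1: "nrm Y (?M \<phi>) \<le> (\<eta> / (C' * P * P) * nrm X ?h) * nrm X \<phi>" .
          have "f'' 0 ?h \<phi> = y *\<^sub>R ?b"
            using bounded_mapsD(2)[OF A phi, of y] by (simp add: scaleR_fun_def)
          then have "l (?M \<phi>) = l (f' (y *\<^sub>R \<phi>) \<phi>) - l (f' (0 *\<^sub>R \<phi>) \<phi>) - (y - 0) *\<^sub>R l ?b"
            unfolding M using lscale by (simp add: ldiff)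
          moreover have "norm (l (?M \<phi>)) \<le> C' * ((\<eta> / (C' * P * P) * nrm X ?h) * nrm X \<phi>)"
            using lC'[OF v] mult_left_mono[OF 1, of C'] C' by linarith
          moreover have "C' * ((\<eta> / (C' * P * P) * nrm X ?h) * nrm X \<phi>) = ((nrm X \<phi> / P) * (nrm X \<phi> / P)) * (\<eta> * \<bar>y\<bar>)"
            using C' e\<phi>(2) by simp
          moreover have "((nrm X \<phi> / P) * (nrm X \<phi> / P)) * (\<eta> * \<bar>y\<bar>) \<le> (1 * 1) * (\<eta> * \<bar>y\<bar>)"
            using P eta nphi by (intro mult_right_mono mult_mono) auto
          ultimately show "norm (l (f' (y *\<^sub>R \<phi>) \<phi>) - l (f' (0 *\<^sub>R \<phi>) \<phi>) - (y - 0) *\<^sub>R l ?b) \<le> \<eta> * \<bar>y - 0\<bar>"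
            by simp
        qed
      qed
      show "l ?b = 2 * c 2"
      proof (rule power_series_second_derivative)
        show "min \<rho> (r / P) > 0" using rho r P(1) by simp
        show "(\<lambda>n. c n * of_real e ^ n) sums l (f (e *\<^sub>R \<phi>))" if "\<bar>e\<bar> < min \<rho> (r / P)" for e
          using ser that by simp
        show "((\<lambda>e. l (f (e *\<^sub>R \<phi>))) has_vector_derivative l (f' (e *\<^sub>R \<phi>) \<phi>)) (at e)" if "\<bar>e\<bar> < min \<rho> (r / P)" for e
          by (rule der1) (use that in simp)
      qed (rule der2)
    qed
  qed
qed

section \<open>Anisotropic Sobolev spaces\<close>

lemma
  fixes f g :: "'a \<Rightarrow> real"
  assumes [measurable]: "f \<in> borel_measurable M" "g \<in> borel_measurable M"
    and f: "integrable M (\<lambda>x. (f x)\<^sup>2)" and g: "integrable M (\<lambda>x. (g x)\<^sup>2)"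
  shows integrable_mult_L2: "integrable M (\<lambda>x. f x * g x)"
    and integral_mult_L2_le: "(LINT x|M. \<bar>f x * g x\<bar>) \<le> sqrt (LINT x|M. (f x)\<^sup>2) * sqrt (LINT x|M. (g x)\<^sup>2)"
proof -
  show int: "integrable M (\<lambda>x. f x * g x)"
  proof (rule Bochner_Integration.integrable_bound)
    show "integrable M (\<lambda>x. (f x)\<^sup>2 + (g x)\<^sup>2)" using f g by simp
    show "AE x in M. norm (f x * g x) \<le> norm ((f x)\<^sup>2 + (g x)\<^sup>2)"
    proof (rule AE_I2)
      fix x
      have "2 * \<bar>f x\<bar> * \<bar>g x\<bar> \<le> \<bar>f x\<bar>\<^sup>2 + \<bar>g x\<bar>\<^sup>2" by (rule sum_squares_bound)
      then show "norm (f x * g x) \<le> norm ((f x)\<^sup>2 + (g x)\<^sup>2)"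
        using mult_nonneg_nonneg[OF abs_ge_zero abs_ge_zero, of "f x" "g x"]
        unfolding real_norm_def abs_mult mult.assoc power2_abs by linarith
    qed
  qed measurable
  let ?I = "LINT x|M. \<bar>f x * g x\<bar>" and ?A = "LINT x|M. (f x)\<^sup>2" and ?B = "LINT x|M. (g x)\<^sup>2"
  have A: "0 \<le> ?A" and B: "0 \<le> ?B" by simp_all
  have e1: "(\<integral>\<^sup>+x. ennreal \<bar>f x\<bar> * ennreal \<bar>g x\<bar> \<partial>M) = ennreal ?I"
    by (subst nn_integral_eq_integral[symmetric])
       (use integrable_abs[OF int] in \<open>auto simp: abs_mult ennreal_mult\<close>)
  have e2: "(\<integral>\<^sup>+x. (ennreal \<bar>f x\<bar>)\<^sup>2 \<partial>M) = ennreal ?A"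
    by (subst nn_integral_eq_integral[symmetric]) (use f in \<open>auto simp: ennreal_power\<close>)
  have e3: "(\<integral>\<^sup>+x. (ennreal \<bar>g x\<bar>)\<^sup>2 \<partial>M) = ennreal ?B"
    by (subst nn_integral_eq_integral[symmetric]) (use g in \<open>auto simp: ennreal_power\<close>)
  have "(ennreal ?I)\<^sup>2 \<le> ennreal ?A * ennreal ?B"
    unfolding e1[symmetric] e2[symmetric] e3[symmetric]
    by (rule Cauchy_Schwarz_nn_integral) measurable
  then have "ennreal (?I\<^sup>2) \<le> ennreal (?A * ?B)"
    by (simp add: ennreal_power ennreal_mult[symmetric])
  then have "?I\<^sup>2 \<le> ?A * ?B" using A B by (subst (asm) ennreal_le_iff) auto
  then show "?I \<le> sqrt ?A * sqrt ?B"
    using real_le_rsqrt[of ?I "?A * ?B"] by (simp add: real_sqrt_mult)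
qed

lemma fst_borel_measurable [measurable]:
    "(fst :: 'a::second_countable_topology \<times> 'b::second_countable_topology \<Rightarrow> 'a) \<in> borel_measurable borel"
  and snd_borel_measurable [measurable]:
    "(snd :: 'a::second_countable_topology \<times> 'b::second_countable_topology \<Rightarrow> 'b) \<in> borel_measurable borel"
  by (intro borel_measurable_continuous_onI continuous_intros)+

lemma bracket_ge_1: "1 \<le> bracket v"
  by (simp add: bracket_def)

lemma bracket_pos: "0 < bracket v"
  using bracket_ge_1[of v] by linarith

lemma sobolev_weight_pos: "0 < sobolev_weight s1 s2 \<zeta>"
  unfolding sobolev_weight_def by (simp add: case_prod_unfold bracket_pos less_imp_neq[OF bracket_pos, symmetric])

lemma sobolev_weight_measurable [measurable]: "sobolev_weight s1 s2 \<in> borel_measurable borel"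
  unfolding sobolev_weight_def bracket_def[abs_def] case_prod_unfold by measurable

text \<open>The first bound puts rapidly decreasing functions into every Sobolev space, the second
  controls pairings with Schwartz functions. They are one statement, as inverting the weight negates
  its exponents.\<close>

lemma sobolev_weight_bounds:
  "\<exists>m::nat. \<forall>\<zeta>. sobolev_weight s1 s2 \<zeta> \<le> (1 + (norm \<zeta>)\<^sup>2) ^ m \<and>
    inverse (sobolev_weight s1 s2 \<zeta>) \<le> (1 + (norm \<zeta>)\<^sup>2) ^ m"
proof -
  define m where "m = nat \<lceil>\<bar>s1\<bar> + \<bar>s2\<bar>\<rceil>"
  have m: "\<bar>s1\<bar> + \<bar>s2\<bar> \<le> real m" unfolding m_def by linarith
  have le: "sobolev_weight s1 s2 \<zeta> \<le> (1 + (norm \<zeta>)\<^sup>2) ^ m" if m: "\<bar>s1\<bar> + \<bar>s2\<bar> \<le> real m" for s1 s2 \<zeta>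
  proof -
    let ?P = "1 + (norm \<zeta>)\<^sup>2"
    have P: "1 \<le> ?P" by simp
    have b: "bracket v powr s \<le> ?P powr \<bar>s\<bar>" if v: "norm v \<le> norm \<zeta>" for s and v :: "'c::real_normed_vector"
    proof -
      have "(bracket v) \<le> sqrt (?P)" unfolding bracket_def using v by (simp add: power_mono)
      also have "\<dots> \<le> sqrt (?P\<^sup>2)" using power_increasing[of 1 2 ?P] P by (intro real_sqrt_le_mono) simp
      also have "\<dots> = ?P" by simp
      finally have "bracket v powr \<bar>s\<bar> \<le> ?P powr \<bar>s\<bar>"
        by (intro powr_mono2) (auto intro: less_imp_le bracket_pos)
      moreover have "bracket v powr s \<le> bracket v powr \<bar>s\<bar>"
        by (rule powr_mono) (auto simp: bracket_ge_1)
      ultimately show ?thesis by linarith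
    qed
    obtain \<xi> \<eta> where z: "\<zeta> = (\<xi>, \<eta>)" by (cases \<zeta>)
    have n1: "norm \<xi> \<le> norm \<zeta>" and n2: "norm \<eta> \<le> norm \<zeta>"
      using norm_fst_le[of \<xi> \<eta>] norm_snd_le[of \<eta> \<xi>] z by auto
    have "sobolev_weight s1 s2 \<zeta> = bracket \<xi> powr s1 * bracket \<eta> powr s2"
      by (simp add: sobolev_weight_def z)
    also have "\<dots> \<le> ?P powr \<bar>s1\<bar> * ?P powr \<bar>s2\<bar>"
      by (intro mult_mono b n1 n2) auto
    also have "\<dots> = ?P powr (\<bar>s1\<bar> + \<bar>s2\<bar>)" by (simp add: powr_add)
    also have "\<dots> \<le> ?P powr (real m)" by (rule powr_mono[OF m P])
    also have "\<dots> = ?P ^ m" by (rule powr_realpow) (use P in linarith)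
    finally show ?thesis .
  qed
  have "inverse (sobolev_weight s1 s2 \<zeta>) = sobolev_weight (-s1) (-s2) \<zeta>" for \<zeta>
    by (simp add: sobolev_weight_def case_prod_unfold powr_minus)
  then show ?thesis
    using le[OF m] le[of "-s1" "-s2"] m by (intro exI[of _ m]) simp
qed

text \<open>\<open>weighted_L2 s1 s2 g\<close> says that \<open>g\<close> is the Fourier transform of an element of \<open>H\<^bsup>s1,s2\<^esup>\<close>.\<close>

definition weighted_L2 :: "real \<Rightarrow> real \<Rightarrow> (pt \<Rightarrow> complex) \<Rightarrow> bool" where
  "weighted_L2 s1 s2 g \<longleftrightarrow> g \<in> borel_measurable borel \<and>
     integrable lborel (\<lambda>\<zeta>. (sobolev_weight s1 s2 \<zeta> * norm (g \<zeta>))\<^sup>2)"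

definition weighted_L2_norm :: "real \<Rightarrow> real \<Rightarrow> (pt \<Rightarrow> complex) \<Rightarrow> real" where
  "weighted_L2_norm s1 s2 g = sqrt (LINT \<zeta>|lborel. (sobolev_weight s1 s2 \<zeta> * norm (g \<zeta>))\<^sup>2)"

lemma weighted_L2_norm_nonneg: "0 \<le> weighted_L2_norm s1 s2 g"
  by (simp add: weighted_L2_norm_def)

text \<open>Cauchy-Schwarz after moving the inverse weight onto \<theta>. The constant serves all
  \<open>g\<close> at once, which makes the pairing a bounded functional on the Sobolev
  space.\<close>

lemma weighted_L2_pairing:
  assumes [measurable]: "\<theta> \<in> borel_measurable borel"
    and dec: "\<And>m. \<exists>C\<ge>0. \<forall>\<zeta>. norm (\<theta> \<zeta>) * (1 + (norm \<zeta>)\<^sup>2) ^ m \<le> C"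
  obtains C where "\<And>g. weighted_L2 s1 s2 g \<Longrightarrow> integrable lborel (\<lambda>\<zeta>. g \<zeta> * \<theta> \<zeta>)"
    "\<And>g. weighted_L2 s1 s2 g \<Longrightarrow> norm (LINT \<zeta>|lborel. g \<zeta> * \<theta> \<zeta>) \<le> C * weighted_L2_norm s1 s2 g"
proof -
  let ?w = "sobolev_weight s1 s2"
  obtain m where m: "\<And>\<zeta>. inverse (?w \<zeta>) \<le> (1 + (norm \<zeta>)\<^sup>2) ^ m"
    using sobolev_weight_bounds[of s1 s2] by (elim exE) (rule that, blast)
  obtain C where C: "C \<ge> 0" "\<And>\<zeta>. norm (\<theta> \<zeta>) * (1 + (norm \<zeta>)\<^sup>2) ^ (m + 3) \<le> C"
    using dec[of "m + 3"] by (elim exE conjE) (rule that, auto)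
  define k where "k \<zeta> = inverse (?w \<zeta>) * norm (\<theta> \<zeta>)" for \<zeta>
  have [measurable]: "k \<in> borel_measurable borel" unfolding k_def by measurable
  have k0: "0 \<le> k \<zeta>" for \<zeta> using sobolev_weight_pos[of s1 s2 \<zeta>] by (simp add: k_def)
  have kb: "k \<zeta> \<le> C * decay \<zeta>" for \<zeta>
    unfolding k_def using sobolev_weight_pos[of s1 s2 \<zeta>] by (intro mult_le_decay[OF _ m C(2)]) simp
  have k2: "integrable lborel (\<lambda>\<zeta>. (k \<zeta>)\<^sup>2)"
  proof (rule integrable_of_le_decay[where C = "C * C"])
    fix \<zeta>
    have "(k \<zeta>)\<^sup>2 \<le> (C * decay \<zeta>) * (C * 1)"
      unfolding power2_eq_square
      by (intro mult_mono kb order_trans[OF kb] mult_left_mono decay_le_1 C k0 mult_nonneg_nonneg decay_nonneg) auto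
    then show "norm ((k \<zeta>)\<^sup>2) \<le> C * C * decay \<zeta>" by (simp add: mult_ac)
  qed measurable
  show ?thesis
  proof (rule that[of "sqrt (LINT \<zeta>|lborel. (k \<zeta>)\<^sup>2)"])
    fix g assume g: "weighted_L2 s1 s2 g"
    then have [measurable]: "g \<in> borel_measurable borel" by (simp add: weighted_L2_def)
    have g2: "integrable lborel (\<lambda>\<zeta>. (?w \<zeta> * norm (g \<zeta>))\<^sup>2)" using g by (simp add: weighted_L2_def)
    have eq: "norm (g \<zeta> * \<theta> \<zeta>) = \<bar>(?w \<zeta> * norm (g \<zeta>)) * k \<zeta>\<bar>" for \<zeta>
      using sobolev_weight_pos[of s1 s2 \<zeta>] by (simp add: k_def norm_mult abs_mult)
    have "integrable lborel (\<lambda>\<zeta>. (?w \<zeta> * norm (g \<zeta>)) * k \<zeta>)"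
      by (rule integrable_mult_L2[OF _ _ g2 k2]) measurable
    then show "integrable lborel (\<lambda>\<zeta>. g \<zeta> * \<theta> \<zeta>)"
      by (rule Bochner_Integration.integrable_bound) (auto simp: eq)
    have "norm (LINT \<zeta>|lborel. g \<zeta> * \<theta> \<zeta>) \<le> (LINT \<zeta>|lborel. norm (g \<zeta> * \<theta> \<zeta>))"
      by (rule integral_norm_bound)
    also have "\<dots> \<le> weighted_L2_norm s1 s2 g * sqrt (LINT \<zeta>|lborel. (k \<zeta>)\<^sup>2)"
      unfolding eq weighted_L2_norm_def by (rule integral_mult_L2_le[OF _ _ g2 k2]) measurable
    finally show "norm (LINT \<zeta>|lborel. g \<zeta> * \<theta> \<zeta>) \<le> sqrt (LINT \<zeta>|lborel. (k \<zeta>)\<^sup>2) * weighted_L2_norm s1 s2 g"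
      by (simp add: mult.commute)
  qed
qed

lemma weighted_L2_tempered: "weighted_L2 s1 s2 g \<Longrightarrow> tempered_fun g"
  unfolding tempered_fun_def
proof (intro conjI ballI)
  assume g: "weighted_L2 s1 s2 g"
  then show "g \<in> borel_measurable borel" by (simp add: weighted_L2_def)
  fix \<psi> :: "pt \<Rightarrow> complex" assume psi: "\<psi> \<in> schwartz"
  obtain C where "\<And>g. weighted_L2 s1 s2 g \<Longrightarrow> integrable lborel (\<lambda>z. g z * \<psi> z)"
    using weighted_L2_pairing[OF schwartz_measurable[OF psi] schwartz_bound[OF psi], of s1 s2] by blast
  from this[OF g] show "integrable lborel (\<lambda>z. g z * \<psi> z)" .
qed

lemma inv_fourier_dist_bounded:
  assumes "\<psi> \<in> schwartz"
  obtains C where "\<And>g. weighted_L2 s1 s2 g \<Longrightarrow> integrable lborel (\<lambda>\<zeta>. g \<zeta> * inv_fourier \<psi> \<zeta>)"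
    "\<And>g. weighted_L2 s1 s2 g \<Longrightarrow> norm (inv_fourier_dist g \<psi>) \<le> C * weighted_L2_norm s1 s2 g"
proof -
  obtain C where "\<And>g. weighted_L2 s1 s2 g \<Longrightarrow> integrable lborel (\<lambda>\<zeta>. g \<zeta> * inv_fourier \<psi> \<zeta>)"
    "\<And>g. weighted_L2 s1 s2 g \<Longrightarrow> norm (LINT \<zeta>|lborel. g \<zeta> * inv_fourier \<psi> \<zeta>) \<le> C * weighted_L2_norm s1 s2 g"
    using weighted_L2_pairing[OF inv_fourier_measurable[OF schwartz_measurable[OF assms]] inv_fourier_decay[OF assms], of s1 s2]
    by blast
  then show ?thesis using that[of C] assms by (simp add: inv_fourier_dist_def)
qed

lemma points_sobolev: "points (sobolev s1 s2) = inv_fourier_dist ` {g. weighted_L2 s1 s2 g}"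
  by (auto simp: sobolev_def weighted_L2_def)

lemma nrm_sobolev:
  assumes g: "weighted_L2 s1 s2 g"
  shows "nrm (sobolev s1 s2) (inv_fourier_dist g) = weighted_L2_norm s1 s2 g"
proof -
  note f = fourier_fun_inv_fourier_dist[OF weighted_L2_tempered[OF g]]
  have [measurable]: "g \<in> borel_measurable borel" "fourier_fun (inv_fourier_dist g) \<in> borel_measurable borel"
    using g f(1) by (simp_all add: weighted_L2_def tempered_fun_def)
  have "(LINT \<zeta>|lborel. (sobolev_weight s1 s2 \<zeta> * norm (fourier_fun (inv_fourier_dist g) \<zeta>))\<^sup>2) =
      (LINT \<zeta>|lborel. (sobolev_weight s1 s2 \<zeta> * norm (g \<zeta>))\<^sup>2)"
    by (rule integral_cong_AE) (use f(2) in auto)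
  then show ?thesis by (simp add: sobolev_def weighted_L2_norm_def)
qed

lemma
  assumes g: "weighted_L2 s1 s2 g" and h: "weighted_L2 s1 s2 h"
  shows weighted_L2_add: "weighted_L2 s1 s2 (\<lambda>\<zeta>. g \<zeta> + h \<zeta>)"
    and weighted_L2_norm_add: "weighted_L2_norm s1 s2 (\<lambda>\<zeta>. g \<zeta> + h \<zeta>) \<le> weighted_L2_norm s1 s2 g + weighted_L2_norm s1 s2 h"
    and inv_fourier_dist_add: "inv_fourier_dist (\<lambda>\<zeta>. g \<zeta> + h \<zeta>) = inv_fourier_dist g + inv_fourier_dist h"
proof -
  let ?w = "sobolev_weight s1 s2"
  let ?G = "\<lambda>\<zeta>. ?w \<zeta> * norm (g \<zeta>)" and ?H = "\<lambda>\<zeta>. ?w \<zeta> * norm (h \<zeta>)"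
  have [measurable]: "g \<in> borel_measurable borel" "h \<in> borel_measurable borel"
    and G: "integrable lborel (\<lambda>\<zeta>. (?G \<zeta>)\<^sup>2)" and H: "integrable lborel (\<lambda>\<zeta>. (?H \<zeta>)\<^sup>2)"
    using g h by (auto simp: weighted_L2_def)
  have GH: "integrable lborel (\<lambda>\<zeta>. ?G \<zeta> * ?H \<zeta>)"
    by (rule integrable_mult_L2[OF _ _ G H]) measurable
  have w0: "0 \<le> ?w \<zeta>" for \<zeta> using sobolev_weight_pos[of s1 s2 \<zeta>] by simp
  have pw: "(?w \<zeta> * norm (g \<zeta> + h \<zeta>))\<^sup>2 \<le> (?G \<zeta>)\<^sup>2 + (?H \<zeta>)\<^sup>2 + 2 * (?G \<zeta> * ?H \<zeta>)" for \<zeta>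
  proof -
    have "(?w \<zeta> * norm (g \<zeta> + h \<zeta>))\<^sup>2 \<le> (?w \<zeta> * (norm (g \<zeta>) + norm (h \<zeta>)))\<^sup>2"
      by (intro power_mono mult_left_mono norm_triangle_ineq w0 mult_nonneg_nonneg) auto
    then show ?thesis by (simp add: power2_eq_square algebra_simps)
  qed
  have int: "integrable lborel (\<lambda>\<zeta>. (?G \<zeta>)\<^sup>2 + (?H \<zeta>)\<^sup>2 + 2 * (?G \<zeta> * ?H \<zeta>))"
    by (intro Bochner_Integration.integrable_add integrable_mult_right G H GH)
  have int': "integrable lborel (\<lambda>\<zeta>. (?w \<zeta> * norm (g \<zeta> + h \<zeta>))\<^sup>2)"
    by (rule Bochner_Integration.integrable_bound[OF int])
       (auto intro!: AE_I2 order_trans[OF pw])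
  then show sum: "weighted_L2 s1 s2 (\<lambda>\<zeta>. g \<zeta> + h \<zeta>)" by (simp add: weighted_L2_def)
  have "(LINT \<zeta>|lborel. (?w \<zeta> * norm (g \<zeta> + h \<zeta>))\<^sup>2) \<le> (LINT \<zeta>|lborel. (?G \<zeta>)\<^sup>2 + (?H \<zeta>)\<^sup>2 + 2 * (?G \<zeta> * ?H \<zeta>))"
    by (rule integral_mono[OF int' int pw])
  also have "\<dots> = (LINT \<zeta>|lborel. (?G \<zeta>)\<^sup>2) + (LINT \<zeta>|lborel. (?H \<zeta>)\<^sup>2) + 2 * (LINT \<zeta>|lborel. ?G \<zeta> * ?H \<zeta>)"
    using G H GH by (simp only: Bochner_Integration.integral_add Bochner_Integration.integrable_add integrable_mult_right integral_mult_right_zero)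
  also have "(LINT \<zeta>|lborel. ?G \<zeta> * ?H \<zeta>) \<le> weighted_L2_norm s1 s2 g * weighted_L2_norm s1 s2 h"
  proof -
    have "(LINT \<zeta>|lborel. ?G \<zeta> * ?H \<zeta>) = (LINT \<zeta>|lborel. \<bar>?G \<zeta> * ?H \<zeta>\<bar>)"
      by (rule Bochner_Integration.integral_cong) (auto simp: abs_mult w0)
    also have "\<dots> \<le> weighted_L2_norm s1 s2 g * weighted_L2_norm s1 s2 h"
      unfolding weighted_L2_norm_def by (rule integral_mult_L2_le[OF _ _ G H]) measurable
    finally show ?thesis .
  qed
  finally have "(LINT \<zeta>|lborel. (?w \<zeta> * norm (g \<zeta> + h \<zeta>))\<^sup>2) \<le> (weighted_L2_norm s1 s2 g + weighted_L2_norm s1 s2 h)\<^sup>2"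
    by (simp add: power2_sum weighted_L2_norm_def)
  then show "weighted_L2_norm s1 s2 (\<lambda>\<zeta>. g \<zeta> + h \<zeta>) \<le> weighted_L2_norm s1 s2 g + weighted_L2_norm s1 s2 h"
    unfolding weighted_L2_norm_def[of s1 s2 "\<lambda>\<zeta>. g \<zeta> + h \<zeta>"]
    by (intro real_le_lsqrt add_nonneg_nonneg weighted_L2_norm_nonneg) auto
  show "inv_fourier_dist (\<lambda>\<zeta>. g \<zeta> + h \<zeta>) = inv_fourier_dist g + inv_fourier_dist h"
  proof
    fix \<psi>
    show "inv_fourier_dist (\<lambda>\<zeta>. g \<zeta> + h \<zeta>) \<psi> = (inv_fourier_dist g + inv_fourier_dist h) \<psi>"
    proof (cases "\<psi> \<in> schwartz")
      case True
      from inv_fourier_dist_bounded[OF True, of s1 s2]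
      have "integrable lborel (\<lambda>\<zeta>. g \<zeta> * inv_fourier \<psi> \<zeta>)" "integrable lborel (\<lambda>\<zeta>. h \<zeta> * inv_fourier \<psi> \<zeta>)"
        using g h by metis+
      then show ?thesis by (simp add: inv_fourier_dist_def plus_fun_def distrib_right)
    qed (simp add: inv_fourier_dist_def plus_fun_def)
  qed
qed

lemma
  assumes g: "weighted_L2 s1 s2 g"
  shows weighted_L2_scale: "weighted_L2 s1 s2 (\<lambda>\<zeta>. of_real c * g \<zeta>)"
    and weighted_L2_norm_scale: "weighted_L2_norm s1 s2 (\<lambda>\<zeta>. of_real c * g \<zeta>) = \<bar>c\<bar> * weighted_L2_norm s1 s2 g"
proof -
  have [measurable]: "g \<in> borel_measurable borel"
    and G: "integrable lborel (\<lambda>\<zeta>. (sobolev_weight s1 s2 \<zeta> * norm (g \<zeta>))\<^sup>2)"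
    using g by (auto simp: weighted_L2_def)
  have eq: "(sobolev_weight s1 s2 \<zeta> * norm (of_real c * g \<zeta>))\<^sup>2 = c\<^sup>2 * (sobolev_weight s1 s2 \<zeta> * norm (g \<zeta>))\<^sup>2" for \<zeta>
    by (simp add: norm_mult power_mult_distrib)
  show "weighted_L2 s1 s2 (\<lambda>\<zeta>. of_real c * g \<zeta>)"
    unfolding weighted_L2_def eq using G by simp
  show "weighted_L2_norm s1 s2 (\<lambda>\<zeta>. of_real c * g \<zeta>) = \<bar>c\<bar> * weighted_L2_norm s1 s2 g"
    unfolding weighted_L2_norm_def eq by (simp add: real_sqrt_mult)
qed

lemma inv_fourier_dist_scale: "inv_fourier_dist (\<lambda>\<zeta>. of_real c * g \<zeta>) = c *\<^sub>R inv_fourier_dist g"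
  by (rule ext) (simp add: inv_fourier_dist_def scaleR_fun_def mult.assoc scaleR_conv_of_real)

lemma seminormed_sobolev: "seminormed (sobolev s1 s2)"
proof -
  have z: "weighted_L2 s1 s2 (\<lambda>_. 0)" by (simp add: weighted_L2_def)
  have "inv_fourier_dist (\<lambda>_. 0) = 0" by (rule ext) (simp add: inv_fourier_dist_def)
  with z have 0: "0 \<in> points (sobolev s1 s2)" unfolding points_sobolev by force
  show ?thesis
    unfolding seminormed_def
  proof (intro conjI ballI allI 0)
    fix u assume "u \<in> points (sobolev s1 s2)"
    then obtain g where g: "weighted_L2 s1 s2 g" and u: "u = inv_fourier_dist g" unfolding points_sobolev by blast
    show "0 \<le> nrm (sobolev s1 s2) u" unfolding u nrm_sobolev[OF g] by (rule weighted_L2_norm_nonneg)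
    show "c *\<^sub>R u \<in> points (sobolev s1 s2)" for c
      unfolding u inv_fourier_dist_scale[symmetric] points_sobolev using weighted_L2_scale[OF g] by blast
    show "nrm (sobolev s1 s2) (c *\<^sub>R u) = \<bar>c\<bar> * nrm (sobolev s1 s2) u" for c
      unfolding u inv_fourier_dist_scale[symmetric] nrm_sobolev[OF g] nrm_sobolev[OF weighted_L2_scale[OF g]]
      by (rule weighted_L2_norm_scale[OF g])
    fix v assume "v \<in> points (sobolev s1 s2)"
    then obtain h where h: "weighted_L2 s1 s2 h" and v: "v = inv_fourier_dist h" unfolding points_sobolev by blast
    show "u + v \<in> points (sobolev s1 s2)"
      unfolding u v inv_fourier_dist_add[OF g h, symmetric] points_sobolev using weighted_L2_add[OF g h] by blast
    show "nrm (sobolev s1 s2) (u + v) \<le> nrm (sobolev s1 s2) u + nrm (sobolev s1 s2) v"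
      unfolding u v inv_fourier_dist_add[OF g h, symmetric] nrm_sobolev[OF g] nrm_sobolev[OF h] nrm_sobolev[OF weighted_L2_add[OF g h]]
      by (rule weighted_L2_norm_add[OF g h])
  qed
qed

lemma real_sobolev_simps:
  "points (real_sobolev s1 s2) = {u \<in> points (sobolev s1 s2). real_valued u}"
  "nrm (real_sobolev s1 s2) = nrm (sobolev s1 s2)"
  by (simp_all add: real_sobolev_def)

lemma seminormed_real_sobolev: "seminormed (real_sobolev s1 s2)"
  using seminormed_sobolev[of s1 s2]
  by (auto simp: seminormed_def real_sobolev_simps real_valued_def plus_fun_def scaleR_fun_def zero_fun_def)

section \<open>Real-valued distributions and rapidly decreasing transforms\<close>

lemma cnj_borel_measurable [measurable]: "cnj \<in> borel_measurable borel"
  by (intro borel_measurable_continuous_onI continuous_intros)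

text \<open>Hermitian symmetry of the transform expresses that the distribution is real. It allows
  the same data to be used in \<open>sobolev\<close> and in \<open>real_sobolev\<close>.\<close>

lemma real_valued_inv_fourier_dist:
  assumes [measurable]: "g \<in> borel_measurable borel" and sym: "\<And>\<zeta>. g (- \<zeta>) = cnj (g \<zeta>)"
  shows "real_valued (inv_fourier_dist g)"
  unfolding real_valued_def
proof
  fix \<psi> :: "pt \<Rightarrow> complex" assume psi: "\<psi> \<in> schwartz"
  note [measurable] = schwartz_measurable[OF psi]
  have "inv_fourier (\<lambda>z. cnj (\<psi> z)) \<zeta> = cnj (inv_fourier \<psi> (- \<zeta>))" for \<zeta>
  proof -
    have "cnj (LINT z|lborel. cis (z \<bullet> - \<zeta>) * \<psi> z) = (LINT z|lborel. cnj (cis (z \<bullet> - \<zeta>) * \<psi> z))"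
      by (rule Bochner_Integration.integral_cnj[symmetric])
    then show ?thesis unfolding inv_fourier_def by (simp add: cis_cnj)
  qed
  then have "inv_fourier_dist g (\<lambda>z. cnj (\<psi> z)) = (LINT \<zeta>|lborel. g \<zeta> * cnj (inv_fourier \<psi> (- \<zeta>)))"
    using psi schwartz_cnj[OF psi] by (simp add: inv_fourier_dist_def)
  also have "\<dots> = (LINT \<zeta>|lborel. (\<lambda>\<zeta>. g (- \<zeta>) * cnj (inv_fourier \<psi> \<zeta>)) (0 - \<zeta>))"
    by simp
  also have "\<dots> = (LINT \<zeta>|lborel. g (- \<zeta>) * cnj (inv_fourier \<psi> \<zeta>))"
    by (rule lborel_integral_reflect(1)) measurable
  also have "\<dots> = (LINT \<zeta>|lborel. cnj (g \<zeta> * inv_fourier \<psi> \<zeta>))" by (simp add: sym)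
  also have "\<dots> = cnj (LINT \<zeta>|lborel. g \<zeta> * inv_fourier \<psi> \<zeta>)" by (rule Bochner_Integration.integral_cnj)
  also have "\<dots> = cnj (inv_fourier_dist g \<psi>)"
    using psi by (simp add: inv_fourier_dist_def)
  finally show "inv_fourier_dist g (\<lambda>z. cnj (\<psi> z)) = cnj (inv_fourier_dist g \<psi>)" .
qed

lemma weighted_L2_of_rapid_decay:
  assumes [measurable]: "g \<in> borel_measurable borel"
    and dec: "\<And>m. \<exists>C. \<forall>\<zeta>. norm (g \<zeta>) * (1 + (norm \<zeta>)\<^sup>2) ^ m \<le> C"
  shows "weighted_L2 s1 s2 g"
proof -
  obtain m where m: "\<And>\<zeta>. sobolev_weight s1 s2 \<zeta> \<le> (1 + (norm \<zeta>)\<^sup>2) ^ m"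
    using sobolev_weight_bounds[of s1 s2] by (elim exE) (rule that, blast)
  obtain C where C: "\<And>\<zeta>. norm (g \<zeta>) * (1 + (norm \<zeta>)\<^sup>2) ^ (m + 3) \<le> C"
    using dec[of "m + 3"] by blast
  have b: "sobolev_weight s1 s2 \<zeta> * norm (g \<zeta>) \<le> C * decay \<zeta>" for \<zeta>
    using sobolev_weight_pos[of s1 s2 \<zeta>] by (intro mult_le_decay[OF _ m C]) simp
  have w0: "0 \<le> sobolev_weight s1 s2 \<zeta> * norm (g \<zeta>)" for \<zeta>
    using sobolev_weight_pos[of s1 s2 \<zeta>] by simp
  have C0: "0 \<le> C" using order_trans[OF w0 b[of 0]] decay_pos[of 0] by (simp add: zero_le_mult_iff)
  have "integrable lborel (\<lambda>\<zeta>. (sobolev_weight s1 s2 \<zeta> * norm (g \<zeta>))\<^sup>2)"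
  proof (rule integrable_of_le_decay[where C = "C * C"])
    fix \<zeta>
    have "(sobolev_weight s1 s2 \<zeta> * norm (g \<zeta>))\<^sup>2 \<le> (C * decay \<zeta>) * (C * 1)"
      unfolding power2_eq_square
      by (intro mult_mono b w0 order_trans[OF b] mult_left_mono decay_le_1 C0 mult_nonneg_nonneg decay_nonneg)
    then show "norm ((sobolev_weight s1 s2 \<zeta> * norm (g \<zeta>))\<^sup>2) \<le> C * C * decay \<zeta>" by (simp add: mult_ac)
  qed measurable
  then show ?thesis by (simp add: weighted_L2_def)
qed

section \<open>The Picard series\<close>

text \<open>On the null set \<open>fst \<zeta> = 0\<close> the quotient is 0 by convention, so the
  symbol is odd everywhere, as Hermitian symmetry requires.\<close>

definition kp_symbol :: "real \<Rightarrow> pt \<Rightarrow> real" where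
  "kp_symbol \<alpha> \<zeta> = \<bar>fst \<zeta>\<bar> powr \<alpha> * fst \<zeta> + (norm (snd \<zeta>))\<^sup>2 / fst \<zeta>"

lemma kp_symbol_measurable [measurable]: "kp_symbol \<alpha> \<in> borel_measurable borel"
  unfolding kp_symbol_def by measurable

lemma kp_symbol_minus: "kp_symbol \<alpha> (- \<zeta>) = - kp_symbol \<alpha> \<zeta>"
  by (simp add: kp_symbol_def)

text \<open>The normalization makes \<open>fconv g h\<close> the Fourier transform of the product of the functions with
  Fourier transforms \<open>g\<close> and \<open>h\<close>.\<close>

definition fconv :: "(pt \<Rightarrow> complex) \<Rightarrow> (pt \<Rightarrow> complex) \<Rightarrow> pt \<Rightarrow> complex" where
  "fconv g h \<zeta> = (LINT z|lborel. g z * h (\<zeta> - z)) / of_real ((2 * pi) ^ 3)"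

text \<open>\<open>osign t\<close> turns the oriented integral over \<open>[0,t]\<close> into one over the line.\<close>

definition osign :: "real \<Rightarrow> real \<Rightarrow> real" where
  "osign t s = (if 0 < s \<and> s < t then 1 else if t < s \<and> s < 0 then -1 else 0)"

text \<open>The Duhamel term on the Fourier side, with \<open>G s\<close> in the place of the
  transform of the square at time \<open>s\<close> and \<i> times \<open>fst \<zeta>\<close> as the
  symbol of the x-derivative.\<close>

definition duhamel :: "real \<Rightarrow> (real \<Rightarrow> pt \<Rightarrow> complex) \<Rightarrow> real \<Rightarrow> pt \<Rightarrow> complex" where
  "duhamel \<alpha> G t \<zeta> =
     (LINT s|lborel. osign t s *\<^sub>R (cis ((t - s) * kp_symbol \<alpha> \<zeta>) * (\<i> * of_real (fst \<zeta>)) * G s \<zeta>))"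

text \<open>Obtained by comparing powers of the amplitude in Duhamel's formula: index
  \<open>n\<close> is the part of the solution homogeneous of degree n + 1 in the datum, so index 1
  is the quadratic term.\<close>

fun picard :: "real \<Rightarrow> (pt \<Rightarrow> complex) \<Rightarrow> nat \<Rightarrow> real \<Rightarrow> pt \<Rightarrow> complex" where
  "picard \<alpha> f 0 = (\<lambda>t \<zeta>. cis (t * kp_symbol \<alpha> \<zeta>) * f \<zeta>)"
| "picard \<alpha> f (Suc n) =
     duhamel \<alpha> (\<lambda>s \<zeta>. \<Sum>i\<le>n. fconv (picard \<alpha> f i s) (picard \<alpha> f (n - i) s) \<zeta>)"

subsection \<open>Oriented integrals\<close>

lemma osign_measurable [measurable (raw)]:
  assumes [measurable]: "f \<in> borel_measurable M" "g \<in> borel_measurable M"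
  shows "(\<lambda>x. osign (f x) (g x)) \<in> borel_measurable M"
  unfolding osign_def by measurable

lemma osign_minus: "osign (- t) (- s) = - osign t s"
  by (simp add: osign_def)

lemma abs_osign_le_1: "\<bar>osign t s\<bar> \<le> 1"
  by (simp add: osign_def)

lemma osign_eq_0: "\<bar>t\<bar> \<le> T \<Longrightarrow> T < \<bar>s\<bar> \<Longrightarrow> osign t s = 0"
  by (auto simp: osign_def)

lemma interval_integral_osign:
  "(LBINT s=ereal 0..ereal t. H s) = (LINT s|lborel. osign t s *\<^sub>R (H s :: complex))"
  "interval_lebesgue_integrable lborel (ereal 0) (ereal t) H \<longleftrightarrow> integrable lborel (\<lambda>s. osign t s *\<^sub>R H s)"
proof -
  have 1: "indicat_real {0<..<t} s = osign t s" if "0 \<le> t" for s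
    using that by (auto simp: osign_def)
  have 2: "indicat_real {t<..<0} s = - osign t s" if "\<not> 0 \<le> t" for s
    using that by (auto simp: osign_def)
  show "(LBINT s=ereal 0..ereal t. H s) = (LINT s|lborel. osign t s *\<^sub>R H s)"
    by (cases "0 \<le> t") (simp_all add: interval_lebesgue_integral_def set_lebesgue_integral_def 1 2)
  show "interval_lebesgue_integrable lborel (ereal 0) (ereal t) H \<longleftrightarrow> integrable lborel (\<lambda>s. osign t s *\<^sub>R H s)"
    by (cases "0 \<le> t") (simp_all add: interval_lebesgue_integrable_def set_integrable_def 1 2)
qed

lemma integrable_osign_power: "integrable lborel (\<lambda>s. \<bar>osign t s\<bar> * \<bar>s\<bar> ^ n)"
  and integral_osign_power: "(LINT s|lborel. \<bar>osign t s\<bar> * \<bar>s\<bar> ^ n) = \<bar>t\<bar> ^ Suc n / Suc n"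
proof -
  have pos: "integrable lborel (\<lambda>s. \<bar>osign t s\<bar> * \<bar>s\<bar> ^ n) \<and>
      (LINT s|lborel. \<bar>osign t s\<bar> * \<bar>s\<bar> ^ n) = t ^ Suc n / Suc n" if t: "0 \<le> t" for t
  proof -
    have hb: "has_bochner_integral lborel (\<lambda>s. s ^ n * indicator {0..t} s) (t ^ Suc n / Suc n - 0 ^ Suc n / Suc n)"
    proof (rule has_bochner_integral_FTC_Icc_real[where F = "\<lambda>s. s ^ Suc n / Suc n" and f = "\<lambda>s. s ^ n", OF t])
      show "DERIV (\<lambda>s. s ^ Suc n / Suc n) x :> x ^ n" for x :: real
        by (intro derivative_eq_intros) auto
    qed (intro continuous_intros)
    have "AE s in lborel. s ^ n * indicator {0..t} s = \<bar>osign t s\<bar> * \<bar>s\<bar> ^ n"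
    proof (rule AE_mp[OF AE_conjI[OF AE_lborel_singleton[of 0] AE_lborel_singleton[of t]]])
      show "AE s in lborel. s \<noteq> 0 \<and> s \<noteq> t \<longrightarrow> s ^ n * indicator {0..t} s = \<bar>osign t s\<bar> * \<bar>s\<bar> ^ n"
        using t by (auto simp: osign_def indicator_def intro!: AE_I2)
    qed
    then have "has_bochner_integral lborel (\<lambda>s. \<bar>osign t s\<bar> * \<bar>s\<bar> ^ n) (t ^ Suc n / Suc n - 0 ^ Suc n / Suc n)"
      using hb by (subst has_bochner_integral_cong_AE[symmetric]) auto
    then show ?thesis by (simp add: has_bochner_integral_iff)
  qed
  have "(\<lambda>s. \<bar>osign t s\<bar> * \<bar>s\<bar> ^ n) = (\<lambda>s. \<bar>osign (- t) (0 - s)\<bar> * \<bar>0 - s\<bar> ^ n)"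
    by (simp add: osign_minus)
  then have neg: "integrable lborel (\<lambda>s. \<bar>osign t s\<bar> * \<bar>s\<bar> ^ n) \<and>
      (LINT s|lborel. \<bar>osign t s\<bar> * \<bar>s\<bar> ^ n) = (- t) ^ Suc n / Suc n" if t: "t \<le> 0"
    using pos[of "- t"] t lborel_integral_reflect[of "\<lambda>s. \<bar>osign (- t) s\<bar> * \<bar>s\<bar> ^ n" 0] by simp
  have "integrable lborel (\<lambda>s. \<bar>osign t s\<bar> * \<bar>s\<bar> ^ n) \<and> (LINT s|lborel. \<bar>osign t s\<bar> * \<bar>s\<bar> ^ n) = \<bar>t\<bar> ^ Suc n / Suc n"
    using pos[of t] neg by (cases "0 \<le> t") (auto simp del: power_Suc)
  then show "integrable lborel (\<lambda>s. \<bar>osign t s\<bar> * \<bar>s\<bar> ^ n)"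
    "(LINT s|lborel. \<bar>osign t s\<bar> * \<bar>s\<bar> ^ n) = \<bar>t\<bar> ^ Suc n / Suc n" by auto
qed

text \<open>Integrating a bound of order |s|^n over time gains |t| / (n + 1), which is what pays for
  the derivative.\<close>

lemma norm_osign_integral_le:
  fixes H :: "real \<Rightarrow> 'a::{banach,second_countable_topology}"
  assumes "\<And>s. osign t s \<noteq> 0 \<Longrightarrow> norm (H s) \<le> M * \<bar>s\<bar> ^ n" and M: "0 \<le> M"
  shows "norm (LINT s|lborel. osign t s *\<^sub>R H s) \<le> M * (\<bar>t\<bar> ^ Suc n / Suc n)"
    and "H \<in> borel_measurable borel \<Longrightarrow> integrable lborel (\<lambda>s. osign t s *\<^sub>R H s)"
proof -
  have b: "norm (osign t s *\<^sub>R H s) \<le> M * (\<bar>osign t s\<bar> * \<bar>s\<bar> ^ n)" for s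
    using mult_left_mono[OF assms(1), of s "\<bar>osign t s\<bar>"] by (cases "osign t s = 0") (simp_all add: mult_ac)
  have int: "integrable lborel (\<lambda>s. M * (\<bar>osign t s\<bar> * \<bar>s\<bar> ^ n))"
    by (intro integrable_mult_right integrable_osign_power)
  have "norm (LINT s|lborel. osign t s *\<^sub>R H s) \<le> (LINT s|lborel. norm (osign t s *\<^sub>R H s))"
    by (rule integral_norm_bound)
  also have "\<dots> \<le> (LINT s|lborel. M * (\<bar>osign t s\<bar> * \<bar>s\<bar> ^ n))"
    by (rule integral_mono'[OF int b]) (simp add: M)
  also have "\<dots> = M * (\<bar>t\<bar> ^ Suc n / Suc n)" by (simp only: integral_mult_right_zero integral_osign_power)
  finally show "norm (LINT s|lborel. osign t s *\<^sub>R H s) \<le> M * (\<bar>t\<bar> ^ Suc n / Suc n)" .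
  assume [measurable]: "H \<in> borel_measurable borel"
  show "integrable lborel (\<lambda>s. osign t s *\<^sub>R H s)"
    by (rule Bochner_Integration.integrable_bound[OF int])
       (auto intro!: AE_I2 order_trans[OF b] abs_ge_self simp del: norm_scaleR)
qed

subsection \<open>Convolution bounds\<close>

lemma measurable_uncurry:
  assumes "case_prod g \<in> borel_measurable (N1 \<Otimes>\<^sub>M N2)" "a \<in> measurable M N1" "b \<in> measurable M N2"
  shows "(\<lambda>x. g (a x) (b x)) \<in> borel_measurable M"
  using measurable_compose[OF measurable_Pair[OF assms(2,3)] assms(1)] by simp

lemma fconv_measurable_pair:
  fixes g h :: "real \<Rightarrow> pt \<Rightarrow> complex"
  assumes g: "case_prod g \<in> borel_measurable (borel \<Otimes>\<^sub>M borel)" and h: "case_prod h \<in> borel_measurable (borel \<Otimes>\<^sub>M borel)"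
  shows "(\<lambda>(s, \<zeta>). fconv (g s) (h s) \<zeta>) \<in> borel_measurable (borel \<Otimes>\<^sub>M borel)"
proof -
  have [measurable]: "(\<lambda>p. g (fst (fst p)) (snd p)) \<in> borel_measurable ((borel \<Otimes>\<^sub>M borel) \<Otimes>\<^sub>M lborel)"
    by (rule measurable_uncurry[OF g]) measurable
  have [measurable]: "(\<lambda>p. h (fst (fst p)) (snd (fst p) - snd p)) \<in> borel_measurable ((borel \<Otimes>\<^sub>M borel) \<Otimes>\<^sub>M lborel)"
    by (rule measurable_uncurry[OF h]) measurable
  have "(\<lambda>p. LINT z|lborel. g (fst p) z * h (fst p) (snd p - z)) \<in> borel_measurable (borel \<Otimes>\<^sub>M borel)"
    by measurable
  then show ?thesis unfolding fconv_def case_prod_unfold by measurable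
qed

text \<open>Fixed once, so that the constants of the Picard iterates can be named by a
  formula.\<close>

definition conv_const :: real where
  "conv_const = (SOME C. C > 0 \<and> (\<forall>x. (LINT y|lborel. decay y * decay (x - y)) \<le> C * decay x))"

lemma conv_const: "conv_const > 0" "(LINT y|lborel. decay y * decay (x - y)) \<le> conv_const * decay x"
  and integrable_decay_conv: "integrable lborel (\<lambda>y. decay y * decay (x - y))"
proof -
  obtain C where C: "C > 0" "\<And>x. integrable lborel (\<lambda>y. decay y * decay (x - y))"
    "\<And>x. (LINT y|lborel. decay y * decay (x - y)) \<le> C * decay x"
    using decay_convolution by metis
  have "conv_const > 0 \<and> (\<forall>x. (LINT y|lborel. decay y * decay (x - y)) \<le> conv_const * decay x)"
    unfolding conv_const_def by (rule someI[of _ C]) (use C in blast)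
  then show "conv_const > 0" "(LINT y|lborel. decay y * decay (x - y)) \<le> conv_const * decay x" by blast+
  show "integrable lborel (\<lambda>y. decay y * decay (x - y))" by (rule C)
qed

lemma
  fixes F :: "pt \<Rightarrow> complex"
  assumes F: "\<And>z. norm (F z) \<le> M * (decay z * decay (\<zeta> - z))" and M: "0 \<le> M"
  shows norm_decay_conv_le: "norm (LINT z|lborel. F z) \<le> M * (conv_const * decay \<zeta>)"
      "(LINT z|lborel. norm (F z)) \<le> M * (conv_const * decay \<zeta>)"
    and integrable_decay_conv_bound: "F \<in> borel_measurable borel \<Longrightarrow> integrable lborel F"
proof -
  have int: "integrable lborel (\<lambda>z. M * (decay z * decay (\<zeta> - z)))"
    by (intro integrable_mult_right integrable_decay_conv)
  have "(LINT z|lborel. norm (F z)) \<le> (LINT z|lborel. M * (decay z * decay (\<zeta> - z)))"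
    by (rule integral_mono'[OF int F]) (simp add: M decay_nonneg)
  also have "\<dots> \<le> M * (conv_const * decay \<zeta>)"
    using mult_left_mono[OF conv_const(2) M] by simp
  finally show 1: "(LINT z|lborel. norm (F z)) \<le> M * (conv_const * decay \<zeta>)" .
  show "norm (LINT z|lborel. F z) \<le> M * (conv_const * decay \<zeta>)"
    by (rule order_trans[OF integral_norm_bound 1])
  assume [measurable]: "F \<in> borel_measurable borel"
  show "integrable lborel F"
    by (rule Bochner_Integration.integrable_bound[OF int]) (auto intro!: AE_I2 order_trans[OF F])
qed

lemma two_pi_cube_ge_1: "1 \<le> (2 * pi) ^ 3"
  by (rule one_le_power) (use pi_ge_two in linarith)

lemma norm_fconv_le:
  assumes g: "\<And>z. norm (g z) \<le> a * decay z" and h: "\<And>z. norm (h z) \<le> b * decay z" and a: "0 \<le> a" and b: "0 \<le> b"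
  shows "norm (fconv g h \<zeta>) \<le> a * b * conv_const * decay \<zeta>"
proof -
  let ?I = "LINT z|lborel. g z * h (\<zeta> - z)"
  have "norm ?I \<le> (a * b) * (conv_const * decay \<zeta>)"
  proof (rule norm_decay_conv_le)
    fix z
    have "norm (g z) * norm (h (\<zeta> - z)) \<le> (a * decay z) * (b * decay (\<zeta> - z))"
      by (intro mult_mono g h mult_nonneg_nonneg a decay_nonneg) auto
    then show "norm (g z * h (\<zeta> - z)) \<le> (a * b) * (decay z * decay (\<zeta> - z))"
      by (simp add: norm_mult mult_ac)
  qed (use a b in simp)
  moreover have "norm (fconv g h \<zeta>) \<le> norm ?I"
    using two_pi_cube_ge_1 unfolding fconv_def by (simp add: norm_divide norm_power divide_le_eq mult_le_cancel_left1)
  ultimately show ?thesis by (simp add: mult_ac)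
qed

lemma sum_inverse_squares_le: "(\<Sum>i\<le>n. 1 / (real i + 1)\<^sup>2) \<le> 2 - 1 / (real n + 1)"
proof (induction n)
  case (Suc n)
  have "1 / (real n + 2)\<^sup>2 \<le> 1 / (real n + 1) - 1 / (real n + 2)"
  proof -
    have "1 / (real n + 2)\<^sup>2 \<le> 1 / ((real n + 1) * (real n + 2))"
      by (intro divide_left_mono) (auto simp: power2_eq_square)
    also have "\<dots> = 1 / (real n + 1) - 1 / (real n + 2)"
      by (simp add: field_simps)
    finally show ?thesis .
  qed
  with Suc show ?case by (simp add: add.commute)
qed simp

text \<open>The weight 1 / (n + 1)^2 is stable under discrete convolution. With a + b = n + 2 the
  product 1 / (a b) equals (1/a + 1/b) / (a + b); squaring this and summing leaves two sums of
  inverse squares, each at most 2.\<close>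

lemma sum_inverse_squares_conv_le:
  "(\<Sum>i\<le>n. 1 / ((real i + 1)\<^sup>2 * (real (n - i) + 1)\<^sup>2)) \<le> 8 / (real n + 2)\<^sup>2"
proof -
  have summand: "1 / ((real i + 1)\<^sup>2 * (real (n - i) + 1)\<^sup>2) \<le>
      2 / (real n + 2)\<^sup>2 * (1 / (real i + 1)\<^sup>2 + 1 / (real (n - i) + 1)\<^sup>2)" if "i \<le> n" for i
  proof -
    define a b where "a = real i + 1" and "b = real (n - i) + 1"
    have ab: "a > 0" "b > 0" "a + b = real n + 2" using that by (auto simp: a_def b_def of_nat_diff)
    have "1 / (a\<^sup>2 * b\<^sup>2) = (1 / a + 1 / b)\<^sup>2 / (a + b)\<^sup>2"
      using ab by (simp add: field_simps)
    also have "\<dots> \<le> (2 * ((1 / a)\<^sup>2 + (1 / b)\<^sup>2)) / (a + b)\<^sup>2"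
    proof (rule divide_right_mono)
      show "(x + y)\<^sup>2 \<le> 2 * (x\<^sup>2 + y\<^sup>2)" for x y :: real
        using sum_squares_bound[of x y] by (simp add: power2_sum)
    qed simp
    also have "\<dots> = (2 * (1 / a\<^sup>2 + 1 / b\<^sup>2)) / (a + b)\<^sup>2" by (simp add: power_divide)
    finally have "1 / (a\<^sup>2 * b\<^sup>2) \<le> (2 * (1 / a\<^sup>2 + 1 / b\<^sup>2)) / (real n + 2)\<^sup>2"
      unfolding ab(3) .
    then show ?thesis by (simp add: a_def b_def)
  qed
  have "(\<Sum>i\<le>n. 1 / (real (n - i) + 1)\<^sup>2) = (\<Sum>i\<le>n. 1 / (real i + 1)\<^sup>2)"
    by (rule sum.reindex_bij_witness[of _ "\<lambda>i. n - i" "\<lambda>i. n - i"]) auto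
  moreover have "(\<Sum>i\<le>n. 1 / (real i + 1)\<^sup>2) \<le> 2"
    by (rule order_trans[OF sum_inverse_squares_le]) simp
  ultimately have "(\<Sum>i\<le>n. 1 / (real i + 1)\<^sup>2 + 1 / (real (n - i) + 1)\<^sup>2) \<le> 4"
    by (simp add: sum.distrib)
  from mult_left_mono[OF this, of "2 / (real n + 2)\<^sup>2"]
  have "(\<Sum>i\<le>n. 2 / (real n + 2)\<^sup>2 * (1 / (real i + 1)\<^sup>2 + 1 / (real (n - i) + 1)\<^sup>2)) \<le> 8 / (real n + 2)\<^sup>2"
    by (simp add: sum_distrib_left)
  with sum_mono[of "{..n}", OF summand] show ?thesis by (meson atMost_iff order_trans)
qed

subsection \<open>Bounds on the Picard iterates\<close>

text \<open>The \<open>n\<close>-th iterate lives on frequencies of size \<open>O(n)\<close>, so that the derivative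
  in the nonlinearity costs a factor \<open>n\<close>; it is won back from the time integral of \<open>\<bar>t\<bar>\<^sup>n\<close>.\<close>

locale kp_data =
  fixes \<alpha> A R :: real and f :: "pt \<Rightarrow> complex"
  assumes f_measurable [measurable]: "f \<in> borel_measurable borel"
    and f_bound: "\<And>\<zeta>. norm (f \<zeta>) \<le> A * decay \<zeta>"
    and f_support: "\<And>\<zeta>. f \<zeta> \<noteq> 0 \<Longrightarrow> norm \<zeta> \<le> R"
    and R_nonneg: "0 \<le> R"
begin

lemma A_nonneg: "0 \<le> A"
  using order_trans[OF norm_ge_zero f_bound[of 0]] decay_pos[of 0] by (simp add: zero_le_mult_iff)

abbreviation p where "p \<equiv> picard \<alpha> f"

text \<open>The ratio by which the iterates grow. Of the 16, a factor 8 is the constant of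
  \<open>sum_inverse_squares_conv_le\<close>; the other 2 bounds (k + 2) / (k + 1), the frequency
  radius against the gain of the time integral.\<close>

definition B where "B = 16 * A * conv_const * R"

lemma B_nonneg: "0 \<le> B"
  using A_nonneg R_nonneg conv_const(1) by (simp add: B_def)

text \<open>The denominator \<open>(real n + 1)\<^sup>2\<close> is what closes the induction: it
  reproduces itself under the sum over all pairs of earlier iterates, so that no combinatorial
  factor accumulates.\<close>

lemma picard_estimates:
  "case_prod (p n) \<in> borel_measurable (borel \<Otimes>\<^sub>M borel) \<and>
   (\<forall>t \<zeta>. norm (p n t \<zeta>) \<le> A * B ^ n * \<bar>t\<bar> ^ n / (real n + 1)\<^sup>2 * decay \<zeta>) \<and>
   (\<forall>t \<zeta>. p n t \<zeta> \<noteq> 0 \<longrightarrow> norm \<zeta> \<le> (real n + 1) * R)"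
proof (induction n rule: less_induct)
  case (less n)
  show ?case
  proof (cases n)
    case 0
    have "(\<lambda>(t, \<zeta>). cis (t * kp_symbol \<alpha> \<zeta>) * f \<zeta>) \<in> borel_measurable (borel \<Otimes>\<^sub>M borel)"
      by measurable
    then show ?thesis using f_bound f_support by (simp add: 0 norm_mult)
  next
    case (Suc k)
    have IHm: "case_prod (p i) \<in> borel_measurable (borel \<Otimes>\<^sub>M borel)"
      and IHb: "\<And>t \<zeta>. norm (p i t \<zeta>) \<le> A * B ^ i * \<bar>t\<bar> ^ i / (real i + 1)\<^sup>2 * decay \<zeta>"
      and IHs: "\<And>t \<zeta>. p i t \<zeta> \<noteq> 0 \<Longrightarrow> norm \<zeta> \<le> (real i + 1) * R" if "i \<le> k" for i
      using less.IH[of i] that Suc by auto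
    define K where "K s \<zeta> = (\<Sum>i\<le>k. fconv (p i s) (p (k - i) s) \<zeta>)" for s \<zeta>
    have pS: "p n = duhamel \<alpha> K" unfolding Suc K_def by simp
    have Km: "case_prod K \<in> borel_measurable (borel \<Otimes>\<^sub>M borel)"
    proof -
      have "(\<lambda>x. fconv (p i (fst x)) (p (k - i) (fst x)) (snd x)) \<in> borel_measurable (borel \<Otimes>\<^sub>M borel)" if "i \<le> k" for i
        using fconv_measurable_pair[OF IHm[OF that] IHm[of "k - i"]] by (simp add: case_prod_unfold)
      then show ?thesis unfolding K_def case_prod_unfold by (intro borel_measurable_sum) simp
    qed
    have Kb: "norm (K s \<zeta>) \<le> A\<^sup>2 * B ^ k * conv_const * 8 / (real k + 2)\<^sup>2 * decay \<zeta> * \<bar>s\<bar> ^ k" for s \<zeta>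
    proof -
      have "norm (fconv (p i s) (p (k - i) s) \<zeta>) \<le>
          (A\<^sup>2 * B ^ k * conv_const * decay \<zeta> * \<bar>s\<bar> ^ k) * (1 / ((real i + 1)\<^sup>2 * (real (k - i) + 1)\<^sup>2))" if "i \<le> k" for i
      proof -
        have "norm (fconv (p i s) (p (k - i) s) \<zeta>) \<le>
          (A * B ^ i * \<bar>s\<bar> ^ i / (real i + 1)\<^sup>2) * (A * B ^ (k - i) * \<bar>s\<bar> ^ (k - i) / (real (k - i) + 1)\<^sup>2) * conv_const * decay \<zeta>"
          by (rule norm_fconv_le[OF IHb[OF that] IHb])
             (auto intro!: divide_nonneg_nonneg mult_nonneg_nonneg A_nonneg B_nonneg zero_le_power)
        also have "\<dots> = (A * A * (B ^ i * B ^ (k - i)) * conv_const * decay \<zeta> * (\<bar>s\<bar> ^ i * \<bar>s\<bar> ^ (k - i))) * (1 / ((real i + 1)\<^sup>2 * (real (k - i) + 1)\<^sup>2))"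
          by (simp add: field_simps)
        also have "\<dots> = (A\<^sup>2 * B ^ k * conv_const * decay \<zeta> * \<bar>s\<bar> ^ k) * (1 / ((real i + 1)\<^sup>2 * (real (k - i) + 1)\<^sup>2))"
          using that by (simp only: power_add[symmetric] le_add_diff_inverse power2_eq_square)
        finally show ?thesis .
      qed
      then have "norm (K s \<zeta>) \<le> (\<Sum>i\<le>k. (A\<^sup>2 * B ^ k * conv_const * decay \<zeta> * \<bar>s\<bar> ^ k) * (1 / ((real i + 1)\<^sup>2 * (real (k - i) + 1)\<^sup>2)))"
        unfolding K_def by (intro sum_norm_le) simp
      also have "\<dots> = (A\<^sup>2 * B ^ k * conv_const * decay \<zeta> * \<bar>s\<bar> ^ k) * (\<Sum>i\<le>k. 1 / ((real i + 1)\<^sup>2 * (real (k - i) + 1)\<^sup>2))"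
        by (rule sum_distrib_left[symmetric])
      also have "\<dots> \<le> (A\<^sup>2 * B ^ k * conv_const * decay \<zeta> * \<bar>s\<bar> ^ k) * (8 / (real k + 2)\<^sup>2)"
        by (intro mult_left_mono sum_inverse_squares_conv_le mult_nonneg_nonneg)
           (auto intro: zero_le_power[OF B_nonneg] less_imp_le[OF conv_const(1)] decay_nonneg)
      finally show ?thesis by (simp add: mult_ac)
    qed
    have Ks: "norm \<zeta> \<le> (real k + 2) * R" if "K s \<zeta> \<noteq> 0" for s \<zeta>
    proof -
      have "\<exists>i\<in>{..k}. fconv (p i s) (p (k - i) s) \<zeta> \<noteq> 0"
        using that unfolding K_def by (rule contrapos_np) (simp add: sum.neutral)
      then obtain i where i: "i \<le> k" "fconv (p i s) (p (k - i) s) \<zeta> \<noteq> 0" by auto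
      have "\<exists>z. p i s z \<noteq> 0 \<and> p (k - i) s (\<zeta> - z) \<noteq> 0"
      proof (rule contrapos_np[OF i(2)])
        assume "\<not> (\<exists>z. p i s z \<noteq> 0 \<and> p (k - i) s (\<zeta> - z) \<noteq> 0)"
        then have "(\<lambda>z. p i s z * p (k - i) s (\<zeta> - z)) = (\<lambda>z. 0)" by (auto simp: fun_eq_iff)
        then show "fconv (p i s) (p (k - i) s) \<zeta> = 0" by (simp add: fconv_def)
      qed
      then obtain z where z: "p i s z \<noteq> 0" "p (k - i) s (\<zeta> - z) \<noteq> 0" by blast
      have "norm \<zeta> \<le> norm z + norm (\<zeta> - z)" by (metis norm_triangle_sub)
      also have "\<dots> \<le> (real i + 1) * R + (real (k - i) + 1) * R"
        by (intro add_mono IHs[OF i(1) z(1)] IHs[OF _ z(2)]) simp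
      also have "\<dots> = (real k + 2) * R" using i(1) by (simp add: of_nat_diff algebra_simps)
      finally show ?thesis .
    qed
    have m: "case_prod (p n) \<in> borel_measurable (borel \<Otimes>\<^sub>M borel)"
    proof -
      have [measurable]: "(\<lambda>x. K (snd x) (snd (fst x))) \<in> borel_measurable ((borel \<Otimes>\<^sub>M borel) \<Otimes>\<^sub>M lborel)"
        by (rule measurable_uncurry[OF Km]) measurable
      have "(\<lambda>x. LINT s|lborel. osign (fst x) s *\<^sub>R (cis ((fst x - s) * kp_symbol \<alpha> (snd x)) * (\<i> * of_real (fst (snd x))) * K s (snd x)))
         \<in> borel_measurable (borel \<Otimes>\<^sub>M borel)"
        by measurable
      then show ?thesis unfolding pS duhamel_def case_prod_unfold .
    qed
    have supp: "norm \<zeta> \<le> (real n + 1) * R" if "p n t \<zeta> \<noteq> 0" for t \<zeta>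
    proof (rule ccontr)
      assume *: "\<not> norm \<zeta> \<le> (real n + 1) * R"
      have "K s \<zeta> = 0" for s using Ks[of s \<zeta>] * Suc by (auto simp: algebra_simps)
      then have "p n t \<zeta> = 0" unfolding pS duhamel_def by simp
      with that show False by simp
    qed
    have bound: "norm (p n t \<zeta>) \<le> A * B ^ n * \<bar>t\<bar> ^ n / (real n + 1)\<^sup>2 * decay \<zeta>" for t \<zeta>
    proof (cases "norm \<zeta> \<le> (real k + 2) * R")
      case False
      then have "p n t \<zeta> = 0" using supp[of t \<zeta>] Suc by (auto simp: algebra_simps)
      then show ?thesis
        by (auto intro!: divide_nonneg_nonneg mult_nonneg_nonneg A_nonneg B_nonneg zero_le_power decay_nonneg)
    next
      case True
      define M where "M = (real k + 2) * R * (A\<^sup>2 * B ^ k * conv_const * 8 / (real k + 2)\<^sup>2 * decay \<zeta>)"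
      have M: "0 \<le> M" unfolding M_def
        by (intro divide_nonneg_nonneg mult_nonneg_nonneg R_nonneg A_nonneg B_nonneg zero_le_power decay_nonneg less_imp_le[OF conv_const(1)]) auto
      have "\<bar>fst \<zeta>\<bar> \<le> norm \<zeta>" by (metis norm_fst_le prod.collapse real_norm_def)
      with True have x: "\<bar>fst \<zeta>\<bar> \<le> (real k + 2) * R" by linarith
      have "norm (p n t \<zeta>) \<le> M * (\<bar>t\<bar> ^ Suc k / Suc k)"
        unfolding pS duhamel_def
      proof (rule norm_osign_integral_le(1)[OF _ M])
        fix s
        have "\<bar>fst \<zeta>\<bar> * norm (K s \<zeta>) \<le> ((real k + 2) * R) * (A\<^sup>2 * B ^ k * conv_const * 8 / (real k + 2)\<^sup>2 * decay \<zeta> * \<bar>s\<bar> ^ k)"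
          by (intro mult_mono x Kb) (auto simp: R_nonneg)
        then show "norm (cis ((t - s) * kp_symbol \<alpha> \<zeta>) * (\<i> * of_real (fst \<zeta>)) * K s \<zeta>) \<le> M * \<bar>s\<bar> ^ k"
          by (simp add: norm_mult M_def mult_ac)
      qed
      also have "\<dots> = A * (8 * A * conv_const * R) * B ^ k * ((real k + 2) / (real k + 1)) * \<bar>t\<bar> ^ Suc k / (real k + 2)\<^sup>2 * decay \<zeta>"
        by (simp add: M_def power2_eq_square field_simps)
      also have "\<dots> \<le> A * (8 * A * conv_const * R) * B ^ k * 2 * \<bar>t\<bar> ^ Suc k / (real k + 2)\<^sup>2 * decay \<zeta>"
        by (intro mult_right_mono divide_right_mono mult_left_mono mult_nonneg_nonneg A_nonneg B_nonneg R_nonneg zero_le_power decay_nonneg less_imp_le[OF conv_const(1)])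
           (auto simp: divide_le_eq A_nonneg)
      also have "\<dots> = A * B ^ n * \<bar>t\<bar> ^ n / (real n + 1)\<^sup>2 * decay \<zeta>"
        by (simp add: Suc B_def add.commute mult_ac)
      finally show ?thesis .
    qed
    show ?thesis using m bound supp by blast
  qed
qed

end

subsection \<open>Products and distributions given by functions\<close>

text \<open>The growth factor allowed beside \<open>decay\<close> leaves room for the multiplier of
  \<open>deriv_x\<close>.\<close>

lemma tempered_of_le_decay:
  assumes [measurable]: "k \<in> borel_measurable borel"
    and k: "\<And>\<zeta>. norm (k \<zeta>) \<le> C * (1 + (norm \<zeta>)\<^sup>2) * decay \<zeta>"
  shows "tempered_fun k"
  unfolding tempered_fun_def
proof (intro conjI ballI)
  fix \<psi> :: "pt \<Rightarrow> complex" assume psi: "\<psi> \<in> schwartz"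
  note [measurable] = schwartz_measurable[OF psi]
  obtain D where D: "D \<ge> 0" "\<And>z. norm (\<psi> z) * (1 + (norm z)\<^sup>2) ^ 1 \<le> D"
    using schwartz_bound[OF psi, of 1] by blast
  have C0: "0 \<le> C" using order_trans[OF norm_ge_zero k[of 0]] decay_pos[of 0] by (simp add: zero_le_mult_iff)
  show "integrable lborel (\<lambda>z. k z * \<psi> z)"
  proof (rule integrable_of_le_decay)
    fix z
    have "norm (k z) * norm (\<psi> z) \<le> (C * (1 + (norm z)\<^sup>2) * decay z) * norm (\<psi> z)"
      by (rule mult_right_mono[OF k]) simp
    also have "\<dots> = (C * decay z) * (norm (\<psi> z) * (1 + (norm z)\<^sup>2) ^ 1)" by simp
    also have "\<dots> \<le> (C * decay z) * D" by (intro mult_left_mono D mult_nonneg_nonneg C0 decay_nonneg)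
    finally show "norm (k z * \<psi> z) \<le> (C * D) * decay z" by (simp add: norm_mult mult_ac)
  qed measurable
qed (rule assms)

lemma tempered_of_le_decay':
  assumes "k \<in> borel_measurable borel" and k: "\<And>\<zeta>. norm (k \<zeta>) \<le> C * decay \<zeta>"
  shows "tempered_fun k"
proof (rule tempered_of_le_decay[OF assms(1)])
  fix \<zeta>
  have C0: "0 \<le> C" using order_trans[OF norm_ge_zero k[of 0]] decay_pos[of 0] by (simp add: zero_le_mult_iff)
  have "C * decay \<zeta> * 1 \<le> C * decay \<zeta> * (1 + (norm \<zeta>)\<^sup>2)"
    by (intro mult_left_mono mult_nonneg_nonneg C0 decay_nonneg) simp
  with k[of \<zeta>] show "norm (k \<zeta>) \<le> C * (1 + (norm \<zeta>)\<^sup>2) * decay \<zeta>" by (simp add: mult_ac)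
qed

lemma tempered_of_bounded:
  assumes [measurable]: "w \<in> borel_measurable borel" and w: "\<And>z. norm (w z) \<le> C"
  shows "tempered_fun w"
  unfolding tempered_fun_def
proof (intro conjI ballI)
  fix \<psi> :: "pt \<Rightarrow> complex" assume psi: "\<psi> \<in> schwartz"
  note [measurable] = schwartz_measurable[OF psi]
  have C0: "0 \<le> C" using order_trans[OF norm_ge_zero w[of 0]] .
  have "integrable lborel (\<lambda>z. of_real C * \<psi> z)" by (intro integrable_mult_right schwartz_integrable psi)
  then show "integrable lborel (\<lambda>z. w z * \<psi> z)"
    by (rule Bochner_Integration.integrable_bound)
       (auto simp: norm_mult C0 intro!: AE_I2 mult_right_mono w)
qed (rule assms)

lemma dist_of_inv_fourier:
  assumes g: "integrable lborel g"
  shows "dist_of (inv_fourier g) = inv_fourier_dist g"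
proof
  fix \<psi> :: "pt \<Rightarrow> complex"
  show "dist_of (inv_fourier g) \<psi> = inv_fourier_dist g \<psi>"
  proof (cases "\<psi> \<in> schwartz")
    case True
    have [measurable]: "g \<in> borel_measurable borel" "\<psi> \<in> borel_measurable borel"
      using borel_measurable_integrable[OF g] schwartz_measurable[OF True] by simp_all
    let ?c = "complex_of_real ((2 * pi) ^ 3)"
    have int: "integrable (lborel \<Otimes>\<^sub>M lborel) (\<lambda>(z, \<zeta>). cis (z \<bullet> \<zeta>) * g \<zeta> * \<psi> z)"
    proof (rule Bochner_Integration.integrable_bound)
      show "integrable (lborel \<Otimes>\<^sub>M lborel) (\<lambda>(z, \<zeta>). \<psi> z * g \<zeta>)"
        by (rule integrable_pair_mult[OF schwartz_integrable[OF True] g])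
    qed (auto simp: norm_mult)
    have "(LINT z|lborel. (LINT \<zeta>|lborel. cis (\<zeta> \<bullet> z) * g \<zeta>) * \<psi> z) = (LINT z|lborel. LINT \<zeta>|lborel. cis (z \<bullet> \<zeta>) * g \<zeta> * \<psi> z)"
      by (simp add: inner_commute)
    also have "\<dots> = (LINT \<zeta>|lborel. LINT z|lborel. cis (z \<bullet> \<zeta>) * g \<zeta> * \<psi> z)"
      by (rule lborel_pair.Fubini_integral[OF int, symmetric])
    also have "\<dots> = (LINT \<zeta>|lborel. g \<zeta> * (LINT z|lborel. cis (z \<bullet> \<zeta>) * \<psi> z))"
    proof (rule Bochner_Integration.integral_cong)
      fix \<zeta>
      have "(LINT z|lborel. cis (z \<bullet> \<zeta>) * g \<zeta> * \<psi> z) = (LINT z|lborel. g \<zeta> * (cis (z \<bullet> \<zeta>) * \<psi> z))"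
        by (rule Bochner_Integration.integral_cong) simp_all
      then show "(LINT z|lborel. cis (z \<bullet> \<zeta>) * g \<zeta> * \<psi> z) = g \<zeta> * (LINT z|lborel. cis (z \<bullet> \<zeta>) * \<psi> z)" by simp
    qed simp
    finally have "(LINT z|lborel. (LINT \<zeta>|lborel. cis (\<zeta> \<bullet> z) * g \<zeta>) * \<psi> z) / ?c = (LINT \<zeta>|lborel. g \<zeta> * (LINT z|lborel. cis (z \<bullet> \<zeta>) * \<psi> z)) / ?c"
      by simp
    then show ?thesis using True by (simp add: dist_of_def inv_fourier_dist_def inv_fourier_def)
  qed (simp add: dist_of_def inv_fourier_dist_def)
qed

lemma inv_fourier_fconv:
  assumes g: "integrable lborel g" and h: "integrable lborel h"
  shows "inv_fourier (fconv g h) x = inv_fourier g x * inv_fourier h x"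
proof -
  let ?c = "complex_of_real ((2 * pi) ^ 3)"
  have [measurable]: "g \<in> borel_measurable borel" "h \<in> borel_measurable borel"
    using borel_measurable_integrable[OF g] borel_measurable_integrable[OF h] by simp_all
  have inner: "(LINT \<zeta>|lborel. cis (\<zeta> \<bullet> x) * (g z * h (\<zeta> - z))) = (cis (z \<bullet> x) * g z) * (LINT \<zeta>|lborel. cis (\<zeta> \<bullet> x) * h \<zeta>)" for z
  proof -
    have "(LINT \<zeta>|lborel. cis (\<zeta> \<bullet> x) * (g z * h (\<zeta> - z))) = (LINT \<zeta>|lborel. cis ((\<zeta> + z) \<bullet> x) * (g z * h ((\<zeta> + z) - z)))"
      by (rule lborel_integral_shift(1)[symmetric]) measurable
    also have "\<dots> = (LINT \<zeta>|lborel. (cis (z \<bullet> x) * g z) * (cis (\<zeta> \<bullet> x) * h \<zeta>))"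
      by (rule Bochner_Integration.integral_cong) (simp_all add: inner_add_left cis_mult[symmetric])
    finally show ?thesis by simp
  qed
  have int: "integrable (lborel \<Otimes>\<^sub>M lborel) (\<lambda>(z, \<zeta>). cis (\<zeta> \<bullet> x) * (g z * h (\<zeta> - z)))"
  proof (rule lborel_pair.Fubini_integrable)
    show "(\<lambda>(z, \<zeta>). cis (\<zeta> \<bullet> x) * (g z * h (\<zeta> - z))) \<in> borel_measurable (lborel \<Otimes>\<^sub>M lborel)"
      by measurable
    have hz: "integrable lborel (\<lambda>\<zeta>. h (\<zeta> - z))" for z
      using lborel_integral_shift(2)[OF _ h, of "- z"] by simp
    have eq: "(LINT \<zeta>|lborel. norm (h (\<zeta> - z))) = (LINT \<zeta>|lborel. norm (h \<zeta>))" for z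
      using lborel_integral_shift(1)[of "\<lambda>\<zeta>. norm (h \<zeta>)" "- z"] by simp
    show "integrable lborel (\<lambda>z. LINT \<zeta>|lborel. norm (case (z, \<zeta>) of (z, \<zeta>) \<Rightarrow> cis (\<zeta> \<bullet> x) * (g z * h (\<zeta> - z))))"
      using g by (simp add: norm_mult eq)
    show "AE z in lborel. integrable lborel (\<lambda>\<zeta>. case (z, \<zeta>) of (z, \<zeta>) \<Rightarrow> cis (\<zeta> \<bullet> x) * (g z * h (\<zeta> - z)))"
      using integrable_cis_mult[OF integrable_mult_right[OF hz]] by simp
  qed
  have "(LINT \<zeta>|lborel. cis (\<zeta> \<bullet> x) * (LINT z|lborel. g z * h (\<zeta> - z))) = (LINT \<zeta>|lborel. LINT z|lborel. cis (\<zeta> \<bullet> x) * (g z * h (\<zeta> - z)))"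
    by simp
  also have "\<dots> = (LINT z|lborel. LINT \<zeta>|lborel. cis (\<zeta> \<bullet> x) * (g z * h (\<zeta> - z)))"
    by (rule lborel_pair.Fubini_integral[OF int])
  also have "\<dots> = (LINT z|lborel. cis (z \<bullet> x) * g z) * (LINT \<zeta>|lborel. cis (\<zeta> \<bullet> x) * h \<zeta>)"
    by (simp only: inner integral_mult_left_zero)
  finally show ?thesis unfolding inv_fourier_def fconv_def by simp
qed

lemma is_square_inv_fourier_dist:
  assumes g: "integrable lborel g" and k: "integrable lborel (fconv g g)"
  shows "is_square (inv_fourier_dist g) (inv_fourier_dist (fconv g g))"
proof -
  have [measurable]: "g \<in> borel_measurable borel"
    using borel_measurable_integrable[OF g] by simp
  let ?w = "inv_fourier g" and ?C = "LINT z|lborel. norm (g z)"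
  have b: "norm (?w z) \<le> ?C" for z by (rule norm_inv_fourier_le[OF g])
  have sq: "(\<lambda>z. (?w z)\<^sup>2) = inv_fourier (fconv g g)"
    by (rule ext) (simp add: inv_fourier_fconv[OF g g] power2_eq_square)
  show ?thesis unfolding is_square_def
  proof (intro exI[of _ ?w] conjI)
    show "tempered_fun ?w" by (rule tempered_of_bounded[OF _ b]) measurable
    show "tempered_fun (\<lambda>z. (?w z)\<^sup>2)"
    proof (rule tempered_of_bounded)
      show "norm ((?w z)\<^sup>2) \<le> ?C\<^sup>2" for z unfolding norm_power by (rule power_mono[OF b]) simp
    qed measurable
    show "inv_fourier_dist g = dist_of ?w" by (simp add: dist_of_inv_fourier[OF g])
    show "inv_fourier_dist (fconv g g) = dist_of (\<lambda>z. (?w z)\<^sup>2)" unfolding sq by (simp add: dist_of_inv_fourier[OF k])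
  qed
qed

subsection \<open>Summing the series\<close>

lemma summable_geometric_poly: "summable (\<lambda>n. (1/2) ^ n * (1 + ((real n + 1) * R)\<^sup>2) ^ m)"
proof -
  \<comment> \<open>With this \<open>c\<close> a polynomial in \<open>n\<close> is at most a
    constant times (3/2)^n, and 1/2 times 3/2 is still below 1.\<close>
  define c where "c = ln (3/2::real)"
  have c: "c > 0" "exp c = 3/2" by (simp_all add: c_def)
  have le: "(1/2) ^ n * (1 + ((real n + 1) * R)\<^sup>2) ^ m \<le> ((1 + R\<^sup>2) ^ m * (fact (2 * m) / c ^ (2 * m)) * (3/2)) * (3/4) ^ n" for n
  proof -
    have "1 + ((real n + 1) * R)\<^sup>2 \<le> (1 + R\<^sup>2) * (real n + 1)\<^sup>2"
      by (simp add: power_mult_distrib algebra_simps power2_eq_square)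
    then have "(1 + ((real n + 1) * R)\<^sup>2) ^ m \<le> ((1 + R\<^sup>2) * (real n + 1)\<^sup>2) ^ m"
      by (rule power_mono) simp
    also have "\<dots> = (1 + R\<^sup>2) ^ m * (real n + 1) ^ (2 * m)"
      by (simp add: power_mult_distrib power_mult)
    also have "(real n + 1) ^ (2 * m) \<le> fact (2 * m) / c ^ (2 * m) * (3/2) ^ (n + 1)"
    proof -
      have "(c * (real n + 1)) ^ (2 * m) \<le> fact (2 * m) * exp (c * (real n + 1))"
        by (rule power_le_fact_times_exp) (use c in simp)
      also have "exp (c * (real n + 1)) = (3/2) ^ (n + 1)"
        using exp_of_nat_mult[of "n + 1" c] c(2) by (simp add: mult.commute add.commute)
      finally show ?thesis using c by (simp only: power_mult_distrib) (simp add: field_simps)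
    qed
    finally have "(1 + ((real n + 1) * R)\<^sup>2) ^ m \<le> (1 + R\<^sup>2) ^ m * (fact (2 * m) / c ^ (2 * m) * (3/2) ^ (n + 1))"
      by (simp add: mult_left_mono)
    then have "(1/2) ^ n * (1 + ((real n + 1) * R)\<^sup>2) ^ m \<le> (1/2) ^ n * ((1 + R\<^sup>2) ^ m * (fact (2 * m) / c ^ (2 * m) * (3/2) ^ (n + 1)))"
      by (rule mult_left_mono) simp
    also have "\<dots> = ((1 + R\<^sup>2) ^ m * (fact (2 * m) / c ^ (2 * m)) * (3/2)) * ((1/2) ^ n * (3/2) ^ n)"
      by (simp add: mult_ac)
    also have "(1/2::real) ^ n * (3/2) ^ n = (3/4) ^ n" by (simp add: power_mult_distrib[symmetric])
    finally show ?thesis .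
  qed
  show ?thesis
  proof (rule summable_comparison_test'[where N = 0])
    show "summable (\<lambda>n. ((1 + R\<^sup>2) ^ m * (fact (2 * m) / c ^ (2 * m)) * (3/2)) * (3/4::real) ^ n)"
      by (intro summable_mult summable_geometric) simp
    show "norm ((1/2) ^ n * (1 + ((real n + 1) * R)\<^sup>2) ^ m) \<le> ((1 + R\<^sup>2) ^ m * (fact (2 * m) / c ^ (2 * m)) * (3/2)) * (3/4) ^ n" for n
      using le[of n] by (simp add: abs_mult)
  qed
qed

lemma summable_linear_geometric: "summable (\<lambda>n. (real n + 1) * (1/2) ^ n)"
proof (rule summable_comparison_test'[where N = 0])
  show "summable (\<lambda>n. (1/2) ^ n * (1 + ((real n + 1) * 1)\<^sup>2) ^ 1)" by (rule summable_geometric_poly)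
  fix n :: nat
  have "(real n + 1) \<le> 1 + ((real n + 1) * 1)\<^sup>2"
    by (simp add: power2_eq_square algebra_simps)
  from mult_left_mono[OF this, of "(1/2) ^ n"]
  show "norm ((real n + 1) * (1/2) ^ n) \<le> (1/2) ^ n * (1 + ((real n + 1) * 1)\<^sup>2) ^ 1"
    by (simp add: mult.commute)
qed

context kp_data
begin

lemmas p_measurable_pair = picard_estimates[THEN conjunct1]
lemmas p_bound = picard_estimates[THEN conjunct2, THEN conjunct1, rule_format]
lemmas p_support = picard_estimates[THEN conjunct2, THEN conjunct2, rule_format]

lemma p_measurable [measurable]: "p n t \<in> borel_measurable borel"
  using measurable_uncurry[OF p_measurable_pair[of n], of "\<lambda>_. t" borel "\<lambda>x. x"] by simp

definition sol :: "real \<Rightarrow> real \<Rightarrow> pt \<Rightarrow> complex" where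
  "sol e t \<zeta> = (\<Sum>n. of_real (e ^ Suc n) * p n t \<zeta>)"

lemma sol_measurable_pair: "case_prod (sol e) \<in> borel_measurable (borel \<Otimes>\<^sub>M borel)"
proof -
  have [measurable]: "(\<lambda>x. p n (fst x) (snd x)) \<in> borel_measurable (borel \<Otimes>\<^sub>M borel)" for n
    using p_measurable_pair[of n] by (simp add: case_prod_unfold)
  show ?thesis unfolding sol_def case_prod_unfold by measurable
qed

lemma sol_measurable [measurable]: "sol e t \<in> borel_measurable borel"
  using measurable_uncurry[OF sol_measurable_pair[of e], of "\<lambda>_. t" borel "\<lambda>x. x"] by simp

text \<open>The time \<open>T\<close> is given and may be large, so smallness is imposed on the
  amplitude: the series then has ratio at most 1/2 on all of [-T,T].\<close>

context
  fixes e T :: real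
  assumes small: "\<bar>e\<bar> * (B * T) \<le> 1/2" and T: "0 < T"
begin

lemma sol_term_le:
  assumes t: "\<bar>t\<bar> \<le> T"
  shows "norm (of_real (e ^ Suc n) * p n t \<zeta>) \<le> \<bar>e\<bar> * A * (1/2) ^ n * decay \<zeta>"
proof -
  have "norm (of_real (e ^ Suc n) * p n t \<zeta>) = \<bar>e\<bar> ^ Suc n * norm (p n t \<zeta>)"
    by (simp add: norm_mult norm_power)
  also have "\<dots> \<le> \<bar>e\<bar> ^ Suc n * (A * B ^ n * \<bar>t\<bar> ^ n / (real n + 1)\<^sup>2 * decay \<zeta>)"
    by (rule mult_left_mono[OF p_bound]) simp
  also have "A * B ^ n * \<bar>t\<bar> ^ n / (real n + 1)\<^sup>2 \<le> A * B ^ n * T ^ n / 1"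
    by (intro frac_le mult_left_mono power_mono t mult_nonneg_nonneg A_nonneg zero_le_power B_nonneg)
       (use T in \<open>auto simp: one_le_power\<close>)
  also have "\<bar>e\<bar> ^ Suc n * (A * B ^ n * T ^ n / 1 * decay \<zeta>) = \<bar>e\<bar> * A * (\<bar>e\<bar> * (B * T)) ^ n * decay \<zeta>"
    by (simp add: power_mult_distrib mult_ac)
  also have "\<dots> \<le> \<bar>e\<bar> * A * (1/2) ^ n * decay \<zeta>"
    by (intro mult_right_mono mult_left_mono power_mono small mult_nonneg_nonneg A_nonneg B_nonneg decay_nonneg)
       (use T in auto)
  finally show ?thesis by (simp add: mult_left_mono mult_right_mono decay_nonneg)
qed

lemma summable_bound: "summable (\<lambda>n. \<bar>e\<bar> * A * (1/2) ^ n * decay \<zeta>)"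
  "(\<Sum>n. \<bar>e\<bar> * A * (1/2) ^ n * decay \<zeta>) = 2 * \<bar>e\<bar> * A * decay \<zeta>"
proof -
  have "(\<lambda>n. (1/2::real) ^ n) sums 2" using geometric_sums[of "1/2::real"] by simp
  then have "(\<lambda>n. \<bar>e\<bar> * A * (1/2) ^ n * decay \<zeta>) sums (\<bar>e\<bar> * A * 2 * decay \<zeta>)"
    by (intro sums_mult sums_mult2)
  then show "summable (\<lambda>n. \<bar>e\<bar> * A * (1/2) ^ n * decay \<zeta>)"
    "(\<Sum>n. \<bar>e\<bar> * A * (1/2) ^ n * decay \<zeta>) = 2 * \<bar>e\<bar> * A * decay \<zeta>"
    by (simp_all add: sums_iff mult_ac)
qed

lemma sol_summable_norm:
  assumes t: "\<bar>t\<bar> \<le> T"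
  shows "summable (\<lambda>n. norm (of_real (e ^ Suc n) * p n t \<zeta>))"
  by (rule summable_comparison_test'[OF summable_bound(1), of 0]) (use sol_term_le[OF t] in simp)

lemma sol_sums:
  assumes t: "\<bar>t\<bar> \<le> T"
  shows "(\<lambda>n. of_real (e ^ Suc n) * p n t \<zeta>) sums sol e t \<zeta>"
  unfolding sol_def by (rule summable_sums[OF summable_norm_cancel[OF sol_summable_norm[OF t]]])

lemma sol_bound:
  assumes t: "\<bar>t\<bar> \<le> T"
  shows "norm (sol e t \<zeta>) \<le> 2 * \<bar>e\<bar> * A * decay \<zeta>"
proof -
  have "norm (sol e t \<zeta>) \<le> (\<Sum>n. norm (of_real (e ^ Suc n) * p n t \<zeta>))"
    unfolding sol_def by (rule summable_norm[OF sol_summable_norm[OF t]])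
  also have "\<dots> \<le> (\<Sum>n. \<bar>e\<bar> * A * (1/2) ^ n * decay \<zeta>)"
    by (rule suminf_le[OF sol_term_le[OF t] sol_summable_norm[OF t] summable_bound(1)])
  finally show ?thesis by (simp add: summable_bound(2))
qed

text \<open>The \<open>n\<close>-th term lives on |\<zeta>| \<le> (n + 1) R, where the weight is
  polynomial in \<open>n\<close>, while the term itself is of order 2^(-n). Hence the sum decreases
  rapidly, uniformly in time, although its support need not be bounded.\<close>

lemma sol_weighted_bound: "\<exists>C. \<forall>t \<zeta>. \<bar>t\<bar> \<le> T \<longrightarrow> norm (sol e t \<zeta>) * (1 + (norm \<zeta>)\<^sup>2) ^ m \<le> C"
proof (intro exI allI impI)
  let ?b = "\<lambda>n. (\<bar>e\<bar> * A) * ((1/2) ^ n * (1 + ((real n + 1) * R)\<^sup>2) ^ m)"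
  fix t and \<zeta> :: pt assume t: "\<bar>t\<bar> \<le> T"
  let ?W = "(1 + (norm \<zeta>)\<^sup>2) ^ m"
  have sb: "summable ?b" by (rule summable_mult[OF summable_geometric_poly])
  have le: "norm (of_real (e ^ Suc n) * p n t \<zeta>) * ?W \<le> ?b n" for n
  proof (cases "p n t \<zeta> = 0")
    case True
    then show ?thesis by (simp add: A_nonneg)
  next
    case False
    have "norm (of_real (e ^ Suc n) * p n t \<zeta>) \<le> \<bar>e\<bar> * A * (1/2) ^ n * 1"
      by (rule order_trans[OF sol_term_le[OF t]]) (intro mult_left_mono decay_le_1 mult_nonneg_nonneg A_nonneg, auto)
    moreover have "?W \<le> (1 + ((real n + 1) * R)\<^sup>2) ^ m"
      by (intro power_mono add_left_mono p_support[OF False]) auto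
    ultimately have "norm (of_real (e ^ Suc n) * p n t \<zeta>) * ?W \<le> (\<bar>e\<bar> * A * (1/2) ^ n * 1) * (1 + ((real n + 1) * R)\<^sup>2) ^ m"
      by (intro mult_mono) (auto simp: A_nonneg)
    then show ?thesis by (simp add: mult_ac)
  qed
  have s1: "summable (\<lambda>n. norm (of_real (e ^ Suc n) * p n t \<zeta>) * ?W)"
    by (rule summable_mult2[OF sol_summable_norm[OF t]])
  have "norm (sol e t \<zeta>) * ?W \<le> (\<Sum>n. norm (of_real (e ^ Suc n) * p n t \<zeta>)) * ?W"
    unfolding sol_def by (rule mult_right_mono[OF summable_norm[OF sol_summable_norm[OF t]]]) simp
  also have "\<dots> = (\<Sum>n. norm (of_real (e ^ Suc n) * p n t \<zeta>) * ?W)"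
    by (rule suminf_mult2[OF sol_summable_norm[OF t]])
  also have "\<dots> \<le> (\<Sum>n. ?b n)" by (rule suminf_le[OF le s1 sb])
  finally show "norm (sol e t \<zeta>) * ?W \<le> (\<Sum>n. ?b n)" .
qed

text \<open>The Cauchy product under the convolution integral. The majorant (n + 1) 2^(-n) of the
  second claim is summable and later justifies exchanging the sum with the time integral.\<close>

lemma fconv_sol_sums:
  assumes s: "\<bar>s\<bar> \<le> T"
  shows "(\<lambda>n. of_real (e ^ (n + 2)) * (\<Sum>i\<le>n. fconv (p i s) (p (n - i) s) \<zeta>)) sums fconv (sol e s) (sol e s) \<zeta>"
    and "norm (of_real (e ^ (n + 2)) * (\<Sum>i\<le>n. fconv (p i s) (p (n - i) s) \<zeta>)) \<le> ((\<bar>e\<bar> * A)\<^sup>2 * conv_const * decay \<zeta>) * ((real n + 1) * (1/2) ^ n)"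
proof -
  let ?a = "\<lambda>i z. of_real (e ^ Suc i) * p i s z"
  define F where "F n z = (\<Sum>i\<le>n. ?a i z * ?a (n - i) (\<zeta> - z))" for n z
  define M where "M n = (\<bar>e\<bar> * A)\<^sup>2 * ((real n + 1) * (1/2) ^ n)" for n
  have M0: "0 \<le> M n" for n by (simp add: M_def)
  have tb: "norm (?a i z * ?a (n - i) (\<zeta> - z)) \<le> (\<bar>e\<bar> * A)\<^sup>2 * (1/2) ^ n * (decay z * decay (\<zeta> - z))" if "i \<le> n" for i n z
  proof -
    have "norm (?a i z * ?a (n - i) (\<zeta> - z)) \<le> (\<bar>e\<bar> * A * (1/2) ^ i * decay z) * (\<bar>e\<bar> * A * (1/2) ^ (n - i) * decay (\<zeta> - z))"
      unfolding norm_mult[of "?a i z"]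
      by (intro mult_mono sol_term_le[OF s] mult_nonneg_nonneg A_nonneg decay_nonneg) auto
    also have "\<dots> = (\<bar>e\<bar> * A)\<^sup>2 * ((1/2) ^ i * (1/2) ^ (n - i)) * (decay z * decay (\<zeta> - z))"
      by (simp add: power2_eq_square mult_ac)
    also have "(1/2::real) ^ i * (1/2) ^ (n - i) = (1/2) ^ n"
      using that by (simp only: power_add[symmetric] le_add_diff_inverse)
    finally show ?thesis .
  qed
  have Fb: "norm (F n z) \<le> M n * (decay z * decay (\<zeta> - z))" for n z
  proof -
    have "norm (F n z) \<le> (\<Sum>i\<le>n. (\<bar>e\<bar> * A)\<^sup>2 * (1/2) ^ n * (decay z * decay (\<zeta> - z)))"
      unfolding F_def by (intro sum_norm_le tb) simp
    then show ?thesis by (simp add: M_def mult_ac add.commute)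
  qed
  have [measurable]: "F n \<in> borel_measurable borel" for n unfolding F_def by measurable
  have Fi: "integrable lborel (F n)" for n by (rule integrable_decay_conv_bound[OF Fb M0]) measurable
  have sM: "summable M"
    unfolding M_def by (intro summable_mult summable_linear_geometric)
  have sum1: "summable (\<lambda>n. norm (F n z))" for z
    by (rule summable_comparison_test'[OF summable_mult2[OF sM, of "decay z * decay (\<zeta> - z)"], of 0])
       (use Fb in simp)
  have sum2: "summable (\<lambda>n. LINT z|lborel. norm (F n z))"
    by (rule summable_comparison_test'[OF summable_mult2[OF sM, of "conv_const * decay \<zeta>"], of 0])
       (use norm_decay_conv_le(2)[OF Fb M0] in simp)
  have "(\<lambda>n. LINT z|lborel. F n z) sums (LINT z|lborel. (\<Sum>n. F n z))"
    by (rule sums_integral[OF Fi _ sum2]) (use sum1 in simp)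
  moreover have "(\<Sum>n. F n z) = sol e s z * sol e s (\<zeta> - z)" for z
    unfolding F_def sol_def
    by (rule Cauchy_product[OF sol_summable_norm[OF s] sol_summable_norm[OF s], symmetric])
  ultimately have 1: "(\<lambda>n. (LINT z|lborel. F n z) / of_real ((2 * pi) ^ 3)) sums fconv (sol e s) (sol e s) \<zeta>"
    unfolding fconv_def by (intro sums_divide) simp
  have eq: "(LINT z|lborel. F n z) / of_real ((2 * pi) ^ 3) = of_real (e ^ (n + 2)) * (\<Sum>i\<le>n. fconv (p i s) (p (n - i) s) \<zeta>)" for n
  proof -
    have i: "integrable lborel (\<lambda>z. ?a i z * ?a (n - i) (\<zeta> - z))" if "i \<le> n" for i
      by (rule integrable_decay_conv_bound[OF tb[OF that]]) auto
    have "(LINT z|lborel. F n z) = (\<Sum>i\<le>n. LINT z|lborel. ?a i z * ?a (n - i) (\<zeta> - z))"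
      unfolding F_def by (rule Bochner_Integration.integral_sum) (use i in simp)
    also have "\<dots> = (\<Sum>i\<le>n. of_real (e ^ (n + 2)) * (LINT z|lborel. p i s z * p (n - i) s (\<zeta> - z)))"
    proof (rule sum.cong)
      fix i assume "i \<in> {..n}"
      then have "Suc i + Suc (n - i) = n + 2" by simp
      then have "complex_of_real (e ^ Suc i) * of_real (e ^ Suc (n - i)) = of_real (e ^ (n + 2))"
        by (simp only: of_real_mult[symmetric] power_add[symmetric])
      moreover have "?a i z * ?a (n - i) (\<zeta> - z) = (complex_of_real (e ^ Suc i) * of_real (e ^ Suc (n - i))) * (p i s z * p (n - i) s (\<zeta> - z))" for z
        by (simp only: mult_ac)
      ultimately have "?a i z * ?a (n - i) (\<zeta> - z) = of_real (e ^ (n + 2)) * (p i s z * p (n - i) s (\<zeta> - z))" for z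
        by (simp only:)
      then show "(LINT z|lborel. ?a i z * ?a (n - i) (\<zeta> - z)) = of_real (e ^ (n + 2)) * (LINT z|lborel. p i s z * p (n - i) s (\<zeta> - z))"
        by (simp only: integral_mult_right_zero)
    qed simp
    finally show ?thesis unfolding fconv_def
      by (simp only: sum_distrib_left[symmetric] sum_divide_distrib[symmetric] times_divide_eq_right)
  qed
  show "(\<lambda>n. of_real (e ^ (n + 2)) * (\<Sum>i\<le>n. fconv (p i s) (p (n - i) s) \<zeta>)) sums fconv (sol e s) (sol e s) \<zeta>"
    using 1 unfolding eq .
  have "norm ((LINT z|lborel. F n z) / of_real ((2 * pi) ^ 3)) \<le> norm (LINT z|lborel. F n z)"
    using two_pi_cube_ge_1 by (simp add: norm_divide norm_power divide_le_eq mult_le_cancel_left1)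
  also have "\<dots> \<le> M n * (conv_const * decay \<zeta>)" by (rule norm_decay_conv_le(1)[OF Fb M0])
  finally show "norm (of_real (e ^ (n + 2)) * (\<Sum>i\<le>n. fconv (p i s) (p (n - i) s) \<zeta>)) \<le> ((\<bar>e\<bar> * A)\<^sup>2 * conv_const * decay \<zeta>) * ((real n + 1) * (1/2) ^ n)"
    unfolding eq by (simp add: M_def mult_ac)
qed

lemma fconv_sol_bound:
  assumes s: "\<bar>s\<bar> \<le> T"
  shows "norm (fconv (sol e s) (sol e s) \<zeta>) \<le> (2 * \<bar>e\<bar> * A) * (2 * \<bar>e\<bar> * A) * conv_const * decay \<zeta>"
  by (rule norm_fconv_le[OF sol_bound[OF s] sol_bound[OF s]]) (auto simp: A_nonneg)

end

end

subsection \<open>The series solves Duhamel's formula\<close>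

context kp_data
begin

context
  fixes e T :: real
  assumes small: "\<bar>e\<bar> * (B * T) \<le> 1/2" and T: "0 < T"
begin

lemmas fconv_sol_bound' = fconv_sol_bound[OF small T]

lemma fconv_sol_measurable_pair:
  "(\<lambda>(s, \<zeta>). fconv (sol e s) (sol e s) \<zeta>) \<in> borel_measurable (borel \<Otimes>\<^sub>M borel)"
  by (rule fconv_measurable_pair[OF sol_measurable_pair sol_measurable_pair])

lemma fconv_sol_measurable [measurable]: "fconv (sol e s) (sol e s) \<in> borel_measurable borel"
  using measurable_uncurry[of "\<lambda>s. fconv (sol e s) (sol e s)" borel borel "\<lambda>_. s" borel "\<lambda>x. x"] fconv_sol_measurable_pair
  by simp

lemma fconv_sol_measurable_time: "(\<lambda>s. fconv (sol e s) (sol e s) \<zeta>) \<in> borel_measurable borel"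
  using measurable_uncurry[of "\<lambda>s. fconv (sol e s) (sol e s)" borel borel "\<lambda>s. s" borel "\<lambda>_. \<zeta>"] fconv_sol_measurable_pair
  by simp

lemma osign_nonzero_le: "\<bar>t\<bar> \<le> T \<Longrightarrow> osign t s \<noteq> 0 \<Longrightarrow> \<bar>s\<bar> \<le> T"
  using osign_eq_0[of t T s] by force

text \<open>The recursion for the iterates, multiplied by powers of \<open>e\<close> and summed. The
  indices from 1 on give the Duhamel integral, index 0 the free evolution.\<close>

lemma sol_duhamel:
  assumes t: "\<bar>t\<bar> \<le> T"
  shows "sol e t \<zeta> = of_real e * (cis (t * kp_symbol \<alpha> \<zeta>) * f \<zeta>) + duhamel \<alpha> (\<lambda>s. fconv (sol e s) (sol e s)) t \<zeta>"
proof -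
  define K where "K n s = (\<Sum>i\<le>n. fconv (p i s) (p (n - i) s) \<zeta>)" for n s
  define m where "m s = cis ((t - s) * kp_symbol \<alpha> \<zeta>) * (\<i> * of_real (fst \<zeta>))" for s
  define F where "F n s = osign t s *\<^sub>R (m s * (of_real (e ^ (n + 2)) * K n s))" for n s
  define M where "M n = (\<bar>fst \<zeta>\<bar> * ((\<bar>e\<bar> * A)\<^sup>2 * conv_const * decay \<zeta>)) * ((real n + 1) * (1/2) ^ n)" for n
  have M0: "0 \<le> M n" for n
    unfolding M_def using conv_const(1) decay_nonneg[of \<zeta>] by simp
  have m_meas [measurable]: "m \<in> borel_measurable borel" unfolding m_def by measurable
  have K_meas [measurable]: "K n \<in> borel_measurable borel" for n
    unfolding K_def
  proof (rule borel_measurable_sum)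
    fix i
    show "(\<lambda>s. fconv (p i s) (p (n - i) s) \<zeta>) \<in> borel_measurable borel"
      using measurable_uncurry[of "\<lambda>s. fconv (p i s) (p (n - i) s)" borel borel "\<lambda>s. s" borel "\<lambda>_. \<zeta>"]
        fconv_measurable_pair[OF p_measurable_pair[of i] p_measurable_pair[of "n - i"]] by simp
  qed
  have b: "norm (m s * (of_real (e ^ (n + 2)) * K n s)) \<le> M n * \<bar>s\<bar> ^ 0" if "osign t s \<noteq> 0" for n s
  proof -
    have "norm (of_real (e ^ (n + 2)) * K n s) \<le> ((\<bar>e\<bar> * A)\<^sup>2 * conv_const * decay \<zeta>) * ((real n + 1) * (1/2) ^ n)"
      unfolding K_def by (rule fconv_sol_sums(2)[OF small T osign_nonzero_le[OF t that]])
    from mult_left_mono[OF this, of "\<bar>fst \<zeta>\<bar>"] show ?thesis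
      by (simp add: m_def norm_mult M_def mult_ac)
  qed
  have Fi: "integrable lborel (F n)" for n
    unfolding F_def by (rule norm_osign_integral_le(2)[OF b M0]) measurable
  have Fb: "norm (F n s) \<le> M n * \<bar>osign t s\<bar>" for n s
    using mult_left_mono[OF b[of s n], of "\<bar>osign t s\<bar>"] by (cases "osign t s = 0") (simp_all add: F_def mult_ac)
  have sM: "summable M"
    unfolding M_def by (intro summable_mult summable_linear_geometric)
  have sum1: "summable (\<lambda>n. norm (F n s))" for s
    by (rule summable_comparison_test'[OF summable_mult2[OF sM, of "\<bar>osign t s\<bar>"], of 0]) (use Fb in simp)
  have sum2: "summable (\<lambda>n. LINT s|lborel. norm (F n s))"
  proof (rule summable_comparison_test'[OF summable_mult2[OF sM, of "\<bar>t\<bar>"], of 0])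
    fix n :: nat
    have i: "integrable lborel (\<lambda>s. M n * \<bar>osign t s\<bar>)" using integrable_osign_power[of t 0] by simp
    have "(LINT s|lborel. norm (F n s)) \<le> (LINT s|lborel. M n * \<bar>osign t s\<bar>)"
      by (rule integral_mono'[OF i Fb]) (simp add: M0)
    then show "norm (LINT s|lborel. norm (F n s)) \<le> M n * \<bar>t\<bar>" using integral_osign_power[of t 0] by simp
  qed
  have "(\<lambda>n. LINT s|lborel. F n s) sums (LINT s|lborel. (\<Sum>n. F n s))"
    by (rule sums_integral[OF Fi _ sum2]) (use sum1 in simp)
  moreover have "(\<Sum>n. F n s) = osign t s *\<^sub>R (m s * fconv (sol e s) (sol e s) \<zeta>)" for s
  proof (cases "osign t s = 0")
    case False
    have "(\<lambda>n. osign t s *\<^sub>R (m s * (of_real (e ^ (n + 2)) * K n s))) sums (osign t s *\<^sub>R (m s * fconv (sol e s) (sol e s) \<zeta>))"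
      unfolding K_def by (intro sums_scaleR_right sums_mult fconv_sol_sums(1)[OF small T osign_nonzero_le[OF t False]])
    then show ?thesis unfolding F_def by (rule sums_unique[symmetric])
  qed (simp add: F_def)
  ultimately have 1: "(\<lambda>n. LINT s|lborel. F n s) sums duhamel \<alpha> (\<lambda>s. fconv (sol e s) (sol e s)) t \<zeta>"
    by (simp add: duhamel_def m_def)
  have "(LINT s|lborel. F n s) = of_real (e ^ Suc (Suc n)) * p (Suc n) t \<zeta>" for n
  proof -
    have "(LINT s|lborel. F n s) = (LINT s|lborel. of_real (e ^ (n + 2)) * (osign t s *\<^sub>R (m s * K n s)))"
      by (rule Bochner_Integration.integral_cong) (simp_all add: F_def mult_ac)
    also have "\<dots> = of_real (e ^ (n + 2)) * (LINT s|lborel. osign t s *\<^sub>R (m s * K n s))"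
      by (rule integral_mult_right_zero)
    finally show ?thesis by (simp add: duhamel_def m_def K_def)
  qed
  with 1 have "(\<lambda>n. of_real (e ^ Suc (Suc n)) * p (Suc n) t \<zeta>) sums duhamel \<alpha> (\<lambda>s. fconv (sol e s) (sol e s)) t \<zeta>"
    by (simp del: picard.simps)
  then have "(\<lambda>n. of_real (e ^ Suc n) * p n t \<zeta>) sums (duhamel \<alpha> (\<lambda>s. fconv (sol e s) (sol e s)) t \<zeta> + of_real (e ^ Suc 0) * p 0 t \<zeta>)"
    by (subst (asm) sums_Suc_iff[of "\<lambda>n. of_real (e ^ Suc n) * p n t \<zeta>"]) simp
  from sums_unique2[OF this sol_sums[OF small T t]] show ?thesis by (simp add: add.commute)
qed

text \<open>Continuity in time is read off from Duhamel's formula by dominated convergence: for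
  almost every \<open>s\<close> the value \<open>osign (X k) s\<close> is eventually constant in
  \<open>k\<close>.\<close>

lemma sol_tendsto:
  assumes X: "X \<longlonglongrightarrow> t" "\<And>k. \<bar>X k\<bar> \<le> T" and t: "\<bar>t\<bar> \<le> T"
  shows "(\<lambda>k. sol e (X k) \<zeta>) \<longlonglongrightarrow> sol e t \<zeta>"
proof -
  define Q where "Q s = fconv (sol e s) (sol e s) \<zeta>" for s
  define M where "M = \<bar>fst \<zeta>\<bar> * ((2 * \<bar>e\<bar> * A) * (2 * \<bar>e\<bar> * A) * conv_const * decay \<zeta>)"
  have M0: "0 \<le> M" unfolding M_def using conv_const(1) decay_nonneg[of \<zeta>] A_nonneg by simp
  have [measurable]: "Q \<in> borel_measurable borel" unfolding Q_def by (rule fconv_sol_measurable_time)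
  let ?F = "\<lambda>t s. osign t s *\<^sub>R (cis ((t - s) * kp_symbol \<alpha> \<zeta>) * (\<i> * of_real (fst \<zeta>)) * Q s)"
  have F: "duhamel \<alpha> (\<lambda>s. fconv (sol e s) (sol e s)) t \<zeta> = (LINT s|lborel. ?F t s)" for t
    by (simp add: duhamel_def Q_def)
  have "(\<lambda>k. LINT s|lborel. ?F (X k) s) \<longlonglongrightarrow> (LINT s|lborel. ?F t s)"
  proof (rule integral_dominated_convergence[where w = "\<lambda>s. M * indicator {-T..T} s"])
    show "integrable lborel (\<lambda>s. M * indicat_real {-T..T} s)"
      using T by (intro integrable_mult_right) (simp add: integrable_indicator_iff)
    show "AE s in lborel. norm (?F (X k) s) \<le> M * indicator {-T..T} s" for k
    proof (rule AE_I2)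
      fix s
      show "norm (?F (X k) s) \<le> M * indicator {-T..T} s"
      proof (cases "osign (X k) s = 0")
        case True
        then show ?thesis using M0 by simp
      next
        case False
        have s: "\<bar>s\<bar> \<le> T" by (rule osign_nonzero_le[OF X(2) False])
        have "norm (?F (X k) s) \<le> 1 * (\<bar>fst \<zeta>\<bar> * norm (Q s))"
          using mult_right_mono[OF abs_osign_le_1[of "X k" s], of "\<bar>fst \<zeta>\<bar> * norm (Q s)"]
          by (simp add: norm_mult)
        also have "\<dots> \<le> M" unfolding M_def Q_def
          using mult_left_mono[OF fconv_sol_bound'[OF s], of "\<bar>fst \<zeta>\<bar>" \<zeta>] by simp
        finally show ?thesis using s by (simp add: abs_le_iff)
      qed
    qed
    have "AE s in lborel. s \<noteq> t \<and> s \<noteq> 0"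
      using AE_lborel_singleton[of t] AE_lborel_singleton[of 0] by (rule AE_conjI)
    then show "AE s in lborel. (\<lambda>k. ?F (X k) s) \<longlonglongrightarrow> ?F t s"
    proof (rule AE_mp, intro AE_I2 impI)
      fix s assume s: "s \<noteq> t \<and> s \<noteq> 0"
      have "\<forall>\<^sub>F k in sequentially. osign (X k) s = osign t s"
      proof (cases "s < t")
        case True
        from order_tendstoD(1)[OF X(1) this] show ?thesis
          by eventually_elim (use True in \<open>auto simp: osign_def\<close>)
      next
        case False
        with s have "t < s" by simp
        from order_tendstoD(2)[OF X(1) this] show ?thesis
          by eventually_elim (use \<open>t < s\<close> in \<open>auto simp: osign_def\<close>)
      qed
      then have "(\<lambda>k. osign (X k) s) \<longlonglongrightarrow> osign t s" by (rule tendsto_eventually)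
      moreover have "(\<lambda>k. cis ((X k - s) * kp_symbol \<alpha> \<zeta>)) \<longlonglongrightarrow> cis ((t - s) * kp_symbol \<alpha> \<zeta>)"
        unfolding cis_conv_exp by (intro tendsto_intros X(1))
      ultimately show "(\<lambda>k. ?F (X k) s) \<longlonglongrightarrow> ?F t s"
        by (intro tendsto_scaleR tendsto_mult tendsto_const)
    qed
  qed measurable
  moreover have "(\<lambda>k. of_real e * (cis (X k * kp_symbol \<alpha> \<zeta>) * f \<zeta>)) \<longlonglongrightarrow> of_real e * (cis (t * kp_symbol \<alpha> \<zeta>) * f \<zeta>)"
    unfolding cis_conv_exp by (intro tendsto_intros X(1))
  ultimately show ?thesis
    unfolding sol_duhamel[OF t] sol_duhamel[OF X(2)] F by (intro tendsto_add)
qed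

lemma sol_weighted_L2:
  assumes t: "\<bar>t\<bar> \<le> T"
  shows "weighted_L2 s1 s2 (sol e t)"
proof (rule weighted_L2_of_rapid_decay[OF sol_measurable])
  fix m
  show "\<exists>C. \<forall>\<zeta>. norm (sol e t \<zeta>) * (1 + (norm \<zeta>)\<^sup>2) ^ m \<le> C"
    using sol_weighted_bound[OF small T, of m] t by blast
qed

text \<open>Dominated convergence in frequency, with a majorant uniform in time from
  \<open>sol_weighted_bound\<close>. The difference is written with \<open>of_real (- 1)\<close> to
  fit \<open>weighted_L2_add\<close> and \<open>weighted_L2_scale\<close>.\<close>

lemma sol_time_continuous:
  assumes X: "X \<longlonglongrightarrow> t" "\<And>k. \<bar>X k\<bar> \<le> T" and t: "\<bar>t\<bar> \<le> T"
  shows "(\<lambda>k. weighted_L2_norm s1 s2 (\<lambda>\<zeta>. sol e (X k) \<zeta> + of_real (- 1) * sol e t \<zeta>)) \<longlonglongrightarrow> 0"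
proof -
  let ?w = "sobolev_weight s1 s2"
  obtain m where m: "\<And>\<zeta>. ?w \<zeta> \<le> (1 + (norm \<zeta>)\<^sup>2) ^ m"
    using sobolev_weight_bounds[of s1 s2] by (elim exE) (rule that, blast)
  obtain C where C: "\<And>t \<zeta>. \<bar>t\<bar> \<le> T \<Longrightarrow> norm (sol e t \<zeta>) * (1 + (norm \<zeta>)\<^sup>2) ^ (m + 3) \<le> C"
    using sol_weighted_bound[OF small T, of "m + 3"] by blast
  have w0: "0 \<le> ?w \<zeta>" for \<zeta> using sobolev_weight_pos[of s1 s2 \<zeta>] by simp
  have b: "?w \<zeta> * norm (sol e t \<zeta>) \<le> C * decay \<zeta>" if t: "\<bar>t\<bar> \<le> T" for t \<zeta>
    by (rule mult_le_decay[OF w0 m C[OF t]])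
  have C0: "0 \<le> C" using order_trans[OF mult_nonneg_nonneg[OF w0 norm_ge_zero] b[OF t, of 0]] decay_pos[of 0]
    by (simp add: zero_le_mult_iff)
  let ?d = "\<lambda>k \<zeta>. sol e (X k) \<zeta> + of_real (- 1) * sol e t \<zeta>"
  have "(\<lambda>k. LINT \<zeta>|lborel. (?w \<zeta> * norm (?d k \<zeta>))\<^sup>2) \<longlonglongrightarrow> (LINT \<zeta>::pt|lborel. 0)"
  proof (rule integral_dominated_convergence[where w = "\<lambda>\<zeta>. (2 * C) * (2 * C) * decay \<zeta>"])
    show "AE \<zeta> in lborel. (\<lambda>k. (?w \<zeta> * norm (?d k \<zeta>))\<^sup>2) \<longlonglongrightarrow> 0"
    proof (rule AE_I2)
      fix \<zeta>
      have "(\<lambda>k. (?w \<zeta> * norm (?d k \<zeta>))\<^sup>2) \<longlonglongrightarrow> (?w \<zeta> * norm (sol e t \<zeta> + of_real (-1) * sol e t \<zeta>))\<^sup>2"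
        by (intro tendsto_intros sol_tendsto[OF X t])
      then show "(\<lambda>k. (?w \<zeta> * norm (?d k \<zeta>))\<^sup>2) \<longlonglongrightarrow> 0" by simp
    qed
    show "AE \<zeta> in lborel. norm ((?w \<zeta> * norm (?d k \<zeta>))\<^sup>2) \<le> (2 * C) * (2 * C) * decay \<zeta>" for k
    proof (rule AE_I2)
      fix \<zeta>
      have "norm (?d k \<zeta>) \<le> norm (sol e (X k) \<zeta>) + norm (sol e t \<zeta>)"
        using norm_triangle_ineq4[of "sol e (X k) \<zeta>" "sol e t \<zeta>"] by simp
      from mult_left_mono[OF this w0[of \<zeta>]]
      have le: "?w \<zeta> * norm (?d k \<zeta>) \<le> 2 * C * decay \<zeta>"
        using b[OF X(2)[of k], of \<zeta>] b[OF t, of \<zeta>] by (simp add: distrib_left)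
      have "(?w \<zeta> * norm (?d k \<zeta>))\<^sup>2 \<le> (2 * C * decay \<zeta>) * (2 * C * 1)"
        unfolding power2_eq_square
        by (intro mult_mono le order_trans[OF le] mult_left_mono decay_le_1 mult_nonneg_nonneg decay_nonneg w0) (auto simp: C0)
      then show "norm ((?w \<zeta> * norm (?d k \<zeta>))\<^sup>2) \<le> (2 * C) * (2 * C) * decay \<zeta>" by (simp add: mult_ac)
    qed
  qed (auto simp: integrable_decay)
  then have "(\<lambda>k. sqrt (LINT \<zeta>|lborel. (?w \<zeta> * norm (?d k \<zeta>))\<^sup>2)) \<longlonglongrightarrow> sqrt 0"
    by (intro tendsto_real_sqrt) simp
  then show ?thesis by (simp add: weighted_L2_norm_def)
qed

lemma propagator_deriv_fconv_sol:
  assumes s: "\<bar>s\<bar> \<le> T"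
  shows "propagator \<alpha> r (deriv_x (inv_fourier_dist (fconv (sol e s) (sol e s)))) =
    inv_fourier_dist (\<lambda>\<zeta>. cis (r * kp_symbol \<alpha> \<zeta>) * (\<i> * of_real (fst \<zeta>)) * fconv (sol e s) (sol e s) \<zeta>)"
proof -
  define C where "C = (2 * \<bar>e\<bar> * A) * (2 * \<bar>e\<bar> * A) * conv_const"
  note b = fconv_sol_bound'[OF s, folded C_def]
  have C0: "0 \<le> C" unfolding C_def using conv_const(1) A_nonneg by simp
  have t1: "tempered_fun (fconv (sol e s) (sol e s))"
    by (rule tempered_of_le_decay'[OF fconv_sol_measurable b])
  have t2: "tempered_fun (\<lambda>\<zeta>. \<i> * of_real (fst \<zeta>) * fconv (sol e s) (sol e s) \<zeta>)"
  proof (rule tempered_of_le_decay)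
    fix \<zeta> :: pt
    have "\<bar>fst \<zeta>\<bar> \<le> norm \<zeta>" by (metis norm_fst_le prod.collapse real_norm_def)
    also have "norm \<zeta> \<le> 1 + (norm \<zeta>)\<^sup>2" by (rule norm_le_one_plus_sq)
    finally have "\<bar>fst \<zeta>\<bar> * norm (fconv (sol e s) (sol e s) \<zeta>) \<le> (1 + (norm \<zeta>)\<^sup>2) * (C * decay \<zeta>)"
      by (intro mult_mono b) auto
    then show "norm (\<i> * of_real (fst \<zeta>) * fconv (sol e s) (sol e s) \<zeta>) \<le> C * (1 + (norm \<zeta>)\<^sup>2) * decay \<zeta>"
      by (simp add: norm_mult mult_ac)
  qed measurable
  have d: "deriv_x (inv_fourier_dist (fconv (sol e s) (sol e s))) = inv_fourier_dist (\<lambda>\<zeta>. \<i> * of_real (fst \<zeta>) * fconv (sol e s) (sol e s) \<zeta>)"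
    unfolding deriv_x_def case_prod_unfold by (rule fourier_mult_inv_fourier_dist[OF t1]) measurable
  have "propagator \<alpha> r (inv_fourier_dist (\<lambda>\<zeta>. \<i> * of_real (fst \<zeta>) * fconv (sol e s) (sol e s) \<zeta>)) =
      inv_fourier_dist (\<lambda>\<zeta>. cis (r * kp_symbol \<alpha> \<zeta>) * (\<i> * of_real (fst \<zeta>) * fconv (sol e s) (sol e s) \<zeta>))"
    unfolding propagator_def case_prod_unfold kp_symbol_def[symmetric]
    by (rule fourier_mult_inv_fourier_dist[OF t2]) measurable
  then show ?thesis unfolding d by (simp only: mult.assoc)
qed

text \<open>Fubini in time and frequency turns the pointwise formula into the one paired with test
  functions. The decay of the square gives integrability in frequency, since
  \<open>fst \<zeta>\<close> times the transform of the test function is bounded.\<close>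

lemma sol_duhamel_weak:
  assumes t: "\<bar>t\<bar> \<le> T" and psi: "\<psi> \<in> schwartz"
  defines "H \<equiv> \<lambda>s. propagator \<alpha> (t - s) (deriv_x (inv_fourier_dist (fconv (sol e s) (sol e s)))) \<psi>"
  shows "interval_lebesgue_integrable lborel (ereal 0) (ereal t) H"
    and "inv_fourier_dist (sol e t) \<psi> =
      propagator \<alpha> t (inv_fourier_dist (\<lambda>\<zeta>. of_real e * f \<zeta>)) \<psi> + (LBINT s=ereal 0..ereal t. H s)"
proof -
  note [measurable] = schwartz_measurable[OF psi]
  let ?\<psi> = "inv_fourier \<psi>"
  define Q where "Q s \<zeta> = fconv (sol e s) (sol e s) \<zeta>" for s \<zeta>
  define C where "C = (2 * \<bar>e\<bar> * A) * (2 * \<bar>e\<bar> * A) * conv_const"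
  have C0: "0 \<le> C" unfolding C_def using conv_const(1) A_nonneg by simp
  have Qb: "norm (Q s \<zeta>) \<le> C * decay \<zeta>" if "\<bar>s\<bar> \<le> T" for s \<zeta>
    using fconv_sol_bound'[OF that] by (simp add: C_def Q_def)
  obtain D where D: "D \<ge> 0" "\<And>\<zeta>. norm (?\<psi> \<zeta>) * (1 + (norm \<zeta>)\<^sup>2) ^ 1 \<le> D"
    using inv_fourier_decay[OF psi, of 1] by blast
  define G where "G s \<zeta> = osign t s *\<^sub>R (cis ((t - s) * kp_symbol \<alpha> \<zeta>) * (\<i> * of_real (fst \<zeta>)) * Q s \<zeta>)" for s \<zeta>
  have Qm: "(\<lambda>(s, \<zeta>). Q s \<zeta>) \<in> borel_measurable (borel \<Otimes>\<^sub>M borel)"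
    unfolding Q_def by (rule fconv_sol_measurable_pair)
  have [measurable]: "(\<lambda>x. Q (fst x) (snd x)) \<in> borel_measurable (lborel \<Otimes>\<^sub>M lborel)"
    by (rule measurable_uncurry[OF Qm]) measurable
  have [measurable]: "?\<psi> \<in> borel_measurable borel" by measurable
  have xb: "\<bar>fst \<zeta>\<bar> * norm (?\<psi> \<zeta>) \<le> D" for \<zeta> :: pt
  proof -
    have "\<bar>fst \<zeta>\<bar> \<le> norm \<zeta>" by (metis norm_fst_le prod.collapse real_norm_def)
    also have "norm \<zeta> \<le> 1 + (norm \<zeta>)\<^sup>2" by (rule norm_le_one_plus_sq)
    finally have "\<bar>fst \<zeta>\<bar> * norm (?\<psi> \<zeta>) \<le> (1 + (norm \<zeta>)\<^sup>2) * norm (?\<psi> \<zeta>)" by (rule mult_right_mono) simp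
    with D(2)[of \<zeta>] show ?thesis by (simp add: mult.commute)
  qed
  have int: "integrable (lborel \<Otimes>\<^sub>M lborel) (\<lambda>(s, \<zeta>). G s \<zeta> * ?\<psi> \<zeta>)"
  proof (rule Bochner_Integration.integrable_bound)
    show "integrable (lborel \<Otimes>\<^sub>M lborel) (\<lambda>(s, \<zeta>). (\<bar>osign t s\<bar>) * (C * D * decay \<zeta>))"
      by (rule integrable_pair_mult) (use integrable_osign_power[of t 0] in \<open>simp_all add: integrable_decay\<close>)
    show "(\<lambda>(s, \<zeta>). G s \<zeta> * ?\<psi> \<zeta>) \<in> borel_measurable (lborel \<Otimes>\<^sub>M lborel)"
      unfolding G_def case_prod_unfold by measurable
    have "norm (G s \<zeta> * ?\<psi> \<zeta>) \<le> \<bar>osign t s\<bar> * (C * D * decay \<zeta>)" for s \<zeta>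
    proof (cases "osign t s = 0")
      case False
      have "norm (Q s \<zeta>) * (\<bar>fst \<zeta>\<bar> * norm (?\<psi> \<zeta>)) \<le> (C * decay \<zeta>) * D"
        by (intro mult_mono Qb xb osign_nonzero_le[OF t False] mult_nonneg_nonneg C0 decay_nonneg) auto
      from mult_left_mono[OF this, of "\<bar>osign t s\<bar>"] show ?thesis
        by (simp add: G_def norm_mult mult_ac)
    qed (simp add: G_def)
    then show "AE x in lborel \<Otimes>\<^sub>M lborel. norm (case x of (s, \<zeta>) \<Rightarrow> G s \<zeta> * ?\<psi> \<zeta>) \<le> norm (case x of (s, \<zeta>) \<Rightarrow> \<bar>osign t s\<bar> * (C * D * decay \<zeta>))"
      using C0 D(1) by (intro AE_I2) (auto simp: abs_mult decay_nonneg)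
  qed
  have eqH: "osign t s *\<^sub>R H s = (LINT \<zeta>|lborel. G s \<zeta> * ?\<psi> \<zeta>)" for s
  proof (cases "osign t s = 0")
    case False
    have "H s = (LINT \<zeta>|lborel. cis ((t - s) * kp_symbol \<alpha> \<zeta>) * (\<i> * of_real (fst \<zeta>)) * Q s \<zeta> * ?\<psi> \<zeta>)"
      unfolding H_def propagator_deriv_fconv_sol[OF osign_nonzero_le[OF t False]] using psi
      by (simp add: inv_fourier_dist_def Q_def)
    then show ?thesis by (simp add: G_def)
  qed (simp add: G_def)
  show "interval_lebesgue_integrable lborel (ereal 0) (ereal t) H"
    unfolding interval_integral_osign(2) eqH
    using lborel_pair.integrable_fst'[OF int] by simp
  have swap: "(LINT \<zeta>|lborel. (LINT s|lborel. G s \<zeta>) * ?\<psi> \<zeta>) = (LBINT s=ereal 0..ereal t. H s)"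
    unfolding interval_integral_osign(1) eqH
    using lborel_pair.Fubini_integral[OF int] by simp
  have gm: "(\<lambda>\<zeta>. LINT s|lborel. G s \<zeta>) \<in> borel_measurable borel"
  proof -
    have [measurable]: "(\<lambda>x. Q (snd x) (fst x)) \<in> borel_measurable (borel \<Otimes>\<^sub>M lborel)"
      by (rule measurable_uncurry[OF Qm]) measurable
    show ?thesis unfolding G_def by measurable
  qed
  have i2: "integrable lborel (\<lambda>\<zeta>. (LINT s|lborel. G s \<zeta>) * ?\<psi> \<zeta>)"
    using lborel_pair.integrable_snd[OF int] by simp
  have tf: "tempered_fun (\<lambda>\<zeta>. of_real e * f \<zeta>)"
  proof (rule tempered_of_le_decay'[where C = "\<bar>e\<bar> * A"])
    show "norm (of_real e * f \<zeta>) \<le> \<bar>e\<bar> * A * decay \<zeta>" for \<zeta>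
      using mult_left_mono[OF f_bound[of \<zeta>], of "\<bar>e\<bar>"] by (simp add: norm_mult mult_ac)
  qed measurable
  have lin: "propagator \<alpha> t (inv_fourier_dist (\<lambda>\<zeta>. of_real e * f \<zeta>)) =
      inv_fourier_dist (\<lambda>\<zeta>. cis (t * kp_symbol \<alpha> \<zeta>) * (of_real e * f \<zeta>))"
    unfolding propagator_def case_prod_unfold kp_symbol_def[symmetric]
    by (rule fourier_mult_inv_fourier_dist[OF tf]) measurable
  have i1: "integrable lborel (\<lambda>\<zeta>. cis (t * kp_symbol \<alpha> \<zeta>) * (of_real e * f \<zeta>) * ?\<psi> \<zeta>)"
  proof (rule integrable_of_le_decay[where C = "\<bar>e\<bar> * A * D"])
    fix \<zeta>
    have "norm (?\<psi> \<zeta>) * 1 \<le> norm (?\<psi> \<zeta>) * (1 + (norm \<zeta>)\<^sup>2) ^ 1" by (intro mult_left_mono) auto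
    with D(2)[of \<zeta>] have "norm (?\<psi> \<zeta>) \<le> D" by simp
    then have "norm (f \<zeta>) * norm (?\<psi> \<zeta>) \<le> (A * decay \<zeta>) * D"
      by (intro mult_mono f_bound mult_nonneg_nonneg A_nonneg decay_nonneg) auto
    from mult_left_mono[OF this, of "\<bar>e\<bar>"]
    show "norm (cis (t * kp_symbol \<alpha> \<zeta>) * (of_real e * f \<zeta>) * ?\<psi> \<zeta>) \<le> \<bar>e\<bar> * A * D * decay \<zeta>"
      by (simp add: norm_mult mult_ac)
  qed measurable
  have "inv_fourier_dist (sol e t) \<psi> = (LINT \<zeta>|lborel. sol e t \<zeta> * ?\<psi> \<zeta>)"
    using psi by (simp add: inv_fourier_dist_def)
  also have "\<dots> = (LINT \<zeta>|lborel. cis (t * kp_symbol \<alpha> \<zeta>) * (of_real e * f \<zeta>) * ?\<psi> \<zeta> + (LINT s|lborel. G s \<zeta>) * ?\<psi> \<zeta>)"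
  proof -
    have "sol e t \<zeta> = cis (t * kp_symbol \<alpha> \<zeta>) * (of_real e * f \<zeta>) + (LINT s|lborel. G s \<zeta>)" for \<zeta>
      unfolding sol_duhamel[OF t] duhamel_def G_def Q_def by simp
    then show ?thesis by (simp only: distrib_right)
  qed
  also have "\<dots> = (LINT \<zeta>|lborel. cis (t * kp_symbol \<alpha> \<zeta>) * (of_real e * f \<zeta>) * ?\<psi> \<zeta>) + (LINT \<zeta>|lborel. (LINT s|lborel. G s \<zeta>) * ?\<psi> \<zeta>)"
    by (rule Bochner_Integration.integral_add[OF i1 i2])
  finally show "inv_fourier_dist (sol e t) \<psi> =
      propagator \<alpha> t (inv_fourier_dist (\<lambda>\<zeta>. of_real e * f \<zeta>)) \<psi> + (LBINT s=ereal 0..ereal t. H s)"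
    unfolding swap lin using psi by (simp add: inv_fourier_dist_def)
qed

text \<open>Evaluation at time \<open>t\<close> on a test function is the functional fed into
  \<open>C2_quadratic_bound\<close>; this is the power series in the amplitude that it asks
  for.\<close>

lemma sol_pairing_sums:
  assumes t: "\<bar>t\<bar> \<le> T" and psi: "\<psi> \<in> schwartz"
  shows "(\<lambda>n. of_real (e ^ Suc n) * inv_fourier_dist (p n t) \<psi>) sums inv_fourier_dist (sol e t) \<psi>"
proof -
  note [measurable] = schwartz_measurable[OF psi]
  let ?\<psi> = "inv_fourier \<psi>"
  obtain D where D: "D \<ge> 0" "\<And>\<zeta>. norm (?\<psi> \<zeta>) * (1 + (norm \<zeta>)\<^sup>2) ^ 0 \<le> D"
    using inv_fourier_decay[OF psi, of 0] by blast
  let ?F = "\<lambda>n \<zeta>. of_real (e ^ Suc n) * p n t \<zeta> * ?\<psi> \<zeta>"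
  have b: "norm (?F n \<zeta>) \<le> (\<bar>e\<bar> * A * D * (1/2) ^ n) * decay \<zeta>" for n \<zeta>
  proof -
    have "norm (of_real (e ^ Suc n) * p n t \<zeta>) * norm (?\<psi> \<zeta>) \<le> (\<bar>e\<bar> * A * (1/2) ^ n * decay \<zeta>) * D"
      using D(2)[of \<zeta>] by (intro mult_mono sol_term_le[OF small T t] mult_nonneg_nonneg A_nonneg decay_nonneg) auto
    then show ?thesis by (simp add: norm_mult mult_ac)
  qed
  have Fi: "integrable lborel (?F n)" for n by (rule integrable_of_le_decay[OF _ b]) measurable
  have s12: "summable (\<lambda>n. (\<bar>e\<bar> * A * D * (1/2::real) ^ n) * c)" for c
    by (intro summable_mult summable_mult2 summable_geometric) simp
  have sum1: "summable (\<lambda>n. norm (?F n \<zeta>))" for \<zeta>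
    by (rule summable_comparison_test'[OF s12[of "decay \<zeta>"], of 0]) (use b in simp)
  have sum2: "summable (\<lambda>n. LINT \<zeta>|lborel. norm (?F n \<zeta>))"
  proof (rule summable_comparison_test'[OF s12[of "LINT \<zeta>|lborel. decay \<zeta>"], of 0])
    fix n :: nat
    have "(LINT \<zeta>|lborel. norm (?F n \<zeta>)) \<le> (LINT \<zeta>|lborel. (\<bar>e\<bar> * A * D * (1/2) ^ n) * decay \<zeta>)"
      by (rule integral_mono'[OF integrable_mult_right[OF integrable_decay] b])
         (auto intro!: mult_nonneg_nonneg simp: A_nonneg D decay_nonneg)
    then show "norm (LINT \<zeta>|lborel. norm (?F n \<zeta>)) \<le> (\<bar>e\<bar> * A * D * (1/2) ^ n) * (LINT \<zeta>|lborel. decay \<zeta>)"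
      by simp
  qed
  have "(\<lambda>n. LINT \<zeta>|lborel. ?F n \<zeta>) sums (LINT \<zeta>|lborel. (\<Sum>n. ?F n \<zeta>))"
    by (rule sums_integral[OF Fi _ sum2]) (use sum1 in simp)
  moreover have "(\<Sum>n. ?F n \<zeta>) = sol e t \<zeta> * ?\<psi> \<zeta>" for \<zeta>
    using sums_mult2[OF sol_sums[OF small T t], of \<zeta> "?\<psi> \<zeta>"] by (simp add: sums_iff)
  moreover have "(LINT \<zeta>|lborel. ?F n \<zeta>) = of_real (e ^ Suc n) * (LINT \<zeta>|lborel. p n t \<zeta> * ?\<psi> \<zeta>)" for n
    by (simp only: mult.assoc integral_mult_right_zero)
  ultimately show ?thesis using psi by (simp add: inv_fourier_dist_def)
qed

end

section \<open>Hermitian symmetry, and the series as a solution of the Cauchy problem\<close>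

lemma fconv_reflect:
  assumes [measurable]: "g \<in> borel_measurable borel" "h \<in> borel_measurable borel"
    and g: "\<And>\<zeta>. g (- \<zeta>) = cnj (g \<zeta>)" and h: "\<And>\<zeta>. h (- \<zeta>) = cnj (h \<zeta>)"
  shows "fconv g h (- \<zeta>) = cnj (fconv g h \<zeta>)"
proof -
  have "(LINT z|lborel. g z * h (- \<zeta> - z)) = (LINT z|lborel. (\<lambda>z. g (- z) * h (- \<zeta> + z)) (0 - z))" by simp
  also have "\<dots> = (LINT z|lborel. g (- z) * h (- \<zeta> + z))"
    by (rule lborel_integral_reflect(1)) measurable
  also have "\<dots> = (LINT z|lborel. cnj (g z * h (\<zeta> - z)))"
    using h[of "\<zeta> - z" for z] by (simp add: g)
  also have "\<dots> = cnj (LINT z|lborel. g z * h (\<zeta> - z))" by (rule Bochner_Integration.integral_cnj)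
  finally show ?thesis by (simp add: fconv_def)
qed

text \<open>The symbol is odd and the factor \<i> times \<open>fst \<zeta>\<close> is Hermitian, so
  each step of the recursion preserves the symmetry and real data have real solutions.\<close>

lemma picard_reflect:
  assumes f: "\<And>\<zeta>. f (- \<zeta>) = cnj (f \<zeta>)"
  shows "p n t (- \<zeta>) = cnj (p n t \<zeta>)"
proof (induction n arbitrary: t \<zeta> rule: less_induct)
  case (less n)
  show ?case
  proof (cases n)
    case 0
    then show ?thesis by (simp add: f kp_symbol_minus cis_cnj)
  next
    case (Suc k)
    define K where "K s \<zeta> = (\<Sum>i\<le>k. fconv (p i s) (p (k - i) s) \<zeta>)" for s \<zeta>
    have K: "K s (- \<zeta>) = cnj (K s \<zeta>)" for s \<zeta>
      unfolding K_def cnj_sum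
      by (intro sum.cong refl fconv_reflect p_measurable less.IH) (auto simp: Suc)
    have pS: "p n = duhamel \<alpha> K" unfolding Suc K_def by simp
    have "duhamel \<alpha> K t (- \<zeta>) = (LINT s|lborel. cnj (osign t s *\<^sub>R (cis ((t - s) * kp_symbol \<alpha> \<zeta>) * (\<i> * of_real (fst \<zeta>)) * K s \<zeta>)))"
      unfolding duhamel_def by (simp add: K kp_symbol_minus cis_cnj)
    also have "\<dots> = cnj (duhamel \<alpha> K t \<zeta>)" unfolding duhamel_def by (rule Bochner_Integration.integral_cnj)
    finally show ?thesis unfolding pS .
  qed
qed

lemma sol_reflect:
  assumes f: "\<And>\<zeta>. f (- \<zeta>) = cnj (f \<zeta>)" and small: "\<bar>e\<bar> * (B * T) \<le> 1/2" and T: "0 < T" and t: "\<bar>t\<bar> \<le> T"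
  shows "sol e t (- \<zeta>) = cnj (sol e t \<zeta>)"
proof -
  have "(\<lambda>n. cnj (of_real (e ^ Suc n) * p n t \<zeta>)) sums cnj (sol e t \<zeta>)"
    using sol_sums[OF small T t] by (simp only: sums_cnj)
  then have "(\<lambda>n. of_real (e ^ Suc n) * p n t (- \<zeta>)) sums cnj (sol e t \<zeta>)"
    by (simp add: picard_reflect[OF f])
  from sums_unique2[OF sol_sums[OF small T t] this] show ?thesis .
qed

lemma kp_solution_sol:
  assumes X: "X = sobolev s1 s2 \<or> X = real_sobolev s1 s2"
    and f: "\<And>\<zeta>. f (- \<zeta>) = cnj (f \<zeta>)" and small: "\<bar>e\<bar> * (B * T) \<le> 1/2" and T: "0 < T"
  shows "kp_solution \<alpha> X T (inv_fourier_dist (\<lambda>\<zeta>. of_real e * f \<zeta>)) (\<lambda>t. if t \<in> {-T..T} then inv_fourier_dist (sol e t) else 0)"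
    (is "kp_solution \<alpha> X T ?dat ?u")
proof -
  have nX: "nrm X = nrm (sobolev s1 s2)" using X by (auto simp: real_sobolev_simps)
  have abs: "\<bar>t\<bar> \<le> T" if "t \<in> {-T..T}" for t using that by auto
  have uX: "inv_fourier_dist (sol e t) \<in> points X" if t: "t \<in> {-T..T}" for t
  proof -
    have "inv_fourier_dist (sol e t) \<in> points (sobolev s1 s2)"
      unfolding points_sobolev using sol_weighted_L2[OF small T abs[OF t]] by blast
    moreover have "real_valued (inv_fourier_dist (sol e t))"
      by (rule real_valued_inv_fourier_dist[OF sol_measurable sol_reflect[OF f small T abs[OF t]]])
    ultimately show ?thesis using X by (auto simp: real_sobolev_simps)
  qed
  have curve: "?u \<in> points (continuous_curves T X)"
    unfolding continuous_curves_def nspace.simps mem_Collect_eq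
  proof (intro conjI ballI allI impI)
    fix t assume t: "t \<in> {-T..T}"
    show "?u t \<in> points X" using uX[OF t] t by simp
    show "((\<lambda>t'. nrm X (?u t' - ?u t)) \<longlongrightarrow> 0) (at t within {-T..T})"
      unfolding tendsto_at_iff_sequentially
    proof (intro allI impI)
      fix Y :: "nat \<Rightarrow> real" assume "\<forall>i. Y i \<in> {-T..T} - {t}" and Y: "Y \<longlonglongrightarrow> t"
      then have Y': "Y i \<in> {-T..T}" for i by auto
      have "nrm X (?u (Y k) - ?u t) = weighted_L2_norm s1 s2 (\<lambda>\<zeta>. sol e (Y k) \<zeta> + of_real (- 1) * sol e t \<zeta>)" for k
      proof -
        note w1 = sol_weighted_L2[OF small T abs[OF Y'[of k]], of s1 s2]
        note w2 = weighted_L2_scale[OF sol_weighted_L2[OF small T abs[OF t], of s1 s2], of "- 1"]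
        have "?u (Y k) - ?u t = inv_fourier_dist (\<lambda>\<zeta>. sol e (Y k) \<zeta> + of_real (- 1) * sol e t \<zeta>)"
          using Y'[of k] t by (simp add: inv_fourier_dist_add[OF w1 w2] inv_fourier_dist_scale del: of_real_minus of_real_1)
        then show ?thesis unfolding nX by (simp only: nrm_sobolev[OF weighted_L2_add[OF w1 w2]])
      qed
      then show "((\<lambda>t'. nrm X (?u t' - ?u t)) \<circ> Y) \<longlonglongrightarrow> 0"
        using sol_time_continuous[OF small T Y abs[OF Y'] abs[OF t]] by (simp add: o_def)
    qed
  qed auto
  have sq: "is_square (?u s) (inv_fourier_dist (fconv (sol e s) (sol e s))) \<and> has_fourier_fun (inv_fourier_dist (fconv (sol e s) (sol e s)))"
    if s: "s \<in> {-T..T}" for s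
  proof -
    note b = fconv_sol_bound[OF small T abs[OF s]] and m = fconv_sol_measurable[OF small T]
    have "is_square (inv_fourier_dist (sol e s)) (inv_fourier_dist (fconv (sol e s) (sol e s)))"
      by (rule is_square_inv_fourier_dist[OF integrable_of_le_decay[OF sol_measurable sol_bound[OF small T abs[OF s]]] integrable_of_le_decay[OF m b]])
    moreover have "has_fourier_fun (inv_fourier_dist (fconv (sol e s) (sol e s)))"
      unfolding has_fourier_fun_def using tempered_of_le_decay'[OF m b] by blast
    ultimately show ?thesis using s by simp
  qed
  show ?thesis
    unfolding kp_solution_def
  proof (intro conjI curve exI[of _ "\<lambda>s. inv_fourier_dist (fconv (sol e s) (sol e s))"] ballI)
    show "AE s in lborel. s \<in> {-T..T} \<longrightarrow> is_square (?u s) (inv_fourier_dist (fconv (sol e s) (sol e s))) \<and> has_fourier_fun (inv_fourier_dist (fconv (sol e s) (sol e s)))"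
      by (intro AE_I2 impI sq)
  next
    fix t and \<psi> :: "pt \<Rightarrow> complex" assume t: "t \<in> {-T..T}" and psi: "\<psi> \<in> schwartz"
    show "interval_lebesgue_integrable lborel (ereal 0) (ereal t) (\<lambda>s. propagator \<alpha> (t - s) (deriv_x (inv_fourier_dist (fconv (sol e s) (sol e s)))) \<psi>)"
      by (rule sol_duhamel_weak(1)[OF small T abs[OF t] psi])
    show "?u t \<psi> = propagator \<alpha> t ?dat \<psi> + (LBINT s=ereal 0..ereal t. propagator \<alpha> (t - s) (deriv_x (inv_fourier_dist (fconv (sol e s) (sol e s)))) \<psi>)"
      using sol_duhamel_weak(2)[OF small T abs[OF t] psi] t by simp
  qed
qed

end

section \<open>The resonant interaction\<close>

text \<open>\<open>P = N\<^sup>\<alpha>\<close>; up to constants, the low frequency \<open>\<gamma>\<close> is the largest one for which the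
  resonance function of the interaction is bounded on the whole box, and \<open>\<kappa>\<close> is the
  width of the box across the resonant curve, a circle of radius about \<open>N \<rho>\<close>.\<close>

locale resonance =
  fixes \<alpha> N :: real
  assumes alpha: "2 \<le> \<alpha>" "\<alpha> \<le> 3" and N: "10 \<le> N"
begin

definition "P = N powr \<alpha>"
definition "\<gamma> = N powr ((1 - \<alpha>) / 2)"
definition "\<kappa> = N powr (- \<alpha> / 2)"
definition "\<rho> = sqrt ((\<alpha> + 1) * P)"

section \<open>Relations between the scales of the resonant interaction\<close>

lemma P_pos: "0 < P" and gam_pos: "0 < \<gamma>" and kap_pos: "0 < \<kappa>" and rho_pos: "0 < \<rho>"
  using N alpha by (simp_all add: P_def \<gamma>_def \<kappa>_def \<rho>_def)

text \<open>Used as \<gamma>^2 P / N = 1, the size of the second-order error in the dispersion and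
  in the denominator of the transverse term.\<close>

lemma gam_sq: "\<gamma>\<^sup>2 * P = N"
proof -
  have "\<gamma>\<^sup>2 * P = N powr ((1 - \<alpha>) / 2 + (1 - \<alpha>) / 2 + \<alpha>)"
    unfolding \<gamma>_def P_def power2_eq_square by (simp only: powr_add)
  also have "(1 - \<alpha>) / 2 + (1 - \<alpha>) / 2 + \<alpha> = 1" by (simp add: field_simps)
  finally show ?thesis using N by simp
qed

lemma kap_sq: "\<kappa>\<^sup>2 * P = 1"
proof -
  have "\<kappa>\<^sup>2 * P = N powr (- \<alpha> / 2 + - \<alpha> / 2 + \<alpha>)"
    unfolding \<kappa>_def P_def power2_eq_square by (simp only: powr_add)
  also have "- \<alpha> / 2 + - \<alpha> / 2 + \<alpha> = 0" by (simp add: field_simps)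
  finally show ?thesis using N by simp
qed

lemma gam_le_1: "\<gamma> \<le> 1"
proof -
  have "\<gamma> \<le> N powr 0" unfolding \<gamma>_def by (rule powr_mono) (use N alpha in auto)
  then show ?thesis using N by simp
qed

text \<open>Used as \<kappa>^2 / \<gamma> \<le> 1: the square of the deviation in the first
  transverse coordinate is harmless.\<close>

lemma kap_sq_le: "\<kappa>\<^sup>2 \<le> \<gamma>"
proof -
  have "\<kappa>\<^sup>2 = N powr (- \<alpha> / 2 + - \<alpha> / 2)"
    unfolding \<kappa>_def power2_eq_square by (simp only: powr_add)
  also have "\<dots> \<le> \<gamma>" unfolding \<gamma>_def by (rule powr_mono) (use N alpha in auto)
  finally show ?thesis .
qed

lemma kap_le_1: "\<kappa> \<le> 1"
  using kap_sq_le gam_le_1 kap_pos by (smt (verit) one_less_power pos2)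

lemma rho_sq: "\<rho>\<^sup>2 = (\<alpha> + 1) * P"
  unfolding \<rho>_def using alpha P_pos by (intro real_sqrt_pow2) simp

lemma P_ge_1: "1 \<le> P"
  unfolding P_def using N alpha by (intro ge_one_powr_ge_zero) auto

lemma rho_ge_1: "1 \<le> \<rho>"
proof -
  have "1 * 1 \<le> (\<alpha> + 1) * P" by (intro mult_mono P_ge_1) (use alpha in auto)
  then show ?thesis unfolding \<rho>_def by simp
qed

text \<open>Controls the term linear in the deviation across the resonant curve, the one that
  determines \<kappa>.\<close>

lemma kap_rho_le: "\<kappa> * \<rho> \<le> 2"
proof -
  have "(\<kappa> * \<rho>)\<^sup>2 = (\<alpha> + 1) * (\<kappa>\<^sup>2 * P)" by (simp add: power_mult_distrib rho_sq)
  also have "\<dots> \<le> 2\<^sup>2" using alpha by (simp add: kap_sq)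
  finally show ?thesis by (rule power2_le_imp_le) simp
qed

text \<open>Two applications of the mean value theorem: the error in linearizing at \<open>N\<close>
  is at most x (\<alpha> + 1) (c - N) \<alpha> d^(\<alpha> - 1), with d^(\<alpha> - 1) \<le> 4 P / N
  because d \<le> 2 N and \<alpha> \<le> 3. The constant is 2 * 4 * 2 * 3 * 4 = 192, times
  \<gamma>^2 P / N = 1.\<close>

lemma dispersion_increment:
  assumes x: "0 < x" "x \<le> 2 * \<gamma>" and y: "N \<le> y" and xy: "x + y \<le> N + 2 * \<gamma>"
  shows "\<bar>(x + y) powr (\<alpha> + 1) - y powr (\<alpha> + 1) - (\<alpha> + 1) * P * x\<bar> \<le> 192"
proof -
  have "\<exists>c>y. c < x + y \<and> (x + y) powr (\<alpha> + 1) - y powr (\<alpha> + 1) = (x + y - y) * ((\<alpha> + 1) * c powr \<alpha>)"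
  proof (rule MVT2)
    fix c assume "y \<le> c" "c \<le> x + y"
    then show "((\<lambda>x. x powr (\<alpha> + 1)) has_real_derivative (\<alpha> + 1) * c powr \<alpha>) (at c)"
      using N y by (auto intro!: derivative_eq_intros)
  qed (use x in simp)
  then obtain c where c: "y < c" "c < x + y" "(x + y) powr (\<alpha> + 1) - y powr (\<alpha> + 1) = x * ((\<alpha> + 1) * c powr \<alpha>)"
    by auto
  have Nc: "N < c" using c y by simp
  have "\<exists>d>N. d < c \<and> c powr \<alpha> - N powr \<alpha> = (c - N) * (\<alpha> * d powr (\<alpha> - 1))"
  proof (rule MVT2[OF Nc])
    fix d assume "N \<le> d" "d \<le> c"
    then show "((\<lambda>x. x powr \<alpha>) has_real_derivative \<alpha> * d powr (\<alpha> - 1)) (at d)"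
      using N by (auto intro!: derivative_eq_intros)
  qed
  then obtain d where d: "N < d" "d < c" "c powr \<alpha> - P = (c - N) * (\<alpha> * d powr (\<alpha> - 1))"
    unfolding P_def by auto
  have dN: "d \<le> 2 * N" using d c xy gam_le_1 N by simp
  have "d powr (\<alpha> - 1) \<le> (2 * N) powr (\<alpha> - 1)"
    by (rule powr_mono2) (use alpha d N dN in auto)
  also have "\<dots> = 2 powr (\<alpha> - 1) * N powr (\<alpha> - 1)" using N by (simp add: powr_mult)
  also have "\<dots> \<le> 2 powr 2 * N powr (\<alpha> - 1)"
    by (intro mult_right_mono powr_mono) (use alpha in auto)
  also have "\<dots> = 4 * (P / N)" using N by (simp add: P_def powr_diff)
  finally have dp: "d powr (\<alpha> - 1) \<le> 4 * (P / N)" .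
  have e1: "0 \<le> c powr \<alpha> - P" unfolding d(3) using d c alpha by simp
  have "c powr \<alpha> - P \<le> (2 * \<gamma>) * (3 * (4 * (P / N)))"
    unfolding d(3) by (intro mult_mono dp) (use c xy alpha d gam_pos in auto)
  then have "x * ((\<alpha> + 1) * (c powr \<alpha> - P)) \<le> (2 * \<gamma>) * (4 * ((2 * \<gamma>) * (3 * (4 * (P / N)))))"
    by (intro mult_mono) (use x alpha e1 gam_pos in auto)
  also have "\<dots> = 192 * (\<gamma>\<^sup>2 * P / N)" by (simp add: power2_eq_square)
  also have "\<dots> = 192" using N by (simp add: gam_sq)
  finally have "x * ((\<alpha> + 1) * (c powr \<alpha> - P)) \<le> 192" .
  moreover have "0 \<le> x * ((\<alpha> + 1) * (c powr \<alpha> - P))" using x alpha e1 by simp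
  moreover have "(x + y) powr (\<alpha> + 1) - y powr (\<alpha> + 1) - (\<alpha> + 1) * P * x = x * ((\<alpha> + 1) * (c powr \<alpha> - P))"
    unfolding c(3) by (simp add: algebra_simps)
  ultimately show ?thesis by simp
qed

text \<open>The identity \<open>quot\<close> writes the transverse part as a sum of squares. The
  square in the first coordinate contains a main term close to (\<alpha> + 1) P x, which cancels the
  linear part of the dispersion. The errors add up to 16 + 192 + 64 + 4 + 1 + 1 = 278.\<close>

lemma resonance_bound:
  assumes x: "\<gamma> \<le> x" "x \<le> 5/4 * \<gamma>" and y: "N \<le> y" "y \<le> N + \<gamma> / 4"
    and p1: "0 \<le> p1" "p1 \<le> \<kappa>" and q1: "0 \<le> q1" "q1 \<le> sqrt \<gamma>"
    and p2: "N * \<rho> \<le> p2" "p2 \<le> N * \<rho> + \<kappa>" and q2: "0 \<le> q2" "q2 \<le> sqrt \<gamma>"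
  shows "\<bar>x powr (\<alpha> + 1) + y powr (\<alpha> + 1) - (x + y) powr (\<alpha> + 1)
      + (p1\<^sup>2 + q1\<^sup>2) / x + (p2\<^sup>2 + q2\<^sup>2) / y - ((p1 + p2)\<^sup>2 + (q1 + q2)\<^sup>2) / (x + y)\<bar> \<le> 300"
proof -
  have x0: "0 < x" and y0: "0 < y" and xy: "x \<le> y" and xy0: "0 < x + y"
    using x y N gam_pos gam_le_1 by auto
  have quot: "a\<^sup>2 / x + b\<^sup>2 / y - (a + b)\<^sup>2 / (x + y) = (a * y - b * x)\<^sup>2 / (x * y * (x + y))" for a b
    using x0 y0 xy0 by (simp add: field_simps power2_eq_square)
  let ?D = "x * y * (x + y)"
  have D: "\<gamma> * y\<^sup>2 \<le> ?D" and D0: "0 < ?D"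
  proof -
    have "\<gamma> * y * y \<le> x * y * (x + y)" using x0 y0 x by (intro mult_mono) auto
    then show "\<gamma> * y\<^sup>2 \<le> ?D" by (simp add: power2_eq_square mult.assoc)
    show "0 < ?D" using x0 y0 by simp
  qed
  have diff_le: "\<bar>a * y - b * x\<bar> \<le> c * y" if "0 \<le> a" "a \<le> c" "0 \<le> b" "b \<le> c" for a b c
  proof -
    have "a * y \<le> c * y" "b * x \<le> c * y" "0 \<le> a * y" "0 \<le> b * x"
      using that x0 y0 xy by (auto intro!: mult_mono)
    then show ?thesis by simp
  qed
  have quad: "(a * y - b * x)\<^sup>2 / ?D \<le> c\<^sup>2 / \<gamma>" if "0 \<le> a" "a \<le> c" "0 \<le> b" "b \<le> c" for a b c
  proof -
    have "(a * y - b * x)\<^sup>2 \<le> (c * y)\<^sup>2"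
      using power_mono[OF diff_le[OF that], of 2] by simp
    then have "(a * y - b * x)\<^sup>2 / ?D \<le> (c * y)\<^sup>2 / (\<gamma> * y\<^sup>2)"
      using D gam_pos y0 by (intro frac_le) auto
    also have "\<dots> = c\<^sup>2 / \<gamma>" using y0 by (simp add: power_mult_distrib)
    finally show ?thesis .
  qed
  have second: "(q1 * y - q2 * x)\<^sup>2 / ?D \<le> 1"
    using quad[OF q1 q2] gam_pos by simp
  \<comment> \<open>The offset from the resonant point. With \<open>a\<close> collecting the
    deviations of both inputs, \<open>p1 * y - p2 * x\<close> becomes
    \<open>a - N * \<rho> * x\<close>; its square is estimated term by term as
    \<open>first_a\<close>, \<open>cross\<close> and \<open>main\<close>.\<close>
  define b where "b = p2 - N * \<rho>"
  have b: "0 \<le> b" "b \<le> \<kappa>" using p2 by (simp_all add: b_def)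
  define a where "a = p1 * y - b * x"
  have a: "\<bar>a\<bar> \<le> \<kappa> * y" unfolding a_def by (rule diff_le[OF p1 b])
  have first_a: "a\<^sup>2 / ?D \<le> 1"
  proof -
    have "a\<^sup>2 / ?D \<le> \<kappa>\<^sup>2 / \<gamma>" unfolding a_def by (rule quad[OF p1 b])
    also have "\<dots> \<le> 1" using kap_sq_le gam_pos by simp
    finally show ?thesis .
  qed
  have cross: "\<bar>2 * a * (N * \<rho> * x) / ?D\<bar> \<le> 4"
  proof -
    have "\<bar>2 * a * (N * \<rho> * x) / ?D\<bar> = \<bar>a\<bar> * (2 * (N * \<rho> * x) / ?D)"
      using N rho_pos x0 y0 by (simp add: abs_mult)
    also have "\<dots> \<le> (\<kappa> * y) * (2 * (N * \<rho> * x) / ?D)"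
      using N rho_pos x0 y0 by (intro mult_right_mono a) auto
    also have "\<dots> = 2 * (\<kappa> * \<rho>) * (N / (x + y))"
    proof -
      have "(\<kappa> * y) * (2 * (N * \<rho> * x) / (x * y * s)) = 2 * (\<kappa> * \<rho>) * (N / s)" for s
        using x0 y0 by simp
      then show ?thesis .
    qed
    also have "\<dots> \<le> 2 * 2 * 1"
      using kap_rho_le kap_pos rho_pos N x0 y y0 by (intro mult_mono) auto
    finally show ?thesis by simp
  qed
  \<comment> \<open>Replacing y (x + y) by N^2 is a relative error of at most 8 \<gamma> / N;
    multiplied by the main term, at most 8 P \<gamma>, it is again \<gamma>^2 P / N up to a
    constant.\<close>
  have main: "\<bar>(N * \<rho> * x)\<^sup>2 / ?D - (\<alpha> + 1) * P * x\<bar> \<le> 64"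
  proof -
    have s1: "y * (x + y) \<le> (N + 2 * \<gamma>) * (N + 2 * \<gamma>)"
      using x y y0 x0 gam_pos N by (intro mult_mono) auto
    have s2: "N * N \<le> y * (x + y)"
      using x0 y N by (intro mult_mono) auto
    have s3: "(N + 2 * \<gamma>) * (N + 2 * \<gamma>) - N * N \<le> 8 * \<gamma> * N"
    proof -
      have "(N + 2 * \<gamma>) * (N + 2 * \<gamma>) - N * N = 4 * \<gamma> * N + 4 * (\<gamma> * \<gamma>)" by (simp add: algebra_simps)
      moreover have "\<gamma> * \<gamma> \<le> \<gamma> * N" using gam_pos gam_le_1 N by (intro mult_left_mono) auto
      ultimately show ?thesis by (simp add: algebra_simps)
    qed
    have "(N * \<rho> * x)\<^sup>2 / ?D = (\<alpha> + 1) * P * x * (N * N) / (y * (x + y))"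
      using x0 by (simp add: rho_sq[unfolded power2_eq_square] power2_eq_square)
    then have "(\<alpha> + 1) * P * x - (N * \<rho> * x)\<^sup>2 / ?D = ((\<alpha> + 1) * P * x) * ((y * (x + y) - N * N) / (y * (x + y)))"
    proof -
      have "c - c * n / d = c * ((d - n) / d)" if "d > 0" for c n d :: real
        using that by (simp add: field_simps)
      from this[of "y * (x + y)" "(\<alpha> + 1) * P * x" "N * N"] y0 xy0 show ?thesis
        by (simp only: \<open>(N * \<rho> * x)\<^sup>2 / ?D = _\<close> mult_pos_pos)
    qed
    moreover have "\<dots> \<le> (4 * P * (2 * \<gamma>)) * ((8 * \<gamma> * N) / (N * N))"
      using s1 s2 s3 x x0 alpha P_pos gam_pos N y(1) y0 xy0 by (intro mult_mono frac_le) auto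
    moreover have "(4 * P * (2 * \<gamma>)) * ((8 * \<gamma> * N) / (N * N)) = 64 * (\<gamma>\<^sup>2 * P / N)"
      using N by (simp add: power2_eq_square)
    moreover have "0 \<le> ((\<alpha> + 1) * P * x) * ((y * (x + y) - N * N) / (y * (x + y)))"
      using s2 x0 y0 alpha P_pos by (intro mult_nonneg_nonneg divide_nonneg_nonneg) auto
    moreover have "64 * (\<gamma>\<^sup>2 * P / N) = 64" using N by (simp add: gam_sq)
    ultimately show ?thesis by linarith
  qed
  have first: "(p1 * y - p2 * x)\<^sup>2 / ?D = a\<^sup>2 / ?D - 2 * a * (N * \<rho> * x) / ?D + (N * \<rho> * x)\<^sup>2 / ?D"
  proof -
    have "p1 * y - p2 * x = a - N * \<rho> * x" by (simp add: a_def b_def algebra_simps)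
    then show ?thesis by (simp add: power2_diff diff_divide_distrib add_divide_distrib)
  qed
  have disp: "\<bar>(x + y) powr (\<alpha> + 1) - y powr (\<alpha> + 1) - (\<alpha> + 1) * P * x\<bar> \<le> 192"
    by (rule dispersion_increment) (use x x0 y in auto)
  have low: "0 \<le> x powr (\<alpha> + 1)" "x powr (\<alpha> + 1) \<le> 16"
  proof -
    have "x powr (\<alpha> + 1) \<le> 2 powr (\<alpha> + 1)"
      by (rule powr_mono2) (use x x0 gam_le_1 alpha in auto)
    also have "\<dots> \<le> 2 powr 4" by (rule powr_mono) (use alpha in auto)
    finally show "x powr (\<alpha> + 1) \<le> 16" by simp
  qed simp
  have "x powr (\<alpha> + 1) + y powr (\<alpha> + 1) - (x + y) powr (\<alpha> + 1)
      + (p1\<^sup>2 + q1\<^sup>2) / x + (p2\<^sup>2 + q2\<^sup>2) / y - ((p1 + p2)\<^sup>2 + (q1 + q2)\<^sup>2) / (x + y)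
    = x powr (\<alpha> + 1) + y powr (\<alpha> + 1) - (x + y) powr (\<alpha> + 1)
      + (p1 * y - p2 * x)\<^sup>2 / ?D + (q1 * y - q2 * x)\<^sup>2 / ?D"
    unfolding quot[symmetric] by (simp add: add_divide_distrib)
  moreover have "0 \<le> a\<^sup>2 / ?D" "0 \<le> (q1 * y - q2 * x)\<^sup>2 / ?D" using D0 by simp_all
  ultimately show ?thesis
    using first second first_a cross main disp low by linarith
qed

end

subsection \<open>Boxes of frequencies\<close>

definition brick :: "real \<Rightarrow> real \<Rightarrow> real \<Rightarrow> real \<Rightarrow> real \<Rightarrow> real \<Rightarrow> pt set" where
  "brick x a b l m n = cbox (x, vector [a, b]) (x + l, vector [a + m, b + n])"

lemma mem_brick:
  "\<zeta> \<in> brick x a b l m n \<longleftrightarrow> x \<le> fst \<zeta> \<and> fst \<zeta> \<le> x + l \<and>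
    a \<le> snd \<zeta> $ 1 \<and> snd \<zeta> $ 1 \<le> a + m \<and> b \<le> snd \<zeta> $ 2 \<and> snd \<zeta> $ 2 \<le> b + n"
  unfolding brick_def by (cases \<zeta>) (auto simp: cbox_Pair_eq mem_box_cart forall_2)

lemma brick_sets [measurable]: "brick x a b l m n \<in> sets borel"
  unfolding brick_def by simp

lemma measure_brick:
  assumes "0 \<le> l" "0 \<le> m" "0 \<le> n"
  shows "measure lborel (brick x a b l m n) = l * m * n"
proof -
  have "vector [a, b] \<in> cbox (vector [a, b]) (vector [a + m, b + n] :: real^2)"
    using assms by (simp add: mem_box_cart forall_2)
  then have "measure lborel (cbox (vector [a, b]) (vector [a + m, b + n] :: real^2)) = m * n"
    by (subst content_cbox_cart) (auto simp: UNIV_2)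
  then show ?thesis unfolding brick_def using assms by (simp add: content_Pair mult.assoc)
qed

lemma brick_finite: "emeasure lborel (brick x a b l m n) < \<infinity>"
  unfolding brick_def by (rule emeasure_lborel_cbox_finite)

lemma integrable_brick: "integrable lborel (indicat_real (brick x a b l m n))"
  using brick_finite by (intro integrable_real_indicator) auto

lemma bounded_brick: "bounded (brick x a b l m n)"
  unfolding brick_def by simp

lemma kp_symbol_eq:
  assumes "0 < fst \<zeta>"
  shows "kp_symbol \<alpha> \<zeta> = fst \<zeta> powr (\<alpha> + 1) + ((snd \<zeta> $ 1)\<^sup>2 + (snd \<zeta> $ 2)\<^sup>2) / fst \<zeta>"
proof -
  have "(norm (snd \<zeta>))\<^sup>2 = (snd \<zeta> $ 1)\<^sup>2 + (snd \<zeta> $ 2)\<^sup>2"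
    by (simp add: norm_vec_def L2_set_def sum_2 real_sqrt_pow2 sum_nonneg)
  then show ?thesis using assms by (simp add: kp_symbol_def powr_add)
qed

context resonance
begin

definition "D1 = brick \<gamma> 0 0 (\<gamma> / 4) \<kappa> (sqrt \<gamma>)"
definition "D2 = brick N (N * \<rho>) 0 (\<gamma> / 4) \<kappa> (sqrt \<gamma>)"
text \<open>A box of outputs inside D1 + D2, with margins such that each of its points is a sum u +
  v for every u in \<open>Qh\<close>, an eighth of \<open>D1\<close>, with v in \<open>D2\<close>.
  The convolution of the two indicators is therefore at least q / 8 on \<open>E\<close>.\<close>

definition "E = brick (N + \<gamma> + \<gamma> / 8) (N * \<rho> + \<kappa> / 2) (sqrt \<gamma> / 2) (\<gamma> / 8) (\<kappa> / 2) (sqrt \<gamma> / 2)"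
definition "Qh = brick \<gamma> 0 0 (\<gamma> / 8) (\<kappa> / 2) (sqrt \<gamma> / 2)"
definition "q = \<gamma> / 4 * \<kappa> * sqrt \<gamma>"

lemma q_pos: "0 < q" using gam_pos kap_pos by (simp add: q_def)

lemma measures: "measure lborel D1 = q" "measure lborel D2 = q" "measure lborel E = q / 8" "measure lborel Qh = q / 8"
  using gam_pos kap_pos by (simp_all add: D1_def D2_def E_def Qh_def measure_brick q_def)

lemma resonance_D1_D2:
  assumes "u \<in> D1" "v \<in> D2"
  shows "\<bar>kp_symbol \<alpha> u + kp_symbol \<alpha> v - kp_symbol \<alpha> (u + v)\<bar> \<le> 300"
proof -
  have u: "\<gamma> \<le> fst u" "fst u \<le> 5/4 * \<gamma>" "0 \<le> snd u $ 1" "snd u $ 1 \<le> \<kappa>" "0 \<le> snd u $ 2" "snd u $ 2 \<le> sqrt \<gamma>"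
    using assms(1) by (auto simp: D1_def mem_brick)
  have v: "N \<le> fst v" "fst v \<le> N + \<gamma> / 4" "N * \<rho> \<le> snd v $ 1" "snd v $ 1 \<le> N * \<rho> + \<kappa>" "0 \<le> snd v $ 2" "snd v $ 2 \<le> sqrt \<gamma>"
    using assms(2) by (auto simp: D2_def mem_brick)
  have "0 < fst u" "0 < fst v" "0 < fst (u + v)" using u(1) v(1) gam_pos N by auto
  then show ?thesis
    using resonance_bound[OF u(1,2) v(1,2) u(3-6) v(3-6)] by (simp add: kp_symbol_eq)
qed

lemma E_split: "\<zeta> \<in> E \<Longrightarrow> z \<in> Qh \<Longrightarrow> z \<in> D1 \<and> \<zeta> - z \<in> D2"
  using gam_pos kap_pos real_sqrt_ge_zero[of \<gamma>] by (auto simp: E_def Qh_def D1_def D2_def mem_brick)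

text \<open>The symmetrized datum also produces interactions such as D1 + D1 or D2 - D1. The first
  coordinate alone rules them out, since their sums miss the range from N + 9/8 \<gamma> to N + 5/4
  \<gamma> occupied by \<open>E\<close>.\<close>

lemma E_only:
  assumes zeta: "\<zeta> \<in> E" and z: "z \<in> D1 \<or> - z \<in> D1 \<or> z \<in> D2 \<or> - z \<in> D2"
    and w: "\<zeta> - z \<in> D1 \<or> - (\<zeta> - z) \<in> D1 \<or> \<zeta> - z \<in> D2 \<or> - (\<zeta> - z) \<in> D2"
  shows "z \<in> D1 \<and> \<zeta> - z \<in> D2 \<or> z \<in> D2 \<and> \<zeta> - z \<in> D1"
proof -
  have D1: "u \<in> D1 \<Longrightarrow> \<gamma> \<le> fst u \<and> fst u \<le> 5/4 * \<gamma>" and D2: "u \<in> D2 \<Longrightarrow> N \<le> fst u \<and> fst u \<le> N + \<gamma> / 4" for u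
    by (auto simp: D1_def D2_def mem_brick)
  have E: "N + 9/8 * \<gamma> \<le> fst \<zeta>" "fst \<zeta> \<le> N + 5/4 * \<gamma>" using zeta by (auto simp: E_def mem_brick)
  have "z \<in> D1 \<Longrightarrow> \<gamma> \<le> fst z \<and> fst z \<le> 5/4 * \<gamma>" "z \<in> D2 \<Longrightarrow> N \<le> fst z \<and> fst z \<le> N + \<gamma> / 4"
    "- z \<in> D1 \<Longrightarrow> \<gamma> \<le> - fst z \<and> - fst z \<le> 5/4 * \<gamma>" "- z \<in> D2 \<Longrightarrow> N \<le> - fst z \<and> - fst z \<le> N + \<gamma> / 4"
    "\<zeta> - z \<in> D1 \<Longrightarrow> \<gamma> \<le> fst \<zeta> - fst z \<and> fst \<zeta> - fst z \<le> 5/4 * \<gamma>"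
    "\<zeta> - z \<in> D2 \<Longrightarrow> N \<le> fst \<zeta> - fst z \<and> fst \<zeta> - fst z \<le> N + \<gamma> / 4"
    "- (\<zeta> - z) \<in> D1 \<Longrightarrow> \<gamma> \<le> fst z - fst \<zeta> \<and> fst z - fst \<zeta> \<le> 5/4 * \<gamma>"
    "- (\<zeta> - z) \<in> D2 \<Longrightarrow> N \<le> fst z - fst \<zeta> \<and> fst z - fst \<zeta> \<le> N + \<gamma> / 4"
    using D1[of z] D2[of z] D1[of "- z"] D2[of "- z"] D1[of "\<zeta> - z"] D2[of "\<zeta> - z"] D1[of "- (\<zeta> - z)"] D2[of "- (\<zeta> - z)"]
    by auto
  with z w E N gam_pos gam_le_1 show ?thesis by (elim disjE) (blast | linarith)+
qed

end

section \<open>The quadratic estimate implied by \<open>C\<^sup>2\<close>-differentiability\<close>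

lemma (in kp_data) p_weighted_L2: "weighted_L2 s1 s2 (p n t)"
proof (rule weighted_L2_of_rapid_decay[OF p_measurable])
  fix m
  have "norm (p n t \<zeta>) * (1 + (norm \<zeta>)\<^sup>2) ^ m \<le> (A * B ^ n * \<bar>t\<bar> ^ n / (real n + 1)\<^sup>2) * (1 + ((real n + 1) * R)\<^sup>2) ^ m" for \<zeta>
  proof (cases "p n t \<zeta> = 0")
    case True
    then show ?thesis
      by (auto intro!: divide_nonneg_nonneg mult_nonneg_nonneg A_nonneg B_nonneg zero_le_power)
  next
    case False
    have c: "0 \<le> A * B ^ n * \<bar>t\<bar> ^ n / (real n + 1)\<^sup>2"
      by (intro divide_nonneg_nonneg mult_nonneg_nonneg A_nonneg B_nonneg zero_le_power) auto
    have "norm (p n t \<zeta>) \<le> (A * B ^ n * \<bar>t\<bar> ^ n / (real n + 1)\<^sup>2) * 1"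
      by (rule order_trans[OF p_bound mult_left_mono[OF decay_le_1 c]])
    moreover have "(1 + (norm \<zeta>)\<^sup>2) ^ m \<le> (1 + ((real n + 1) * R)\<^sup>2) ^ m"
      by (intro power_mono add_left_mono p_support[OF False]) auto
    ultimately show ?thesis using c by (intro mult_mono) auto
  qed
  then show "\<exists>C. \<forall>\<zeta>. norm (p n t \<zeta>) * (1 + (norm \<zeta>)\<^sup>2) ^ m \<le> C" by blast
qed

lemma (in kp_data) f_weighted_L2: "weighted_L2 s1 s2 f"
proof -
  have "p 0 0 = f" by (rule ext) simp
  then show ?thesis using p_weighted_L2[of s1 s2 0 0] by simp
qed

text \<open>Schwartz test functions separate distributions, so testing identifies the second
  derivative at time \<open>t\<close> as twice the second Picard term. The constant \<open>K\<close>
  is fixed before \<open>A\<close>, \<open>R\<close> and \<open>f\<close>, so it serves data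
  concentrated at arbitrarily high frequency.\<close>

lemma quadratic_estimate:
  assumes X: "X = sobolev s1 s2 \<or> X = real_sobolev s1 s2" and T: "0 < T" and r: "0 < r"
    and unique: "\<And>u v. u \<in> points X \<Longrightarrow> nrm X u < r \<Longrightarrow> kp_solution \<alpha> X T u v \<Longrightarrow> v = \<Gamma> u"
    and C2: "C2_differentiable_at X (continuous_curves T X) \<Gamma> 0"
  obtains K where "0 \<le> K" "\<And>A R f t. kp_data A R f \<Longrightarrow> (\<And>\<zeta>. f (- \<zeta>) = cnj (f \<zeta>)) \<Longrightarrow> \<bar>t\<bar> \<le> T \<Longrightarrow>
    2 * weighted_L2_norm s1 s2 (picard \<alpha> f 1 t) \<le> K * (weighted_L2_norm s1 s2 f)\<^sup>2"
proof -
  let ?Y = "continuous_curves T X"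
  have sX: "seminormed X" using X seminormed_sobolev seminormed_real_sobolev by auto
  have sY: "seminormed ?Y" using seminormed_continuous_curves[OF sX] T by simp
  have nX: "nrm X = nrm (sobolev s1 s2)" using X by (auto simp: real_sobolev_simps)
  have pX: "u \<in> points (sobolev s1 s2)" if "u \<in> points X" for u
    using X that by (auto simp: real_sobolev_simps)
  obtain K where K: "K \<ge> 0" and Kb: "\<And>\<phi>. \<phi> \<in> points X \<Longrightarrow> \<exists>b\<in>points ?Y. nrm ?Y b \<le> K * (nrm X \<phi>)\<^sup>2 \<and>
     (\<forall>(l :: (real \<Rightarrow> distribution) \<Rightarrow> complex) C c \<rho>. (\<forall>u v. l (u + v) = l u + l v) \<longrightarrow> (\<forall>a u. l (a *\<^sub>R u) = a *\<^sub>R l u) \<longrightarrow>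
        (\<forall>v\<in>points ?Y. norm (l v) \<le> C * nrm ?Y v) \<longrightarrow> \<rho> > 0 \<longrightarrow>
        (\<forall>e. \<bar>e\<bar> < \<rho> \<longrightarrow> (\<lambda>n. c n * of_real e ^ n) sums l (\<Gamma> (e *\<^sub>R \<phi>))) \<longrightarrow> l b = 2 * c 2)"
    by (rule C2_quadratic_bound[OF sX sY C2]) blast
  show ?thesis
  proof (rule that[OF K])
    fix A R f t
    assume "kp_data A R f" and f: "\<And>\<zeta>. f (- \<zeta>) = cnj (f \<zeta>)" and t: "\<bar>t\<bar> \<le> T"
    then interpret kp_data \<alpha> A R f by simp
    define \<phi> where "\<phi> = inv_fourier_dist f"
    have phi: "\<phi> \<in> points X" and nphi: "nrm X \<phi> = weighted_L2_norm s1 s2 f"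
    proof -
      have "\<phi> \<in> points (sobolev s1 s2)" unfolding \<phi>_def points_sobolev using f_weighted_L2 by blast
      moreover have "real_valued \<phi>" unfolding \<phi>_def by (rule real_valued_inv_fourier_dist[OF f_measurable f])
      ultimately show "\<phi> \<in> points X" using X by (auto simp: real_sobolev_simps)
      show "nrm X \<phi> = weighted_L2_norm s1 s2 f" unfolding nX \<phi>_def by (rule nrm_sobolev[OF f_weighted_L2])
    qed
    obtain b where b: "b \<in> points ?Y" "nrm ?Y b \<le> K * (nrm X \<phi>)\<^sup>2"
      and bl0: "\<forall>(l :: (real \<Rightarrow> distribution) \<Rightarrow> complex) C c \<rho>. (\<forall>u v. l (u + v) = l u + l v) \<longrightarrow> (\<forall>a u. l (a *\<^sub>R u) = a *\<^sub>R l u) \<longrightarrow>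
        (\<forall>v\<in>points ?Y. norm (l v) \<le> C * nrm ?Y v) \<longrightarrow> \<rho> > 0 \<longrightarrow>
        (\<forall>e. \<bar>e\<bar> < \<rho> \<longrightarrow> (\<lambda>n. c n * of_real e ^ n) sums l (\<Gamma> (e *\<^sub>R \<phi>))) \<longrightarrow> l b = 2 * c 2"
      using Kb[OF phi] by (elim bexE conjE) (rule that; assumption)
    note bl = bl0[rule_format]
    \<comment> \<open>The first bound makes the series converge up to time \<open>T\<close>, the
      second keeps the datum in the ball where uniqueness is assumed. The summands 1 avoid division
      by zero.\<close>
    define \<rho> where "\<rho> = min (1 / (2 * (B * T + 1))) (r / (nrm X \<phi> + 1))"
    have n0: "0 \<le> nrm X \<phi>" by (rule seminormed_nonneg[OF sX phi])
    have BT: "0 \<le> B * T" using B_nonneg T by simp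
    have rho: "\<rho> > 0" using BT n0 r by (simp add: \<rho>_def add_nonneg_pos)
    have flow: "\<Gamma> (e *\<^sub>R \<phi>) t = inv_fourier_dist (sol e t)" and small: "\<bar>e\<bar> * (B * T) \<le> 1/2" if e: "\<bar>e\<bar> < \<rho>" for e
    proof -
      have "\<bar>e\<bar> * (B * T + 1) \<le> (1 / (2 * (B * T + 1))) * (B * T + 1)"
        using e BT by (intro mult_right_mono) (auto simp: \<rho>_def)
      also have "\<dots> = 1/2" using BT by (simp add: add_nonneg_eq_0_iff)
      finally show small: "\<bar>e\<bar> * (B * T) \<le> 1/2" using abs_ge_zero[of e] by (simp add: distrib_left)
      have "\<bar>e\<bar> * nrm X \<phi> \<le> \<bar>e\<bar> * (nrm X \<phi> + 1)" by (intro mult_left_mono) auto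
      also have "\<dots> < r" using e n0 by (simp add: \<rho>_def pos_less_divide_eq)
      finally have "nrm X (e *\<^sub>R \<phi>) < r" using seminormed_scale(2)[OF sX phi] by simp
      from unique[OF seminormed_scale(1)[OF sX phi] this, of "\<lambda>t. if t \<in> {-T..T} then inv_fourier_dist (sol e t) else 0"]
        kp_solution_sol[OF X f small T]
      have "(\<lambda>t. if t \<in> {-T..T} then inv_fourier_dist (sol e t) else 0) = \<Gamma> (e *\<^sub>R \<phi>)"
        by (simp only: \<phi>_def inv_fourier_dist_scale)
      from fun_cong[OF this, of t] show "\<Gamma> (e *\<^sub>R \<phi>) t = inv_fourier_dist (sol e t)"
        using t by (auto simp: abs_le_iff split: if_splits)
    qed
    have tT: "t \<in> {-T..T}" using t by auto
    have "b t \<in> points X" using b(1) tT by (simp add: continuous_curves_def)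
    then obtain g where g: "b t = inv_fourier_dist g" using pX unfolding points_sobolev by blast
    have "b t = inv_fourier_dist (\<lambda>\<zeta>. of_real 2 * p 1 t \<zeta>)"
    proof
      fix \<psi>
      show "b t \<psi> = inv_fourier_dist (\<lambda>\<zeta>. of_real 2 * p 1 t \<zeta>) \<psi>"
      proof (cases "\<psi> \<in> schwartz")
        \<comment> \<open>Outside Schwartz functions both sides are 0 by the convention in
          \<open>inv_fourier_dist\<close>; this is why \<open>b t\<close> was first written as such
          a distribution.\<close>
        case False
        then show ?thesis by (simp add: g inv_fourier_dist_def)
      next
        case True
        obtain C where C: "\<And>g. weighted_L2 s1 s2 g \<Longrightarrow> norm (inv_fourier_dist g \<psi>) \<le> C * weighted_L2_norm s1 s2 g"
          by (rule inv_fourier_dist_bounded[OF True, of s1 s2]) blast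
        \<comment> \<open>The shift of indices: the coefficient of e^n is iterate n - 1, so that
          \<open>c 2\<close> belongs to iterate 1.\<close>
        define c where "c n = (case n of 0 \<Rightarrow> 0 | Suc n \<Rightarrow> inv_fourier_dist (p n t) \<psi>)" for n
        have "(\<lambda>u. u t \<psi>) b = 2 * c 2"
        proof (rule bl[of "\<lambda>u. u t \<psi>" "max C 0", OF _ _ _ rho])
          fix v assume v: "v \<in> points ?Y"
          then have "v t \<in> points X" using tT by (simp add: continuous_curves_def)
          then obtain h where h: "weighted_L2 s1 s2 h" "v t = inv_fourier_dist h" using pX unfolding points_sobolev by blast
          have "norm (v t \<psi>) \<le> C * nrm X (v t)" unfolding h(2) nX nrm_sobolev[OF h(1)] by (rule C[OF h(1)])
          also have "\<dots> \<le> max C 0 * nrm X (v t)"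
            by (rule mult_right_mono) (simp_all add: seminormed_nonneg[OF sX \<open>v t \<in> points X\<close>])
          also have "\<dots> \<le> max C 0 * nrm ?Y v"
            by (rule mult_left_mono[OF nrm_le_nrm_continuous_curves[OF sX _ v tT]]) (use T in auto)
          finally show "norm (v t \<psi>) \<le> max C 0 * nrm ?Y v" .
        next
          fix e assume e: "\<bar>e\<bar> < \<rho>"
          have "(\<lambda>n. c (Suc n) * of_real e ^ Suc n) sums inv_fourier_dist (sol e t) \<psi>"
            using sol_pairing_sums[OF small[OF e] T t True] by (simp add: c_def mult.commute)
          then show "(\<lambda>n. c n * of_real e ^ n) sums \<Gamma> (e *\<^sub>R \<phi>) t \<psi>"
            unfolding flow[OF e] by (subst (asm) sums_Suc_iff) (simp add: c_def)
        qed (auto simp: plus_fun_def scaleR_fun_def)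
        then have "b t \<psi> = 2 * inv_fourier_dist (p 1 t) \<psi>" by (simp add: c_def numeral_2_eq_2)
        moreover have "inv_fourier_dist (\<lambda>\<zeta>. of_real 2 * p 1 t \<zeta>) \<psi> = 2 * inv_fourier_dist (p 1 t) \<psi>"
          unfolding inv_fourier_dist_scale scaleR_fun_def by (simp only: scaleR_conv_of_real of_real_numeral)
        ultimately show ?thesis by (simp only:)
      qed
    qed
    then have "nrm X (b t) = 2 * weighted_L2_norm s1 s2 (p 1 t)"
      unfolding nX by (simp only: nrm_sobolev[OF weighted_L2_scale[OF p_weighted_L2]] weighted_L2_norm_scale[OF p_weighted_L2])
    moreover have "nrm X (b t) \<le> nrm ?Y b"
      by (rule nrm_le_nrm_continuous_curves[OF sX _ b(1) tT]) (use T in simp)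
    ultimately show "2 * weighted_L2_norm s1 s2 (picard \<alpha> f 1 t) \<le> K * (weighted_L2_norm s1 s2 f)\<^sup>2"
      using b(2) nphi by simp
  qed
qed

section \<open>Failure of the quadratic estimate\<close>

lemma cos_ge_half: "1 / 2 \<le> cos x" if "\<bar>x\<bar> \<le> 1" for x :: real
proof -
  have "\<bar>sin (x / 2)\<bar> \<le> \<bar>x / 2\<bar>" by (rule abs_sin_x_le_abs_x)
  also have "\<dots> \<le> 1 / 2" using that by simp
  finally have "(sin (x / 2))\<^sup>2 \<le> (1 / 2)\<^sup>2" using abs_le_square_iff[of "sin (x / 2)" "1 / 2"] by simp
  then show ?thesis using cos_double_sin[of "x / 2"] by (simp add: power2_eq_square)
qed

text \<open>For a nonnegative amplitude only the oscillation of the phase can cause cancellation. Up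
  to time \<open>t\<close> the phase is at most 1 in absolute value, its cosine at least 1/2, and
  the integral over time and frequency keeps at least half of its unoscillating size.\<close>

lemma (in kp_data) norm_picard_1_ge:
  assumes f: "\<And>\<zeta>. f \<zeta> = of_real (a \<zeta>)" and a [measurable]: "a \<in> borel_measurable borel" and a0: "\<And>\<zeta>. 0 \<le> a \<zeta>"
    and t: "0 < t"
    and nonres: "\<And>z. a z * a (\<zeta> - z) \<noteq> 0 \<Longrightarrow> t * \<bar>kp_symbol \<alpha> z + kp_symbol \<alpha> (\<zeta> - z) - kp_symbol \<alpha> \<zeta>\<bar> \<le> 1"
  shows "\<bar>fst \<zeta>\<bar> / (2 * pi) ^ 3 * (t / 2 * (LINT z|lborel. a z * a (\<zeta> - z))) \<le> norm (p 1 t \<zeta>)"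
    and "integrable lborel (\<lambda>z. a z * a (\<zeta> - z))"
proof -
  let ?c = "complex_of_real ((2 * pi) ^ 3)"
  define w where "w z = kp_symbol \<alpha> z + kp_symbol \<alpha> (\<zeta> - z) - kp_symbol \<alpha> \<zeta>" for z
  have [measurable]: "w \<in> borel_measurable borel" unfolding w_def by measurable
  define g where "g z = a z * a (\<zeta> - z)" for z
  have [measurable]: "g \<in> borel_measurable borel" unfolding g_def by measurable
  have g0: "0 \<le> g z" for z unfolding g_def by (simp add: a0)
  have ab: "a z \<le> A * decay z" for z using f_bound[of z] a0[of z] by (simp add: f)
  have gb: "g z \<le> (A * A) * (decay z * decay (\<zeta> - z))" for z
  proof -
    have "g z \<le> (A * decay z) * (A * decay (\<zeta> - z))" unfolding g_def
      by (intro mult_mono ab a0 mult_nonneg_nonneg A_nonneg decay_nonneg)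
    then show ?thesis by (simp add: mult_ac)
  qed
  define F where "F s z = cis (s * w z) * of_real (g z)" for s z
  have Fb: "norm (F s z) \<le> (A * A) * (decay z * decay (\<zeta> - z))" for s z
    using gb[of z] g0[of z] by (simp add: F_def norm_mult)
  have [measurable]: "F s \<in> borel_measurable borel" for s unfolding F_def by measurable
  have AA: "0 \<le> A * A" by simp
  have Fi: "integrable lborel (F s)" for s by (rule integrable_decay_conv_bound[OF Fb AA]) measurable
  have "integrable lborel (\<lambda>z. Re (F 0 z))" using Fi by (rule integrable_Re)
  then have gi: "integrable lborel g" by (simp add: F_def)
  moreover have "g = (\<lambda>z. a z * a (\<zeta> - z))" by (rule ext) (rule g_def)
  ultimately show "integrable lborel (\<lambda>z. a z * a (\<zeta> - z))" by simp
  define J where "J s = (LINT z|lborel. F s z)" for s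
  have Jb: "norm (J s) \<le> (A * A) * (conv_const * decay \<zeta>) * \<bar>s\<bar> ^ 0" for s
    unfolding J_def using norm_decay_conv_le(1)[OF Fb AA] by simp
  have Jm [measurable]: "J \<in> borel_measurable borel" unfolding J_def F_def by measurable
  have M0: "0 \<le> (A * A) * (conv_const * decay \<zeta>)" using conv_const(1) decay_nonneg[of \<zeta>] by simp
  have Ji: "integrable lborel (\<lambda>s. osign t s *\<^sub>R J s)"
    by (rule norm_osign_integral_le(2)[OF Jb M0]) measurable
  \<comment> \<open>Taking out the phase of the output leaves only the resonance function
    \<open>w\<close> in the integrand.\<close>
  have conv: "fconv (p 0 s) (p 0 s) \<zeta> = cis (s * kp_symbol \<alpha> \<zeta>) * J s / ?c" for s
  proof -
    have "p 0 s z * p 0 s (\<zeta> - z) = cis (s * kp_symbol \<alpha> \<zeta>) * F s z" for z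
    proof -
      have "cis (s * kp_symbol \<alpha> z) * cis (s * kp_symbol \<alpha> (\<zeta> - z)) = cis (s * kp_symbol \<alpha> \<zeta>) * cis (s * w z)"
        by (simp add: cis_mult w_def algebra_simps)
      then show ?thesis by (simp add: F_def g_def f mult_ac)
    qed
    then show ?thesis by (simp add: fconv_def J_def del: picard.simps)
  qed
  have p1: "p 1 t \<zeta> = (cis (t * kp_symbol \<alpha> \<zeta>) * (\<i> * of_real (fst \<zeta>)) / ?c) * (LINT s|lborel. osign t s *\<^sub>R J s)"
  proof -
    have "p 1 t \<zeta> = (LINT s|lborel. osign t s *\<^sub>R (cis ((t - s) * kp_symbol \<alpha> \<zeta>) * (\<i> * of_real (fst \<zeta>)) * fconv (p 0 s) (p 0 s) \<zeta>))"
      by (simp add: duhamel_def del: picard.simps(1))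
    also have "\<dots> = (LINT s|lborel. (cis (t * kp_symbol \<alpha> \<zeta>) * (\<i> * of_real (fst \<zeta>)) / ?c) * (osign t s *\<^sub>R J s))"
    proof (rule Bochner_Integration.integral_cong)
      fix s
      have "cis ((t - s) * kp_symbol \<alpha> \<zeta>) * cis (s * kp_symbol \<alpha> \<zeta>) = cis (t * kp_symbol \<alpha> \<zeta>)"
        by (simp add: cis_mult algebra_simps)
      from this[symmetric] show "osign t s *\<^sub>R (cis ((t - s) * kp_symbol \<alpha> \<zeta>) * (\<i> * of_real (fst \<zeta>)) * fconv (p 0 s) (p 0 s) \<zeta>) =
          (cis (t * kp_symbol \<alpha> \<zeta>) * (\<i> * of_real (fst \<zeta>)) / ?c) * (osign t s *\<^sub>R J s)"
        unfolding conv by (simp add: scaleR_conv_of_real mult_ac)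
    qed simp
    also have "\<dots> = (cis (t * kp_symbol \<alpha> \<zeta>) * (\<i> * of_real (fst \<zeta>)) / ?c) * (LINT s|lborel. osign t s *\<^sub>R J s)"
      by (rule integral_mult_right_zero)
    finally show ?thesis .
  qed
  define m where "m = (LINT z|lborel. g z)"
  have ReJ: "m / 2 \<le> Re (J s)" if s: "0 < s" "s < t" for s
  proof -
    have "m / 2 = (LINT z|lborel. 1 / 2 * g z)" by (simp add: m_def)
    also have "\<dots> \<le> (LINT z|lborel. Re (F s z))"
    proof (rule integral_mono)
      show "1 / 2 * g z \<le> Re (F s z)" for z
      proof (cases "g z = 0")
        case False
        have "\<bar>s * w z\<bar> \<le> t * \<bar>w z\<bar>" using s by (simp add: abs_mult mult_right_mono)
        also have "\<dots> \<le> 1" using nonres[of z] False by (simp add: g_def w_def)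
        finally show ?thesis
          using mult_right_mono[OF cos_ge_half g0[of z]] by (simp add: F_def)
      qed (simp add: F_def)
    qed (use gi Fi in \<open>auto intro: integrable_Re\<close>)
    also have "\<dots> = Re (J s)" unfolding J_def by (rule integral_Re[OF Fi])
    finally show ?thesis .
  qed
  have os: "\<bar>osign t s\<bar> = osign t s" for s using t by (simp add: osign_def)
  have oi: "integrable lborel (\<lambda>s. osign t s)" "(LINT s|lborel. osign t s) = t"
    using integrable_osign_power[of t 0] integral_osign_power[of t 0] t by (simp_all add: os)
  have "t / 2 * m = (LINT s|lborel. osign t s * (m / 2))" using oi by simp
  also have "\<dots> \<le> (LINT s|lborel. Re (osign t s *\<^sub>R J s))"
  proof (rule integral_mono)
    show "osign t s * (m / 2) \<le> Re (osign t s *\<^sub>R J s)" for s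
      using ReJ[of s] t by (auto simp: osign_def)
  qed (use oi Ji in \<open>auto intro: integrable_Re simp del: scaleR_complex.simps\<close>)
  also have "\<dots> = Re (LINT s|lborel. osign t s *\<^sub>R J s)" by (rule integral_Re[OF Ji])
  also have "\<dots> \<le> norm (LINT s|lborel. osign t s *\<^sub>R J s)" by (rule complex_Re_le_cmod)
  finally have "\<bar>fst \<zeta>\<bar> / (2 * pi) ^ 3 * (t / 2 * m) \<le> \<bar>fst \<zeta>\<bar> / (2 * pi) ^ 3 * norm (LINT s|lborel. osign t s *\<^sub>R J s)"
    by (rule mult_left_mono) simp
  also have "\<dots> = norm (p 1 t \<zeta>)"
    unfolding p1 by (simp add: norm_mult norm_divide norm_power)
  finally show "\<bar>fst \<zeta>\<bar> / (2 * pi) ^ 3 * (t / 2 * (LINT z|lborel. a z * a (\<zeta> - z))) \<le> norm (p 1 t \<zeta>)"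
    by (simp add: m_def g_def)
qed

section \<open>Comparison of Sobolev weights, and the size of the datum and of its second Picard
  term\<close>

lemma bracket_le_double: "bracket v \<le> 2 * bracket w" if "norm v \<le> 2 * norm w"
proof -
  have "1 + (norm v)\<^sup>2 \<le> 1 + (2 * norm w)\<^sup>2" using that by (intro add_left_mono power_mono) auto
  also have "\<dots> \<le> 2\<^sup>2 * (1 + (norm w)\<^sup>2)" by (simp add: power_mult_distrib)
  finally have "sqrt (1 + (norm v)\<^sup>2) \<le> sqrt (2\<^sup>2 * (1 + (norm w)\<^sup>2))" by (rule real_sqrt_le_mono)
  also have "\<dots> = 2 * sqrt (1 + (norm w)\<^sup>2)" by (simp only: real_sqrt_mult real_sqrt_pow2_iff real_sqrt_power) simp
  finally show ?thesis by (simp only: bracket_def)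
qed

lemma powr_le_powr_of_comparable:
  fixes a b s :: real
  assumes "0 < a" "0 < b" "a \<le> 2 * b" "b \<le> 2 * a"
  shows "a powr s \<le> 2 powr \<bar>s\<bar> * b powr s"
proof (cases "0 \<le> s")
  case True
  have "a powr s \<le> (2 * b) powr s" by (rule powr_mono2) (use assms True in auto)
  then show ?thesis using True assms by (simp add: powr_mult)
next
  case False
  have "a powr s \<le> (b / 2) powr s" by (rule powr_mono2') (use assms False in auto)
  then show ?thesis using False assms by (simp add: powr_divide powr_minus field_simps)
qed

lemma sobolev_weight_comparable:
  assumes "\<bar>fst \<zeta>\<bar> \<le> 2 * \<bar>fst \<zeta>'\<bar>" "\<bar>fst \<zeta>'\<bar> \<le> 2 * \<bar>fst \<zeta>\<bar>"
    and "norm (snd \<zeta>) \<le> 2 * norm (snd \<zeta>')" "norm (snd \<zeta>') \<le> 2 * norm (snd \<zeta>)"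
  shows "sobolev_weight s1 s2 \<zeta> \<le> 2 powr (\<bar>s1\<bar> + \<bar>s2\<bar>) * sobolev_weight s1 s2 \<zeta>'"
proof -
  have "bracket (fst \<zeta>) powr s1 * bracket (snd \<zeta>) powr s2 \<le>
      (2 powr \<bar>s1\<bar> * bracket (fst \<zeta>') powr s1) * (2 powr \<bar>s2\<bar> * bracket (snd \<zeta>') powr s2)"
    by (intro mult_mono powr_le_powr_of_comparable bracket_pos bracket_le_double) (use assms in auto)
  then show ?thesis by (simp add: sobolev_weight_def case_prod_unfold powr_add mult_ac)
qed

lemma sobolev_weight_minus: "sobolev_weight s1 s2 (- \<zeta>) = sobolev_weight s1 s2 \<zeta>"
  by (simp add: sobolev_weight_def case_prod_unfold bracket_def)

lemma sobolev_weight_le_4: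
  assumes "bracket (fst \<zeta>) \<le> 4" "bracket (snd \<zeta>) \<le> 4"
  shows "sobolev_weight s1 s2 \<zeta> \<le> 4 powr (\<bar>s1\<bar> + \<bar>s2\<bar>)"
proof -
  have b: "x powr s \<le> 4 powr \<bar>s\<bar>" if "1 \<le> x" "x \<le> 4" for x s :: real
  proof -
    have "x powr s \<le> x powr \<bar>s\<bar>" by (rule powr_mono) (use that in auto)
    also have "\<dots> \<le> 4 powr \<bar>s\<bar>" by (rule powr_mono2) (use that in auto)
    finally show ?thesis .
  qed
  have "bracket (fst \<zeta>) powr s1 * bracket (snd \<zeta>) powr s2 \<le> 4 powr \<bar>s1\<bar> * 4 powr \<bar>s2\<bar>"
    by (intro mult_mono b bracket_ge_1 assms) auto
  then show ?thesis by (simp add: sobolev_weight_def case_prod_unfold powr_add)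
qed

context resonance
begin

context
  fixes s1 s2 :: real
begin

definition "base = (N, vector [N * \<rho>, 0] :: real^2)"
definition "W = sobolev_weight s1 s2 base"
text \<open>Dividing the high part by \<open>W\<close>, the weight at its corner, gives both parts a
  norm of order sqrt q, whatever \<open>s1\<close> and \<open>s2\<close> are. The reflected copies
  make the amplitude even, hence the datum real.\<close>

definition "amp \<zeta> = indicat_real D1 \<zeta> + indicat_real D1 (- \<zeta>) + (indicat_real D2 \<zeta> + indicat_real D2 (- \<zeta>)) / W"

lemma W_pos: "0 < W"
  unfolding W_def by (rule sobolev_weight_pos)

lemma norm_real2_bounds: "\<bar>v $ 1\<bar> \<le> norm v" "norm v \<le> \<bar>v $ 1\<bar> + \<bar>v $ 2\<bar>" for v :: "real^2"
  using component_le_norm_cart[of v 1] norm_le_l1_cart[of v] by (simp_all add: sum_2)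

lemma sqrt_gam_le_1: "sqrt \<gamma> \<le> 1" "0 \<le> sqrt \<gamma>"
  using gam_le_1 gam_pos by simp_all

text \<open>The box extends by at most 2 in each direction, while the frequencies \<open>N\<close>
  and N \<rho> are at least 10, so both brackets change at most by a factor 2.\<close>

lemma weight_comparable_base:
  assumes "N \<le> fst \<zeta>" "fst \<zeta> \<le> N + 2" "N * \<rho> \<le> snd \<zeta> $ 1" "snd \<zeta> $ 1 \<le> N * \<rho> + 2" "0 \<le> snd \<zeta> $ 2" "snd \<zeta> $ 2 \<le> 2"
  shows "sobolev_weight s1 s2 \<zeta> \<le> 2 powr (\<bar>s1\<bar> + \<bar>s2\<bar>) * W" "W \<le> 2 powr (\<bar>s1\<bar> + \<bar>s2\<bar>) * sobolev_weight s1 s2 \<zeta>"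
proof -
  have Nr: "10 \<le> N * \<rho>" using mult_mono[of 10 N 1 \<rho>] N rho_ge_1 by simp
  have b: "norm (snd base) = N * \<rho>"
    using norm_real2_bounds[of "snd base"] Nr by (simp add: base_def)
  have z: "N * \<rho> \<le> norm (snd \<zeta>)" "norm (snd \<zeta>) \<le> N * \<rho> + 4"
    using norm_real2_bounds[of "snd \<zeta>"] assms Nr by linarith+
  show "sobolev_weight s1 s2 \<zeta> \<le> 2 powr (\<bar>s1\<bar> + \<bar>s2\<bar>) * W" "W \<le> 2 powr (\<bar>s1\<bar> + \<bar>s2\<bar>) * sobolev_weight s1 s2 \<zeta>"
    unfolding W_def using assms N Nr z
    by (intro sobolev_weight_comparable; simp add: b; simp add: base_def)+
qed

lemma weight_D1: "\<zeta> \<in> D1 \<Longrightarrow> sobolev_weight s1 s2 \<zeta> \<le> 4 powr (\<bar>s1\<bar> + \<bar>s2\<bar>)"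
proof (rule sobolev_weight_le_4)
  assume z: "\<zeta> \<in> D1"
  have b4: "bracket v \<le> 4" if "norm v \<le> 2" for v :: "'a::real_normed_vector"
  proof -
    have "1 + (norm v)\<^sup>2 \<le> 1 + 2\<^sup>2" using that by (intro add_left_mono power_mono) auto
    then have "sqrt (1 + (norm v)\<^sup>2) \<le> sqrt (4\<^sup>2)" by (intro real_sqrt_le_mono) simp
    then show ?thesis by (simp add: bracket_def)
  qed
  have "\<gamma> \<le> fst \<zeta>" "fst \<zeta> \<le> \<gamma> + \<gamma> / 4" and eta: "0 \<le> snd \<zeta> $ 1" "snd \<zeta> $ 1 \<le> \<kappa>" "0 \<le> snd \<zeta> $ 2" "snd \<zeta> $ 2 \<le> sqrt \<gamma>"
    using z unfolding D1_def mem_brick by linarith+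
  then show "bracket (fst \<zeta>) \<le> 4" using gam_le_1 gam_pos by (intro b4) auto
  show "bracket (snd \<zeta>) \<le> 4"
    using eta kap_le_1 sqrt_gam_le_1 norm_real2_bounds(2)[of "snd \<zeta>"] by (intro b4; linarith)
qed

lemma weight_D2: "\<zeta> \<in> D2 \<Longrightarrow> sobolev_weight s1 s2 \<zeta> \<le> 2 powr (\<bar>s1\<bar> + \<bar>s2\<bar>) * W"
  using gam_le_1 gam_pos kap_le_1 kap_pos sqrt_gam_le_1 unfolding D2_def mem_brick
  by (elim conjE, intro weight_comparable_base(1); linarith)

lemma weight_E: "\<zeta> \<in> E \<Longrightarrow> W \<le> 2 powr (\<bar>s1\<bar> + \<bar>s2\<bar>) * sobolev_weight s1 s2 \<zeta>"
  using gam_le_1 gam_pos kap_le_1 kap_pos sqrt_gam_le_1 unfolding E_def mem_brick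
  by (elim conjE, intro weight_comparable_base(2); linarith)

lemma D_sets [measurable]: "D1 \<in> sets borel" "D2 \<in> sets borel" "E \<in> sets borel" "Qh \<in> sets borel"
  by (simp_all add: D1_def D2_def E_def Qh_def)

lemma amp_measurable [measurable]: "amp \<in> borel_measurable borel"
  unfolding amp_def by measurable

lemma amp_nonneg: "0 \<le> amp \<zeta>"
  using W_pos by (simp add: amp_def)

lemma amp_minus: "amp (- \<zeta>) = amp \<zeta>"
  by (simp add: amp_def)

lemma amp_support: "amp \<zeta> \<noteq> 0 \<Longrightarrow> \<zeta> \<in> D1 \<or> - \<zeta> \<in> D1 \<or> \<zeta> \<in> D2 \<or> - \<zeta> \<in> D2"
  by (auto simp: amp_def indicator_def split: if_splits)

text \<open>The bounds \<open>A\<close> and \<open>R\<close> obtained here depend on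
  \<open>N\<close>, but the constant of the quadratic estimate does not depend on them.\<close>

lemma kp_data_amp: "\<exists>A R. kp_data A R (\<lambda>\<zeta>. of_real (amp \<zeta>))"
proof -
  have "bounded (D1 \<union> D2)" by (simp add: D1_def D2_def bounded_brick)
  then obtain R where R: "0 < R" "\<And>\<zeta>. \<zeta> \<in> D1 \<union> D2 \<Longrightarrow> norm \<zeta> \<le> R"
    unfolding bounded_pos by blast
  have supp: "norm \<zeta> \<le> R" if "amp \<zeta> \<noteq> 0" for \<zeta>
    using amp_support[OF that] R(2)[of \<zeta>] R(2)[of "- \<zeta>"] by auto
  have le: "amp \<zeta> \<le> 2 + 2 / W" for \<zeta>
  proof -
    have "(indicat_real D2 \<zeta> + indicat_real D2 (- \<zeta>)) / W \<le> 2 / W"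
      using W_pos by (intro divide_right_mono) (auto simp: indicator_def)
    then show ?thesis by (simp add: amp_def indicator_def)
  qed
  have "kp_data ((2 + 2 / W) * (1 + R\<^sup>2) ^ 3) R (\<lambda>\<zeta>. of_real (amp \<zeta>))"
  proof
    show "norm (complex_of_real (amp \<zeta>)) \<le> (2 + 2 / W) * (1 + R\<^sup>2) ^ 3 * decay \<zeta>" for \<zeta>
    proof (rule le_decay, cases "amp \<zeta> = 0")
      case True
      then show "norm (complex_of_real (amp \<zeta>)) * (1 + (norm \<zeta>)\<^sup>2) ^ 3 \<le> (2 + 2 / W) * (1 + R\<^sup>2) ^ 3"
        using W_pos by simp
    next
      case False
      then show "norm (complex_of_real (amp \<zeta>)) * (1 + (norm \<zeta>)\<^sup>2) ^ 3 \<le> (2 + 2 / W) * (1 + R\<^sup>2) ^ 3"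
        using le[of \<zeta>] amp_nonneg[of \<zeta>] supp[OF False] W_pos
        by (intro mult_mono power_mono add_left_mono) auto
    qed
  qed (use supp R(1) in auto)
  then show ?thesis by blast
qed

lemma amp_norm_le:
  "(weighted_L2_norm s1 s2 (\<lambda>\<zeta>. of_real (amp \<zeta>)))\<^sup>2 \<le> 16 * (4 powr (\<bar>s1\<bar> + \<bar>s2\<bar>))\<^sup>2 * q"
proof -
  let ?c = "4 powr (\<bar>s1\<bar> + \<bar>s2\<bar>) :: real" and ?w = "sobolev_weight s1 s2"
  let ?i = "\<lambda>\<zeta>. indicat_real D1 \<zeta> + indicat_real D1 (0 - \<zeta>) + indicat_real D2 \<zeta> + indicat_real D2 (0 - \<zeta>)"
  have i: "integrable lborel (indicat_real D1)" "integrable lborel (indicat_real D2)"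
    by (simp_all add: D1_def D2_def integrable_brick)
  have i': "integrable lborel (\<lambda>\<zeta>. indicat_real D1 (0 - \<zeta>))" "integrable lborel (\<lambda>\<zeta>. indicat_real D2 (0 - \<zeta>))"
    by (rule lborel_integral_reflect(2)[OF _ i(1)], simp) (rule lborel_integral_reflect(2)[OF _ i(2)], simp)
  have int: "integrable lborel ?i" using i i' by simp
  have "(LINT \<zeta>|lborel. ?i \<zeta>) = q + q + q + q"
    using i i' lborel_integral_reflect(1)[of "indicat_real D1" 0] lborel_integral_reflect(1)[of "indicat_real D2" 0]
    by (simp add: measures)
  then have tot: "(LINT \<zeta>|lborel. 4 * ?c\<^sup>2 * ?i \<zeta>) = 16 * ?c\<^sup>2 * q" by simp
  have pw: "(?w \<zeta> * norm (complex_of_real (amp \<zeta>)))\<^sup>2 \<le> 4 * ?c\<^sup>2 * ?i \<zeta>" for \<zeta>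
  proof -
    have w0: "0 \<le> ?w \<zeta>" using sobolev_weight_pos[of s1 s2 \<zeta>] by simp
    have c2: "2 powr (\<bar>s1\<bar> + \<bar>s2\<bar>) \<le> ?c" by (rule powr_mono2) auto
    have d1: "?w \<zeta> * indicat_real D1 v \<le> ?c * indicat_real D1 v" if "v = \<zeta> \<or> v = - \<zeta>" for v
      using weight_D1[of v] that by (auto simp: indicator_def sobolev_weight_minus)
    have d2: "?w \<zeta> * (indicat_real D2 v / W) \<le> ?c * indicat_real D2 v" if "v = \<zeta> \<or> v = - \<zeta>" for v
    proof (cases "v \<in> D2")
      case True
      have "?w \<zeta> \<le> ?c * W"
        using order_trans[OF weight_D2[OF True] mult_right_mono[OF c2 less_imp_le[OF W_pos]]] that
        by (auto simp: sobolev_weight_minus)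
      then show ?thesis using True W_pos by (simp add: pos_divide_le_eq)
    qed simp
    have "?w \<zeta> * amp \<zeta> = ?w \<zeta> * indicat_real D1 \<zeta> + ?w \<zeta> * indicat_real D1 (- \<zeta>) + ?w \<zeta> * (indicat_real D2 \<zeta> / W) + ?w \<zeta> * (indicat_real D2 (- \<zeta>) / W)"
      by (simp add: amp_def algebra_simps add_divide_distrib)
    also have "\<dots> \<le> ?c * indicat_real D1 \<zeta> + ?c * indicat_real D1 (- \<zeta>) + ?c * indicat_real D2 \<zeta> + ?c * indicat_real D2 (- \<zeta>)"
      by (intro add_mono d1 d2) auto
    also have "\<dots> = ?c * ?i \<zeta>" by (simp add: distrib_left)
    finally have "(?w \<zeta> * amp \<zeta>)\<^sup>2 \<le> (?c * ?i \<zeta>)\<^sup>2"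
      by (rule power_mono) (simp add: w0 amp_nonneg)
    also have "\<dots> = ?c\<^sup>2 * (?i \<zeta>)\<^sup>2" by (simp only: power_mult_distrib)
    \<comment> \<open>The sum of four indicators takes values between 0 and 4, so its square is at
      most four times itself. Its integral is 4 q, which makes the total factor 16.\<close>
    also have "\<dots> \<le> ?c\<^sup>2 * (4 * ?i \<zeta>)"
      by (rule mult_left_mono) (auto simp: indicator_def)
    also have "\<dots> = 4 * ?c\<^sup>2 * ?i \<zeta>" by (simp only: mult_ac)
    also have "amp \<zeta> = norm (complex_of_real (amp \<zeta>))" using amp_nonneg[of \<zeta>] by simp
    finally show ?thesis .
  qed
  have "(LINT \<zeta>|lborel. (?w \<zeta> * norm (complex_of_real (amp \<zeta>)))\<^sup>2) \<le> (LINT \<zeta>|lborel. 4 * ?c\<^sup>2 * ?i \<zeta>)"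
    by (rule integral_mono'[OF integrable_mult_right[OF int] pw]) (simp add: indicator_def)
  then show ?thesis unfolding tot weighted_L2_norm_def by simp
qed

text \<open>For \<open>t \<le> 1/300\<close> the resonance bound 300 keeps the phase below 1. On
  \<open>E\<close> the output is then at least a constant times N t q / W, where the weight is
  comparable to \<open>W\<close>; the two cancel, and \<open>s1\<close> and \<open>s2\<close>
  survive only in a constant factor. The 16 is 2 from the cosine times 8 from the size of
  \<open>Qh\<close>.\<close>

lemma picard_amp_norm_ge:
  assumes t: "0 < t" "t \<le> 1/300"
  shows "(N * t * q / (16 * (2 * pi) ^ 3 * 2 powr (\<bar>s1\<bar> + \<bar>s2\<bar>)))\<^sup>2 * (q / 8) \<le> (weighted_L2_norm s1 s2 (picard \<alpha> (\<lambda>\<zeta>. of_real (amp \<zeta>)) 1 t))\<^sup>2"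
proof -
  let ?w = "sobolev_weight s1 s2" and ?d = "2 powr (\<bar>s1\<bar> + \<bar>s2\<bar>) :: real" and ?f = "\<lambda>\<zeta>. complex_of_real (amp \<zeta>)"
  define L where "L = N * t * q / (16 * (2 * pi) ^ 3 * ?d)"
  have L0: "0 \<le> L" unfolding L_def using N t q_pos by simp
  obtain A R where "kp_data A R ?f" using kp_data_amp by blast
  then interpret kp_data \<alpha> A R ?f .
  have ptw: "L \<le> ?w \<zeta> * norm (p 1 t \<zeta>)" if z: "\<zeta> \<in> E" for \<zeta>
  proof -
    have nonres: "t * \<bar>kp_symbol \<alpha> u + kp_symbol \<alpha> (\<zeta> - u) - kp_symbol \<alpha> \<zeta>\<bar> \<le> 1" if nz: "amp u * amp (\<zeta> - u) \<noteq> 0" for u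
    proof -
      have "u \<in> D1 \<and> \<zeta> - u \<in> D2 \<or> u \<in> D2 \<and> \<zeta> - u \<in> D1"
        by (rule E_only[OF z amp_support amp_support]) (use nz in auto)
      then have "\<bar>kp_symbol \<alpha> u + kp_symbol \<alpha> (\<zeta> - u) - kp_symbol \<alpha> \<zeta>\<bar> \<le> 300"
        using resonance_D1_D2[of u "\<zeta> - u"] resonance_D1_D2[of "\<zeta> - u" u] by (auto simp: add.commute)
      then have "t * \<bar>kp_symbol \<alpha> u + kp_symbol \<alpha> (\<zeta> - u) - kp_symbol \<alpha> \<zeta>\<bar> \<le> 1/300 * 300"
        using t by (intro mult_mono) auto
      then show ?thesis by simp
    qed
    note lower = norm_picard_1_ge[OF refl amp_measurable amp_nonneg t(1) nonres]
    have "q / 8 / W = (LINT u|lborel. indicat_real Qh u / W)"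
      by (simp add: measures)
    also have "\<dots> \<le> (LINT u|lborel. amp u * amp (\<zeta> - u))"
    proof (rule integral_mono'[OF lower(2)])
      fix u
      show "0 \<le> amp u * amp (\<zeta> - u)" by (simp add: amp_nonneg)
      show "indicat_real Qh u / W \<le> amp u * amp (\<zeta> - u)"
      proof (cases "u \<in> Qh")
        case True
        then have "u \<in> D1" "\<zeta> - u \<in> D2" using E_split[OF z] by auto
        then have "1 \<le> amp u" "1 / W \<le> amp (\<zeta> - u)"
          using W_pos by (auto simp: amp_def add_divide_distrib)
        then have "1 * (1 / W) \<le> amp u * amp (\<zeta> - u)"
          using W_pos by (intro mult_mono) auto
        then show ?thesis using True by simp
      qed (simp add: amp_nonneg)
    qed
    finally have m: "q / 8 / W \<le> (LINT u|lborel. amp u * amp (\<zeta> - u))" .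
    have x: "N \<le> \<bar>fst \<zeta>\<bar>" using z gam_pos by (auto simp: E_def mem_brick)
    have "N / (2 * pi) ^ 3 * (t / 2 * (q / 8 / W)) \<le> \<bar>fst \<zeta>\<bar> / (2 * pi) ^ 3 * (t / 2 * (LINT u|lborel. amp u * amp (\<zeta> - u)))"
      using t N q_pos W_pos by (intro mult_mono divide_right_mono x mult_left_mono m) auto
    also have "\<dots> \<le> norm (p 1 t \<zeta>)" by (rule lower(1))
    finally have pl: "N / (2 * pi) ^ 3 * (t / 2 * (q / 8 / W)) \<le> norm (p 1 t \<zeta>)" .
    have wl: "W / ?d \<le> ?w \<zeta>" using weight_E[OF z] by (simp add: pos_divide_le_eq mult.commute)
    have "L = (W / ?d) * (N / (2 * pi) ^ 3 * (t / 2 * (q / 8 / W)))"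
      using W_pos by (simp add: L_def mult_ac)
    also have "\<dots> \<le> ?w \<zeta> * norm (p 1 t \<zeta>)"
      using N t q_pos W_pos sobolev_weight_pos[of s1 s2 \<zeta>] by (intro mult_mono wl pl) auto
    finally show ?thesis .
  qed
  have int: "integrable lborel (\<lambda>\<zeta>. (?w \<zeta> * norm (p 1 t \<zeta>))\<^sup>2)"
    using p_weighted_L2[of s1 s2 1 t] by (simp add: weighted_L2_def del: picard.simps)
  have "L\<^sup>2 * (q / 8) = (LINT \<zeta>|lborel. L\<^sup>2 * indicat_real E \<zeta>)" by (simp add: measures)
  also have "\<dots> \<le> (LINT \<zeta>|lborel. (?w \<zeta> * norm (p 1 t \<zeta>))\<^sup>2)"
  proof (rule integral_mono'[OF int])
    show "L\<^sup>2 * indicat_real E \<zeta> \<le> (?w \<zeta> * norm (p 1 t \<zeta>))\<^sup>2" for \<zeta>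
    proof (cases "\<zeta> \<in> E")
      case True
      then show ?thesis using power_mono[OF ptw[OF True] L0, of 2] by (simp del: picard.simps)
    qed simp
  qed simp
  also have "\<dots> = (weighted_L2_norm s1 s2 (p 1 t))\<^sup>2"
    by (simp add: weighted_L2_norm_def del: picard.simps)
  finally show ?thesis unfolding L_def .
qed

end

lemma N_sq_q: "N\<^sup>2 * q = N powr (11/4 - 5/4 * \<alpha>) / 4"
proof -
  have "sqrt \<gamma> = N powr ((1 - \<alpha>) / 4)"
    unfolding \<gamma>_def by (simp add: powr_half_sqrt[symmetric] powr_powr)
  then have "N\<^sup>2 * q = N powr 2 * (N powr ((1 - \<alpha>) / 2) * N powr (- \<alpha> / 2) * N powr ((1 - \<alpha>) / 4)) / 4"
    using N by (simp add: q_def \<gamma>_def \<kappa>_def)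
  also have "\<dots> = N powr (2 + ((1 - \<alpha>) / 2 + (- \<alpha> / 2) + (1 - \<alpha>) / 4)) / 4"
    by (simp only: powr_add)
  also have "2 + ((1 - \<alpha>) / 2 + (- \<alpha> / 2) + (1 - \<alpha>) / 4) = 11/4 - 5/4 * \<alpha>"
    by (simp add: field_simps)
  finally show ?thesis .
qed

end

text \<open>The squared estimate compares N^2 q^3 on the output side with q^2 on the data side, at
  fixed \<open>t\<close>. It would bound N^2 q uniformly in \<open>N\<close>, but this grows with
  the exponent \<delta>, which is positive for \<alpha> < 11/5.\<close>

lemma no_quadratic_estimate:
  assumes alpha: "2 \<le> \<alpha>" "\<alpha> < 11/5" and T: "0 < T" and K: "0 \<le> K"
    and est: "\<And>A R f t. kp_data A R f \<Longrightarrow> (\<And>\<zeta>. f (- \<zeta>) = cnj (f \<zeta>)) \<Longrightarrow> \<bar>t\<bar> \<le> T \<Longrightarrow>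
      2 * weighted_L2_norm s1 s2 (picard \<alpha> f 1 t) \<le> K * (weighted_L2_norm s1 s2 f)\<^sup>2"
  shows False
proof -
  define t where "t = min T (1/300)"
  have t: "0 < t" "t \<le> 1/300" "\<bar>t\<bar> \<le> T" using T by (simp_all add: t_def)
  define c where "c = (4 powr (\<bar>s1\<bar> + \<bar>s2\<bar>))\<^sup>2"
  define d where "d = 16 * (2 * pi) ^ 3 * 2 powr (\<bar>s1\<bar> + \<bar>s2\<bar>)"
  have c: "0 < c" and d: "0 < d" by (simp_all add: c_def d_def)
  define M where "M = 2 * (K * (16 * c))\<^sup>2 * d\<^sup>2 / t\<^sup>2"
  define \<delta> where "\<delta> = 11/4 - 5/4 * \<alpha>"
  have delta: "0 < \<delta>" using alpha by (simp add: \<delta>_def)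
  have bound: "N powr \<delta> / 4 \<le> M" if N: "10 \<le> N" for N
  proof -
    interpret resonance \<alpha> N by unfold_locales (use alpha N in auto)
    let ?f = "\<lambda>\<zeta>. complex_of_real (amp s1 s2 \<zeta>)"
    let ?n = "weighted_L2_norm s1 s2 (picard \<alpha> ?f 1 t)"
    obtain A R where dat: "kp_data A R ?f" using kp_data_amp by blast
    have "2 * ?n \<le> K * (weighted_L2_norm s1 s2 ?f)\<^sup>2"
      by (rule est[OF dat _ t(3)]) (simp add: amp_minus)
    also have "\<dots> \<le> K * (16 * c * q)"
      unfolding c_def by (rule mult_left_mono[OF amp_norm_le K])
    finally have "(2 * ?n)\<^sup>2 \<le> (K * (16 * c * q))\<^sup>2"
      by (rule power_mono) (simp add: weighted_L2_norm_nonneg)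
    moreover have "(N * t * q / d)\<^sup>2 * (q / 8) \<le> ?n\<^sup>2"
      unfolding d_def by (rule picard_amp_norm_ge[OF t(1,2)])
    moreover have "(2 * ?n)\<^sup>2 = 4 * ?n\<^sup>2" by (simp only: power_mult_distrib) simp
    ultimately have "4 * ((N * t * q / d)\<^sup>2 * (q / 8)) \<le> (K * (16 * c * q))\<^sup>2"
      by linarith
    \<comment> \<open>Regrouped so that q^2 can be cancelled; the third factor q stays with
      N^2.\<close>
    then have "((N\<^sup>2 * q) * (t\<^sup>2 / d\<^sup>2 / 2)) * q\<^sup>2 \<le> (K * (16 * c))\<^sup>2 * q\<^sup>2"
      by (simp add: power2_eq_square field_simps)
    then have "(N\<^sup>2 * q) * (t\<^sup>2 / d\<^sup>2 / 2) \<le> (K * (16 * c))\<^sup>2"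
      by (rule mult_right_le_imp_le) (use q_pos in simp)
    then have "N\<^sup>2 * q \<le> M"
      using t(1) d by (simp add: M_def field_simps)
    then show ?thesis by (simp add: N_sq_q \<delta>_def)
  qed
  \<comment> \<open>The second entry makes the \<delta>-th power of \<open>N\<close> at least |4 M|
    + 1, which exceeds 4 M.\<close>
  define N where "N = max 10 ((\<bar>4 * M\<bar> + 1) powr (1 / \<delta>))"
  have "\<bar>4 * M\<bar> + 1 = ((\<bar>4 * M\<bar> + 1) powr (1 / \<delta>)) powr \<delta>"
    using delta by (simp add: powr_powr)
  also have "\<dots> \<le> N powr \<delta>"
    by (rule powr_mono2) (use delta in \<open>auto simp: N_def\<close>)
  finally have "\<bar>4 * M\<bar> + 1 \<le> N powr \<delta>" .
  moreover have "N powr \<delta> / 4 \<le> M" by (rule bound) (simp add: N_def)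
  ultimately show False by simp
qed

theorem theoremB1:
  fixes \<alpha> s1 s2 :: real and X :: "distribution nspace"
  assumes "\<alpha> \<in> {2..<15/7}"
    and "X = sobolev s1 s2 \<or> X = real_sobolev s1 s2"
  shows "\<not> (\<exists>T>0. \<exists>\<Gamma> :: distribution \<Rightarrow> real \<Rightarrow> distribution.
           (\<exists>r>0. \<forall>u0\<in>points X. nrm X u0 < r \<longrightarrow>
              kp_solution \<alpha> X T u0 (\<Gamma> u0) \<and> (\<forall>v. kp_solution \<alpha> X T u0 v \<longrightarrow> v = \<Gamma> u0)) \<and>
           C2_differentiable_at X (continuous_curves T X) \<Gamma> 0)"
proof (intro notI, elim exE conjE)
  fix T r :: real and \<Gamma> :: "distribution \<Rightarrow> real \<Rightarrow> distribution"
  assume T: "0 < T" and r: "0 < r"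
    and flow: "\<forall>u0\<in>points X. nrm X u0 < r \<longrightarrow>
              kp_solution \<alpha> X T u0 (\<Gamma> u0) \<and> (\<forall>v. kp_solution \<alpha> X T u0 v \<longrightarrow> v = \<Gamma> u0)"
    and C2: "C2_differentiable_at X (continuous_curves T X) \<Gamma> 0"
  show False
  proof (rule quadratic_estimate[OF assms(2) T r _ C2])
    show "v = \<Gamma> u" if "u \<in> points X" "nrm X u < r" "kp_solution \<alpha> X T u v" for u v
      using flow that by blast
    fix K assume "0 \<le> K" "\<And>A R f t. kp_data A R f \<Longrightarrow> (\<And>\<zeta>. f (- \<zeta>) = cnj (f \<zeta>)) \<Longrightarrow> \<bar>t\<bar> \<le> T \<Longrightarrow>
      2 * weighted_L2_norm s1 s2 (picard \<alpha> f 1 t) \<le> K * (weighted_L2_norm s1 s2 f)\<^sup>2"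
    then show False
      using assms(1) by (intro no_quadratic_estimate[OF _ _ T, of \<alpha> K s1 s2]) auto
  qed
qed

end
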